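(* There exists a multiplicative function $f:\mathbb{N}\to\{-1,0,1\}$ resembling the Möbius function such that $M_f(x)=o(\sqrt{x})$ as $x\to\infty$. Further, assuming the Riemann hypothesis, there exists a multiplicative function $f$ resembling the Möbius function such that $M_f(x)=o(x^{2/5+\epsilon})$ for every $\epsilon>0$.
   Context: A function $f:\mathbb{N}\to\mathbb{C}$ resembles the Möbius function $\mu$ if $f$ is multiplicative, supported on the squarefree integers (i.e. $f(n)=0$ whenever $n$ is divisible by a square $d^2>1$), and $f(p)\in\{+1,-1\}$ for every prime $p$. $M_f(x):=\sum_{n\leq x}f(n)$. $f(x)=o(g(x))$ means $\lim_{x\to\infty}f(x)/g(x)=0$. *)

theory Defs
  imports
    "HOL-Complex_Analysis.Complex_Analysis"
    "HOL-Library.Landau_Symbols"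
    "HOL-Computational_Algebra.Computational_Algebra"
begin

section \<open>Functions resembling the Moebius function\<close>

text \<open>
  Arithmetic functions live on the positive integers, so their value at
  \<open>0 :: nat\<close> is never constrained or used.
\<close>

definition multiplicative_function :: "(nat \<Rightarrow> complex) \<Rightarrow> bool" where
  "multiplicative_function f \<longleftrightarrow>
     f 1 = 1 \<and> (\<forall>m n. m > 0 \<longrightarrow> n > 0 \<longrightarrow> coprime m n \<longrightarrow> f (m * n) = f m * f n)"

definition resembles_moebius :: "(nat \<Rightarrow> complex) \<Rightarrow> bool" where
  "resembles_moebius f \<longleftrightarrow>
     multiplicative_function f \<and>
     (\<forall>n>0. \<not> squarefree n \<longrightarrow> f n = 0) \<and>
     (\<forall>p. prime p \<longrightarrow> f p \<in> {1, -1})"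

definition partial_sums :: "(nat \<Rightarrow> complex) \<Rightarrow> real \<Rightarrow> complex" where
  "partial_sums f x = (\<Sum>n | 1 \<le> n \<and> real n \<le> x. f n)"


section \<open>The Riemann zeta function and the Riemann hypothesis\<close>

definition is_zeta_continuation :: "(complex \<Rightarrow> complex) \<Rightarrow> bool" where
  "is_zeta_continuation Z \<longleftrightarrow>
     Z holomorphic_on (- {1}) \<and>
     (\<forall>s. Re s > 1 \<longrightarrow> Z s = (\<Sum>n. 1 / of_nat (Suc n) powr s))"

text \<open>
  The analytic continuation exists and is unique on \<open>- {1}\<close>
  (see \<open>is_zeta_continuation_riemann_zeta\<close> and \<open>riemann_zeta_unique\<close>);
  the conjunct \<open>Z 1 = 0\<close> only fixes a dummy value at the pole.
\<close>

definition riemann_zeta :: "complex \<Rightarrow> complex" where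
  "riemann_zeta = (THE Z. is_zeta_continuation Z \<and> Z 1 = 0)"

definition riemann_hypothesis :: bool where
  "riemann_hypothesis \<longleftrightarrow>
     (\<forall>s. riemann_zeta s = 0 \<longrightarrow> 0 < Re s \<longrightarrow> Re s < 1 \<longrightarrow> Re s = 1 / 2)"

section \<open>Existence and uniqueness of the analytic continuation\<close>

text \<open>
  Summing the Taylor expansion of \<open>(n + 1) powr (1 - s)\<close> around \<open>n\<close>, truncated at order \<open>K\<close>,
  over all \<open>n\<close> expresses \<open>(s - 1) * zD s\<close> by its values at \<open>s + 1, \<dots>, s + K - 1\<close> and the
  series of remainders \<open>zR K n s\<close>, which is holomorphic for \<open>Re s > 1 - K\<close>.  This extends
  \<open>(s - 1) * zD s\<close> one unit strip at a time.
\<close>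

definition zP :: "nat \<Rightarrow> complex \<Rightarrow> complex" where
  "zP i s = (\<Prod>k<i. 1 - s - of_nat k)"

definition zR :: "nat \<Rightarrow> nat \<Rightarrow> complex \<Rightarrow> complex" where
  "zR K n s = of_nat (Suc (Suc n)) powr (1 - s) -
     (\<Sum>j\<le>K. zP j s / fact j * of_nat (Suc n) powr (1 - s - of_nat j))"

lemma zP_Suc: "zP (Suc i) s = zP i s * (1 - s - of_nat i)"
  by (simp add: zP_def)

lemma holomorphic_zP [holomorphic_intros]: "zP i holomorphic_on A"
  unfolding zP_def by (intro holomorphic_intros)

lemma holomorphic_zR: "zR K n holomorphic_on A"
proof -
  have "of_nat (Suc m) \<notin> \<real>\<^sub>\<le>\<^sub>0" for m
    using nonpos_Reals_cases by (auto simp del: of_nat_Suc simp: complex_nonpos_Reals_iff)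
  moreover have nz: "(of_nat (Suc m) :: complex) \<noteq> 0" for m by (simp del: of_nat_Suc)
  ultimately show ?thesis
    unfolding zR_def by (intro holomorphic_intros) (auto simp del: of_nat_Suc)
qed

lemma zR_bound:
  assumes "1 - Re s \<le> real K + 1"
  shows "norm (zR K n s) \<le> norm (zP (Suc K) s) / fact K * real (Suc n) powr (- Re s - real K)"
proof -
  define S where "S = closed_segment (of_nat (Suc n)) (of_nat (Suc (Suc n)) :: complex)"
  define F where "F = (\<lambda>i z. zP i s * z powr (1 - s - of_nat i))"
  have S: "z \<in> \<real> \<and> Re z \<ge> real (Suc n)" if "z \<in> S" for z
  proof -
    from that obtain u where u: "0 \<le> u" "u \<le> 1"
      "z = (1 - u) *\<^sub>R of_nat (Suc n) + u *\<^sub>R of_nat (Suc (Suc n))"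
      unfolding S_def closed_segment_def by blast
    have "z = complex_of_real (real (Suc n) + u)"
      by (simp add: u scaleR_conv_of_real algebra_simps)
    then show ?thesis using u(1) by simp
  qed
  have "norm (F 0 (of_nat (Suc (Suc n))) - (\<Sum>i\<le>K. F i (of_nat (Suc n)) *
           (of_nat (Suc (Suc n)) - of_nat (Suc n)) ^ i / fact i))
        \<le> (norm (zP (Suc K) s) * real (Suc n) powr (- Re s - real K)) *
            norm (of_nat (Suc (Suc n)) - of_nat (Suc n) :: complex) ^ Suc K / fact K"
  proof (rule complex_Taylor)
    show "convex S" unfolding S_def by simp
    show "(F i has_field_derivative F (Suc i) z) (at z within S)" if "z \<in> S" for i z
    proof -
      have "z \<notin> \<real>\<^sub>\<le>\<^sub>0" using S[OF that] by (auto simp: complex_nonpos_Reals_iff)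
      then show ?thesis unfolding F_def
        by (auto intro!: derivative_eq_intros simp: zP_Suc algebra_simps)
    qed
    show "norm (F (Suc K) z) \<le> norm (zP (Suc K) s) * real (Suc n) powr (- Re s - real K)"
      if "z \<in> S" for z
    proof -
      have "norm (z powr (1 - s - of_nat (Suc K))) = Re z powr (- Re s - real K)"
        using S[OF that] by (subst norm_powr_real_powr) (auto)
      also have "\<dots> \<le> real (Suc n) powr (- Re s - real K)"
        using S[OF that] assms by (intro powr_mono2') auto
      finally show ?thesis by (simp add: F_def norm_mult mult_left_mono)
    qed
  qed (auto simp: S_def)
  then show ?thesis
    by (simp add: F_def zR_def zP_def[of 0] field_simps)
qed

lemma summable_zR:
  assumes "Re s > 1 - real K"
  shows "summable (\<lambda>n. zR K n s)"
proof (rule summable_comparison_test')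
  show "norm (zR K n s) \<le> norm (zP (Suc K) s) / fact K * real (Suc n) powr (- Re s - real K)"
    if "n \<ge> 0" for n
    using assms by (intro zR_bound) auto
  have "summable (\<lambda>n. real n powr (- Re s - real K))"
    using assms by (subst summable_real_powr_iff) auto
  then show "summable (\<lambda>n. norm (zP (Suc K) s) / fact K * real (Suc n) powr (- Re s - real K))"
    by (intro summable_mult) (subst summable_Suc_iff[of "\<lambda>n. real n powr (- Re s - real K)"])
qed

lemma holomorphic_suminf_zR:
  "(\<lambda>s. \<Sum>n. zR K n s) holomorphic_on {s. Re s > 1 - real K}"
proof (rule holomorphic_uniform_sequence)
  show "open {s. Re s > 1 - real K}" by (rule open_halfspace_Re_gt)
  show "(\<lambda>s. \<Sum>n<N. zR K n s) holomorphic_on {s. Re s > 1 - real K}" for N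
    by (intro holomorphic_intros holomorphic_zR)
  fix x assume x: "x \<in> {s. Re s > 1 - real K}"
  define d where "d = (Re x - (1 - real K)) / 2"
  define c where "c = Re x - d"
  have d: "d > 0" and c: "c > 1 - real K" using x by (auto simp: d_def c_def field_simps)
  have Re: "Re s \<ge> c" if "s \<in> cball x d" for s
  proof -
    have "\<bar>Re (x - s)\<bar> \<le> norm (x - s)" by (rule abs_Re_le_cmod)
    also have "\<dots> \<le> d" using that by (simp add: dist_norm)
    finally show ?thesis by (simp add: c_def)
  qed
  have "continuous_on (cball x d) (zP (Suc K))"
    by (intro holomorphic_on_imp_continuous_on holomorphic_zP)
  then have "bounded (zP (Suc K) ` cball x d)"
    by (intro compact_imp_bounded compact_continuous_image) auto
  then obtain B where B: "\<And>s. s \<in> cball x d \<Longrightarrow> norm (zP (Suc K) s) \<le> B"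
    unfolding bounded_iff by blast
  have "uniform_limit (cball x d) (\<lambda>N s. \<Sum>n<N. zR K n s) (\<lambda>s. \<Sum>n. zR K n s) sequentially"
  proof (rule Weierstrass_m_test)
    fix n s assume s: "s \<in> cball x d"
    have "norm (zR K n s) \<le> norm (zP (Suc K) s) / fact K * real (Suc n) powr (- Re s - real K)"
      using Re[OF s] c by (intro zR_bound) auto
    also have "\<dots> \<le> B / fact K * real (Suc n) powr (- c - real K)"
      using Re[OF s] order_trans[OF norm_ge_zero B[OF s]] B[OF s]
      by (intro mult_mono divide_right_mono powr_mono) auto
    finally show "norm (zR K n s) \<le> B / fact K * real (Suc n) powr (- c - real K)" .
  next
    have "summable (\<lambda>n. real n powr (- c - real K))"
      using c by (subst summable_real_powr_iff) auto
    then show "summable (\<lambda>n. B / fact K * real (Suc n) powr (- c - real K))"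
      by (intro summable_mult) (subst summable_Suc_iff[of "\<lambda>n. real n powr (- c - real K)"])
  qed
  then show "\<exists>d>0. cball x d \<subseteq> {s. Re s > 1 - real K} \<and>
      uniform_limit (cball x d) (\<lambda>N s. \<Sum>n<N. zR K n s) (\<lambda>s. \<Sum>n. zR K n s) sequentially"
    using d c Re by (intro exI[of _ d]) fastforce
qed

definition zD :: "complex \<Rightarrow> complex" where
  "zD s = (\<Sum>n. 1 / of_nat (Suc n) powr s)"

lemma zD_sums:
  assumes "Re s > 1"
  shows "(\<lambda>n. of_nat (Suc n) powr (- s)) sums zD s"
proof -
  have "summable (\<lambda>n. real n powr (- Re s))"
    using assms by (subst summable_real_powr_iff) auto
  then have "summable (\<lambda>n. real (Suc n) powr (- Re s))"
    by (subst summable_Suc_iff[of "\<lambda>n. real n powr (- Re s)"])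
  moreover have "norm (of_nat (Suc n) powr (- s)) = real (Suc n) powr (- Re s)" for n
    by (subst norm_powr_real_powr) (auto simp del: of_nat_Suc)
  ultimately have "summable (\<lambda>n. of_nat (Suc n) powr (- s) :: complex)"
    by (intro summable_norm_cancel[of "\<lambda>n. of_nat (Suc n) powr (- s)"]) (simp only:)
  then show ?thesis
    unfolding zD_def powr_minus_divide [symmetric] by (rule summable_sums)
qed

lemma zD_recurrence:
  assumes s: "Re s > 1" and K: "K \<ge> 1"
  shows "(s - 1) * zD s = 1 - (\<Sum>i\<in>{1..<K}. zP i s / fact (Suc i) * ((s + of_nat i - 1) * zD (s + of_nat i)))
           + (\<Sum>n. zR K n s)"
proof -
  define G where "G = (\<lambda>n. of_nat (Suc n) powr (1 - s) :: complex)"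
  have "(\<lambda>n. real (Suc n) powr (1 - Re s)) \<longlonglongrightarrow> 0"
    using s by (intro tendsto_neg_powr filterlim_compose[OF filterlim_real_sequentially] filterlim_Suc) auto
  moreover have "norm (G n) = real (Suc n) powr (1 - Re s)" for n
    unfolding G_def by (subst norm_powr_real_powr) (auto simp del: of_nat_Suc)
  ultimately have "G \<longlonglongrightarrow> 0"
    by (intro tendsto_norm_zero_cancel[of G]) simp
  from telescope_sums[OF this] have A: "(\<lambda>n. G (Suc n) - G n) sums (- 1)"
    by (simp add: G_def)
  have B: "(\<lambda>n. \<Sum>i<K. zP (Suc i) s / fact (Suc i) * of_nat (Suc n) powr (- (s + of_nat i)))
          sums (\<Sum>i<K. zP (Suc i) s / fact (Suc i) * zD (s + of_nat i))"
    using s by (intro sums_sum sums_mult zD_sums) auto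
  have "{..K} = insert 0 (Suc ` {..<K})"
    using lessThan_Suc_eq_insert_0 lessThan_Suc_atMost by metis
  then have "zR K n s = G (Suc n) - G n -
      (\<Sum>i<K. zP (Suc i) s / fact (Suc i) * of_nat (Suc n) powr (- (s + of_nat i)))" for n
    by (simp add: zR_def G_def sum.reindex zP_def[of 0] algebra_simps del: fact_Suc)
  with sums_diff[OF A B] have "(\<lambda>n. zR K n s) sums
      (- 1 - (\<Sum>i<K. zP (Suc i) s / fact (Suc i) * zD (s + of_nat i)))"
    by simp
  then have C: "(\<Sum>n. zR K n s) = - 1 - (\<Sum>i<K. zP (Suc i) s / fact (Suc i) * zD (s + of_nat i))"
    by (simp add: sums_iff)
  have "{..<K} = insert 0 {1..<K}" using K by auto
  then have "(\<Sum>i<K. zP (Suc i) s / fact (Suc i) * zD (s + of_nat i)) = 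
      (1 - s) * zD s + (\<Sum>i\<in>{1..<K}. zP (Suc i) s / fact (Suc i) * zD (s + of_nat i))"
    by (simp add: zP_def)
  also have "(\<Sum>i\<in>{1..<K}. zP (Suc i) s / fact (Suc i) * zD (s + of_nat i)) =
     - (\<Sum>i\<in>{1..<K}. zP i s / fact (Suc i) * ((s + of_nat i - 1) * zD (s + of_nat i)))"
    unfolding sum_negf [symmetric]
    by (intro sum.cong refl) (simp add: zP_Suc divide_simps del: fact_Suc, simp add: algebra_simps)
  finally have "(\<Sum>i<K. zP (Suc i) s / fact (Suc i) * zD (s + of_nat i)) = (1 - s) * zD s +
     - (\<Sum>i\<in>{1..<K}. zP i s / fact (Suc i) * ((s + of_nat i - 1) * zD (s + of_nat i)))" .
  note C [unfolded this]
  moreover have "(s - 1) * d = 1 - X + Y" if "Y = - 1 - ((1 - s) * d + - X)" for d X Y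
    using that by (simp add: algebra_simps)
  ultimately show ?thesis by blast
qed

lemma zeta_continuation_halfplane:
  "\<exists>h. h holomorphic_on {s. Re s > - real m} \<and> (\<forall>s. Re s > 1 \<longrightarrow> h s = (s - 1) * zD s)"
proof (induction m)
  case 0
  show ?case
    using holomorphic_suminf_zR[of 1] zD_recurrence[of _ 1]
    by (intro exI[of _ "\<lambda>s. 1 + (\<Sum>n. zR 1 n s)"]) (auto intro!: holomorphic_intros)
next
  case (Suc m)
  then obtain h where h: "h holomorphic_on {s. Re s > - real m}"
    "\<And>s. Re s > 1 \<Longrightarrow> h s = (s - 1) * zD s" by blast
  define K where "K = m + 2"
  define g where "g = (\<lambda>s. 1 - (\<Sum>i\<in>{1..<K}. zP i s / fact (Suc i) * h (s + of_nat i)) + (\<Sum>n. zR K n s))"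
  have "(\<lambda>s. h (s + of_nat i)) holomorphic_on {s. Re s > - real (Suc m)}" if "i \<in> {1..<K}" for i
    using that by (intro holomorphic_on_compose_gen[OF _ h(1), unfolded o_def] holomorphic_intros) auto
  moreover have "(\<lambda>s. \<Sum>n. zR K n s) holomorphic_on {s. Re s > - real (Suc m)}"
    using holomorphic_suminf_zR[of K] by (rule holomorphic_on_subset) (auto simp: K_def)
  ultimately have "g holomorphic_on {s. Re s > - real (Suc m)}"
    unfolding g_def by (intro holomorphic_intros) (auto simp del: fact_Suc)
  moreover have "g s = (s - 1) * zD s" if "Re s > 1" for s
  proof -
    have "h (s + of_nat i) = (s + of_nat i - 1) * zD (s + of_nat i)" for i
      using that by (intro h(2)) auto
    moreover have "K \<ge> 1" by (simp add: K_def)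
    ultimately show ?thesis
      unfolding g_def by (simp only: zD_recurrence[OF that])
  qed
  ultimately show ?case by blast
qed

lemma zeta_continuation_entire:
  "\<exists>h. h holomorphic_on UNIV \<and> (\<forall>s. Re s > 1 \<longrightarrow> h s = (s - 1) * zD s)"
proof -
  obtain H where H: "\<And>m. H m holomorphic_on {s. Re s > - real m}"
    "\<And>m s. Re s > 1 \<Longrightarrow> H m s = (s - 1) * zD s"
    using zeta_continuation_halfplane by metis
  have agree: "H m s = H n s" if "m \<le> n" "Re s > - real m" for m n s
  proof (rule analytic_continuation_open[of "{s. Re s > 1}" "{s. Re s > - real m}" "H m" "H n"])
    show "{s. 1 < Re s} \<noteq> {}" by (auto intro: exI[of _ 2])
    show "connected {s. - real m < Re s}"
      by (intro convex_connected convex_halfspace_Re_gt)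
    show "H n holomorphic_on {s. Re s > - real m}"
      using that by (intro holomorphic_on_subset[OF H(1)[of n]]) auto
  qed (use that H in \<open>auto intro: open_halfspace_Re_gt\<close>)
  define h where "h = (\<lambda>s. H (LEAST m. Re s > - real m) s)"
  have h: "h s = H m s" if "Re s > - real m" for s m
    unfolding h_def
  proof (rule agree)
    show "(LEAST m. - real m < Re s) \<le> m" using that by (rule Least_le)
    show "- real (LEAST m. - real m < Re s) < Re s"
      using that by (rule LeastI[of "\<lambda>m. - real m < Re s"])
  qed
  have "h holomorphic_on UNIV"
  proof -
    have "h field_differentiable (at s)" for s
    proof -
      obtain m where "- Re s < real m" using reals_Archimedean2 by blast
      then have m: "s \<in> {s. Re s > - real m}" by simp
      have "h holomorphic_on {s. Re s > - real m}"
        using H(1)[of m] by (rule holomorphic_transform) (simp add: h)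
      from holomorphic_on_imp_differentiable_at[OF this open_halfspace_Re_gt m] show ?thesis .
    qed
    then show ?thesis by (simp add: holomorphic_on_def field_differentiable_at_within)
  qed
  moreover have "h s = (s - 1) * zD s" if "Re s > 1" for s
    using h[of 0 s] H(2)[of s 0] that by simp
  ultimately show ?thesis by blast
qed

lemma zeta_continuation_unique:
  assumes "is_zeta_continuation Y" "is_zeta_continuation Z" "s \<noteq> 1"
  shows "Y s = Z s"
proof (rule analytic_continuation_open[of "{s. Re s > 1}" "- {1}" Y Z])
  show "{s. 1 < Re s} \<noteq> {}" by (auto intro: exI[of _ 2])
  show "connected (- {1::complex})" by (intro connected_punctured_universe) simp
qed (use assms in \<open>auto simp: is_zeta_continuation_def intro: open_halfspace_Re_gt\<close>)

lemma riemann_zeta_ex1: "\<exists>!Z. is_zeta_continuation Z \<and> Z 1 = 0"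
proof -
  obtain h where h: "h holomorphic_on UNIV" "\<And>s. Re s > 1 \<Longrightarrow> h s = (s - 1) * zD s"
    using zeta_continuation_entire by blast
  define Z where "Z = (\<lambda>s. h s / (s - 1))"
  have "Z holomorphic_on (- {1})"
    unfolding Z_def by (intro holomorphic_intros holomorphic_on_subset[OF h(1)]) auto
  moreover have "Z s = (\<Sum>n. 1 / of_nat (Suc n) powr s)" if "Re s > 1" for s
  proof -
    have "s \<noteq> 1" using that by auto
    then show ?thesis using h(2)[OF that] by (simp add: Z_def zD_def)
  qed
  ultimately have "is_zeta_continuation Z \<and> Z 1 = 0"
    by (simp add: is_zeta_continuation_def Z_def)
  moreover have "Y = Z" if "is_zeta_continuation Y \<and> Y 1 = 0" for Y
    using that calculation zeta_continuation_unique[of Y Z] by (metis ext)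
  ultimately show ?thesis by blast
qed

lemma is_zeta_continuation_riemann_zeta: "is_zeta_continuation riemann_zeta"
  using theI'[OF riemann_zeta_ex1] unfolding riemann_zeta_def by blast

lemma riemann_zeta_unique:
  assumes "is_zeta_continuation Z" "s \<noteq> 1"
  shows "Z s = riemann_zeta s"
  using zeta_continuation_unique[OF assms(1) is_zeta_continuation_riemann_zeta assms(2)] .

end

theory Submission
  imports Defs "HOL-Probability.Probability"
begin

text \<open>
  Let \<open>g\<close> be completely multiplicative, equal to the nonprincipal character modulo 3 away from 3
  and with \<open>g 3 = 1\<close>; its partial sums grow only logarithmically.  The function \<open>f = \<mu>\<^sup>2 g\<close>
  resembles the Moebius function, and since \<open>g (d\<^sup>2) = 1\<close> the partial sum of \<open>f\<close> up to \<open>x\<close> is the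
  sum of \<open>\<mu> d * g m\<close> over \<open>d\<^sup>2 m \<le> x\<close>.  Splitting at \<open>m \<le> T\<close> bounds it by the values
  \<open>M (sqrt (x / m))\<close>, \<open>m \<le> T\<close>, of the Mertens function, up to an error that beats \<open>sqrt x\<close> by
  almost \<open>sqrt T\<close>.  It remains to see that \<open>M x = o(x)\<close>, and that \<open>M x = O(x powr (1/2 + \<delta>))\<close> under the
  Riemann hypothesis; in the latter case \<open>T = x powr (1/5)\<close> is optimal.

  Convolving \<open>M (exp v)\<close> with a Gaussian of width \<open>\<kappa>\<close> turns the Laplace transform
  \<open>1 / (s \<zeta>(s))\<close> into an absolutely convergent vertical integral, and \<open>M\<close> varies so slowly that
  this changes \<open>M (exp u)\<close> by at most \<open>1 + 9 \<kappa> exp u\<close>.  For the unconditional bound \<open>\<kappa>\<close> is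
  fixed, the integral is moved to \<open>Re s = 1\<close>, where \<open>1 / \<zeta>\<close> has polynomial growth by the 3-4-1
  inequality, and the Riemann-Lebesgue lemma applies.  Under the Riemann hypothesis it is moved to
  \<open>Re s = b\<close> with \<open>b > 1/2\<close>, where \<open>1 / \<zeta>\<close> grows more slowly than any power, and
  \<open>\<kappa> = exp (- u)\<close>.
\<close>


section \<open>The Moebius function and a completely multiplicative extension of the character modulo 3\<close>

text \<open>Values at primes must be +1 or -1, so the character itself, which vanishes at 3, is not
  admissible; giving 3 the value 1 costs at most one unit per base-3 digit of the cutoff, hence the
  logarithm. The terms with m > T contribute about sqrt x / sqrt T. Unconditionally T is a large
  constant, so that finitely many Mertens values occur and M x = o(x) suffices without a rate. With
  square-root bounds for M the terms with m \<le> T contribute about x^(1/4) T^(3/4); equating this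
  with x^(1/2) T^(-1/2) gives T = x^(1/5) and the exponent 2/5. To the right of 1 the inversion
  integral of 1 / (s zeta(s)) does not converge absolutely, which is why M is smoothed. Because |mu|
  \<le> 1, smoothing with width \<kappa> costs a relative error of order \<kappa>: a small constant
  is enough for o(x), while \<kappa> = exp (- u) makes the error bounded. In that case the Gaussian
  cuts off only at |t| near exp u, but 1 / (s zeta(s)) then misses integrability by an arbitrarily
  small power, so the loss is an arbitrarily small power of exp u.\<close>

definition moebius_mu :: "nat \<Rightarrow> int" where
  "moebius_mu n = (if squarefree n then (- 1) ^ card (prime_factors n) else 0)"

lemma abs_moebius_mu_le_1: "\<bar>moebius_mu n\<bar> \<le> 1"
  by (simp add: moebius_mu_def power_abs)

lemma squarefree_prod_primes:
  assumes "finite A" "\<And>p. p \<in> A \<Longrightarrow> prime (p::nat)"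
  shows "squarefree (\<Prod>A)" and "prime_factors (\<Prod>A) = A"
proof -
  show "squarefree (\<Prod>A)"
    using assms by (intro squarefree_prod_coprime) (auto intro: primes_coprime squarefree_prime)
  have "prime_factors (\<Prod>A) = (\<Union>p\<in>A. prime_factors p)"
    using assms by (subst prime_factors_prod) (auto dest: prime_gt_0_nat)
  also have "\<dots> = A"
    using assms by (auto simp: prime_prime_factors)
  finally show "prime_factors (\<Prod>A) = A" .
qed

text \<open>A squarefree integer is the product of its prime factors, so squarefree divisors of n
  amount to arbitrary sets of prime factors of n. This turns divisor sums of
  \<open>moebius_mu\<close> into sums over a power set.\<close>

lemma squarefree_divisors_bij:
  assumes "n > (0::nat)"
  shows "bij_betw prime_factors {d. d dvd n \<and> squarefree d} (Pow (prime_factors n))"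
proof (rule bij_betwI[where g = "\<lambda>A. \<Prod>A"])
  show "prime_factors \<in> {d. d dvd n \<and> squarefree d} \<rightarrow> Pow (prime_factors n)"
    using assms by (auto simp: in_prime_factors_iff intro: dvd_trans)
next
  show "Prod \<in> Pow (prime_factors n) \<rightarrow> {d. d dvd n \<and> squarefree d}"
  proof safe
    fix A assume A: "A \<subseteq> prime_factors n"
    then have fin: "finite A" using finite_subset by blast
    have pr: "prime p" if "p \<in> A" for p using A that by auto
    show "squarefree (\<Prod>A)" by (rule squarefree_prod_primes(1)[OF fin pr])
    have "\<Prod>A dvd \<Prod>(prime_factors n)"
      using A by (intro prod_dvd_prod_subset) auto
    also have "\<dots> dvd (\<Prod>p\<in>prime_factors n. p ^ multiplicity p n)"
      using assms by (intro prod_dvd_prod) (auto simp: prime_factors_multiplicity)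
    also have "\<dots> = n" using assms by (simp add: prod_prime_factors)
    finally show "\<Prod>A dvd n" .
  qed
next
  fix d assume d: "d \<in> {d. d dvd n \<and> squarefree d}"
  then have "d > 0" using assms by (auto intro: Nat.gr0I)
  have "d = (\<Prod>p\<in>prime_factors d. p ^ multiplicity p d)"
    using \<open>d > 0\<close> by (simp add: prod_prime_factors)
  also have "\<dots> = \<Prod>(prime_factors d)"
  proof (rule prod.cong)
    fix p assume "p \<in> prime_factors d"
    then have "multiplicity p d = 1" 
      using d squarefree_factorial_semiring'[of d] \<open>d > 0\<close> by auto
    then show "p ^ multiplicity p d = p" by simp
  qed auto
  finally show "\<Prod>(prime_factors d) = d" by simp
next
  fix A assume A: "A \<in> Pow (prime_factors n)"
  then have fin: "finite A" using finite_subset by blast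
  have pr: "prime p" if "p \<in> A" for p using A that by auto
  show "prime_factors (\<Prod>A) = A" by (rule squarefree_prod_primes(2)[OF fin pr])
qed

text \<open>After passage to sets of primes the sum is the expansion of the product of (-1 + 1) over
  the prime factors, which vanishes unless the product is empty.\<close>

lemma sum_moebius_mu_divisors:
  assumes "n > 0"
  shows "(\<Sum>d | d dvd n. moebius_mu d) = (if n = 1 then 1 else 0)"
proof -
  have fin: "finite {d. d dvd n}" using assms by simp
  have "(\<Sum>d | d dvd n. moebius_mu d) = (\<Sum>d | d dvd n \<and> squarefree d. (- 1) ^ card (prime_factors d))"
    using fin by (intro sum.mono_neutral_cong_right) (auto simp: moebius_mu_def)
  also have "\<dots> = (\<Sum>A\<in>Pow (prime_factors n). (- 1) ^ card A)"
    by (rule sum.reindex_bij_betw[OF squarefree_divisors_bij[OF assms]])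
  also have "\<dots> = (\<Sum>A\<in>Pow (prime_factors n). (\<Prod>p\<in>A. - 1) * (\<Prod>p\<in>prime_factors n - A. 1))"
    by simp
  also have "\<dots> = (\<Prod>p\<in>prime_factors n. - 1 + 1)"
    by (subst prod_add) auto
  also have "\<dots> = (if n = 1 then 1 else 0)"
    using assms by (simp add: card_gt_0_iff prime_factorization_empty_iff)
  finally show ?thesis .
qed

text \<open>Since d^2 divides n exactly when d divides the square part of n, this is the preceding
  identity at \<open>square_part n\<close>. It supplies the expansion of mu^2 in the
  reduction.\<close>

lemma sum_moebius_mu_square_divisors:
  assumes "n > 0"
  shows "(\<Sum>d | d\<^sup>2 dvd n. moebius_mu d) = (if squarefree n then 1 else 0)"
proof -
  have "{d. d\<^sup>2 dvd n} = {d. d dvd square_part n}"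
    by (simp add: dvd_square_part_iff)
  then have "(\<Sum>d | d\<^sup>2 dvd n. moebius_mu d) = (if square_part n = 1 then 1 else 0)"
    using assms sum_moebius_mu_divisors[of "square_part n"] by (simp add: neq0_conv [symmetric] del: neq0_conv)
  moreover have "square_part n = 1 \<longleftrightarrow> squarefree n"
  proof
    assume "square_part n = 1"
    then show "squarefree n" by (intro squarefreeI) (simp flip: dvd_square_part_iff)
  next
    assume "squarefree n"
    then show "square_part n = 1" using squarefreeD[of n "square_part n"] by auto
  qed
  ultimately show ?thesis by simp
qed

text \<open>The function g of the overview: factors 3 are stripped before the residue modulo 3 is
  read off, which is what gives 3 the value 1. The base case 0 makes the recursion terminate and is
  compatible with complete multiplicativity.\<close>

fun chi3 :: "nat \<Rightarrow> int" where
  "chi3 n = (if n = 0 then 0 else if 3 dvd n then chi3 (n div 3) else if n mod 3 = 1 then 1 else - 1)"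

declare chi3.simps [simp del]

lemma chi3_0 [simp]: "chi3 0 = 0" by (simp add: chi3.simps)

lemma chi3_not_dvd: "\<not> 3 dvd n \<Longrightarrow> chi3 n = (if n mod 3 = 1 then 1 else - 1)"
  by (cases "n = 0") (auto simp: chi3.simps[of n])

lemma chi3_3: "chi3 (3 * n) = chi3 n"
  by (cases "n = 0") (simp_all add: chi3.simps[of "3 * n"])

lemma chi3_in: "n > 0 \<Longrightarrow> chi3 n \<in> {1, - 1}"
proof (induction n rule: less_induct)
  case (less n)
  show ?case
  proof (cases "3 dvd n")
    case True
    then obtain k where "n = 3 * k" by auto
    then show ?thesis using less by (simp add: chi3_3)
  qed (simp add: chi3_not_dvd)
qed

text \<open>Strong induction on the product strips factors 3 from either argument. What remains is
  that the residues 1 and 2 form a group of order two, with 2 acting as the sign -1.\<close>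

lemma chi3_mult: "chi3 (m * n) = chi3 m * chi3 n"
proof (induction "m * n" arbitrary: m n rule: less_induct)
  case less
  consider "m = 0 \<or> n = 0" | "m > 0" "n > 0" "3 dvd m" | "m > 0" "n > 0" "3 dvd n" | "\<not> 3 dvd m" "\<not> 3 dvd n"
    by blast
  then show ?case
  proof cases
    case 2
    then obtain k where k: "m = 3 * k" by auto
    then have "chi3 (k * n) = chi3 k * chi3 n" using 2 by (intro less) auto
    then show ?thesis using k by (simp add: chi3_3 mult.assoc)
  next
    case 3
    then obtain k where k: "n = 3 * k" by auto
    then have "chi3 (m * k) = chi3 m * chi3 k" using 3 by (intro less) auto
    then show ?thesis using k by (simp add: chi3_3 mult.left_commute[of m 3 k])
  next
    case 4
    then have "\<not> 3 dvd m * n" by (simp add: prime_dvd_mult_iff)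
    moreover have "m mod 3 = 1 \<or> m mod 3 = 2" "n mod 3 = 1 \<or> n mod 3 = 2" using 4 by presburger+
    then have "(m * n) mod 3 = (if m mod 3 = n mod 3 then 1 else 2)"
      by (subst mod_mult_eq [symmetric]) auto
    ultimately show ?thesis using 4 \<open>m mod 3 = 1 \<or> m mod 3 = 2\<close> \<open>n mod 3 = 1 \<or> n mod 3 = 2\<close>
      by (auto simp: chi3_not_dvd)
  qed auto
qed

lemma chi3_square: "d > 0 \<Longrightarrow> chi3 (d\<^sup>2) = 1"
  using chi3_in[of d] by (auto simp: power2_eq_square chi3_mult)

text \<open>The multiples of 3 reproduce the sum at N div 3, because dividing by 3 does not change
  \<open>chi3\<close>. The other integers carry the signs + and - in turn, with an unmatched +
  exactly when N mod 3 = 1.\<close>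

lemma sum_chi3_step: "(\<Sum>n\<in>{1..N}. chi3 n) = (if N mod 3 = 1 then 1 else 0) + (\<Sum>n\<in>{1..N div 3}. chi3 n)"
proof (induction N)
  case (Suc N)
  have *: "(\<Sum>n\<in>{1..Suc N}. chi3 n) = (\<Sum>n\<in>{1..N}. chi3 n) + chi3 (Suc N)" by simp
  have "N mod 3 = 0 \<or> N mod 3 = 1 \<or> N mod 3 = 2" by presburger
  then consider "N mod 3 = 0" | "N mod 3 = 1" | "N mod 3 = 2" by argo
  then show ?case
  proof cases
    case 1
    then have "Suc N mod 3 = 1" "Suc N div 3 = N div 3" "\<not> 3 dvd Suc N" by presburger+
    then show ?thesis using 1 unfolding * Suc.IH by (simp add: chi3_not_dvd)
  next
    case 2
    then have "Suc N mod 3 = 2" "Suc N div 3 = N div 3" "\<not> 3 dvd Suc N" by presburger+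
    then show ?thesis using 2 unfolding * Suc.IH by (simp add: chi3_not_dvd)
  next
    case 3
    then have "Suc N mod 3 = 0" "Suc N div 3 = Suc (N div 3)" "Suc N = 3 * Suc (N div 3)" by presburger+
    then have "chi3 (Suc N) = chi3 (Suc (N div 3))" by (metis chi3_3)
    then show ?thesis using 3 \<open>Suc N mod 3 = 0\<close> \<open>Suc N div 3 = Suc (N div 3)\<close> unfolding * Suc.IH by simp
  qed
qed simp

text \<open>Iterating the recursion costs at most one unit per base-3 digit. The logarithm is
  recorded as an arbitrarily small power because powers are what gets summed later; the constant A
  solves A = 1 + 3^(-\<eta>) A, which closes the induction.\<close>

lemma sum_chi3_bound:
  fixes \<eta> :: real
  assumes "\<eta> > 0" "N > 0"
  shows "real_of_int \<bar>\<Sum>n\<in>{1..N}. chi3 n\<bar> \<le> real N powr \<eta> / (1 - 3 powr (- \<eta>))"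
  using assms(2)
proof (induction N rule: less_induct)
  case (less N)
  define A where "A = 1 / (1 - (3::real) powr (- \<eta>))"
  have p: "(3::real) powr (- \<eta>) < 1" using assms(1) by (intro powr_less_one) auto
  then have A1: "A \<ge> 1" and A2: "A * (1 - 3 powr (- \<eta>)) = 1" by (auto simp: A_def field_simps)
  have N1: "1 \<le> real N powr \<eta>" using assms less.prems by (intro ge_one_powr_ge_zero) auto
  show ?case
  proof (cases "N div 3 = 0")
    case True
    then have "\<bar>\<Sum>n\<in>{1..N}. chi3 n\<bar> \<le> 1" by (subst sum_chi3_step) auto
    then have "real_of_int \<bar>\<Sum>n\<in>{1..N}. chi3 n\<bar> \<le> 1 * 1" by linarith
    also have "\<dots> \<le> A * real N powr \<eta>" using A1 N1 by (intro mult_mono) auto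
    finally show ?thesis by (simp add: A_def)
  next
    case False
    have "\<bar>\<Sum>n\<in>{1..N}. chi3 n\<bar> \<le> 1 + \<bar>\<Sum>n\<in>{1..N div 3}. chi3 n\<bar>"
      by (subst sum_chi3_step) (auto simp: abs_if)
    then have "real_of_int \<bar>\<Sum>n\<in>{1..N}. chi3 n\<bar> \<le> 1 + real_of_int \<bar>\<Sum>n\<in>{1..N div 3}. chi3 n\<bar>"
      by linarith
    also have "\<dots> \<le> 1 + A * real (N div 3) powr \<eta>"
      using less.IH[of "N div 3"] less.prems False by (simp add: A_def)
    also have "\<dots> \<le> 1 + A * (real N / 3) powr \<eta>"
      using real_of_int_div4[of "int N" 3] A1 assms by (intro add_mono mult_left_mono powr_mono2) (auto simp: of_nat_div_le_of_nat)
    also have "(real N / 3) powr \<eta> = 3 powr (- \<eta>) * real N powr \<eta>"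
      by (simp add: powr_divide powr_minus_divide)
    also have "1 + A * (3 powr (- \<eta>) * real N powr \<eta>) = 1 - (A * (1 - 3 powr (- \<eta>))) * real N powr \<eta> + A * real N powr \<eta>"
      by (simp add: algebra_simps)
    also have "\<dots> \<le> A * real N powr \<eta>" unfolding A2 using N1 by simp
    finally show ?thesis by (simp add: A_def)
  qed
qed

section \<open>The sign function restricted to the squarefree integers\<close>

definition sqfree_chi :: "nat \<Rightarrow> int" where
  "sqfree_chi n = (if squarefree n then chi3 n else 0)"

lemma sqfree_chi_in: "sqfree_chi n \<in> {- 1, 0, 1}"
  using chi3_in[of n] by (cases "n = 0") (auto simp: sqfree_chi_def)

lemma resembles_moebius_sqfree_chi: "resembles_moebius (\<lambda>n. of_int (sqfree_chi n))"
  unfolding resembles_moebius_def multiplicative_function_def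
proof (intro conjI allI impI)
  show "of_int (sqfree_chi 1) = (1::complex)" by (simp add: sqfree_chi_def chi3_not_dvd)
  fix m n :: nat assume mn: "m > 0" "n > 0" "coprime m n"
  have "squarefree (m * n) \<longleftrightarrow> squarefree m \<and> squarefree n"
    using mn squarefree_mult_coprime squarefree_multD by blast
  then show "of_int (sqfree_chi (m * n)) = (of_int (sqfree_chi m) * of_int (sqfree_chi n) :: complex)"
    by (auto simp: sqfree_chi_def chi3_mult)
next
  fix p :: nat assume "prime p"
  then show "complex_of_int (sqfree_chi p) \<in> {1, - 1}"
    using chi3_in[of p] prime_gt_0_nat[of p] by (auto simp: sqfree_chi_def squarefree_prime)
qed (simp add: sqfree_chi_def)

section \<open>Reduction to the Mertens function\<close>

definition nats_upto :: "real \<Rightarrow> nat set" where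
  "nats_upto x = {n. 1 \<le> n \<and> real n \<le> x}"

lemma nats_upto_eq: "nats_upto x = {1..nat \<lfloor>x\<rfloor>}"
  unfolding nats_upto_def by (auto simp: le_nat_floor) linarith

lemma finite_nats_upto [simp]: "finite (nats_upto x)"
  by (simp add: nats_upto_eq)

lemma card_nats_upto_le: "x \<ge> 0 \<Longrightarrow> real (card (nats_upto x)) \<le> x"
  by (simp add: nats_upto_eq)

definition mertens :: "real \<Rightarrow> real" where
  "mertens x = (\<Sum>n\<in>nats_upto x. real_of_int (moebius_mu n))"

text \<open>Dirichlet's hyperbola method for the pairs with d^2 m \<le> x, cut at m = T. For m \<le>
  T the sum over d is a Mertens value; for m > T necessarily d \<le> sqrt (x / T), and m runs over
  the gap between T and x / d^2.\<close>

lemma sum_sqfree_chi_hyperbola: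
  assumes "x \<ge> 0" "T > 0"
  shows "(\<Sum>n\<in>nats_upto x. sqfree_chi n) = (\<Sum>m\<in>nats_upto T. chi3 m * (\<Sum>d\<in>nats_upto (sqrt (x / m)). moebius_mu d)) +
           (\<Sum>d\<in>nats_upto (sqrt (x / T)). moebius_mu d * ((\<Sum>m\<in>nats_upto (x / (real d)\<^sup>2). chi3 m) - (\<Sum>m\<in>nats_upto T. chi3 m)))"
proof -
  define P where "P = {(d, m). d \<ge> 1 \<and> m \<ge> 1 \<and> real (d\<^sup>2 * m) \<le> x}"
  define P1 where "P1 = {(d, m). d \<ge> 1 \<and> m \<ge> 1 \<and> real m \<le> T \<and> real (d\<^sup>2 * m) \<le> x}"
  define P2 where "P2 = {(d, m). d \<ge> 1 \<and> m \<ge> 1 \<and> real m > T \<and> real (d\<^sup>2 * m) \<le> x}"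
  have finP: "finite P"
  proof (rule finite_subset)
    show "P \<subseteq> nats_upto x \<times> nats_upto x"
    proof
      fix z assume "z \<in> P"
      then obtain d m where z: "z = (d, m)" "d \<ge> 1" "m \<ge> 1" "real (d\<^sup>2 * m) \<le> x" by (auto simp: P_def)
      have "d \<le> d\<^sup>2" using z by (simp add: power2_eq_square)
      also have "\<dots> \<le> d\<^sup>2 * m" using z by simp
      finally have "d \<le> d\<^sup>2 * m" .
      moreover have "m \<le> d\<^sup>2 * m" using z by simp
      ultimately have "real d \<le> x" "real m \<le> x" using z(4) by (metis of_nat_le_iff order_trans)+
      then show "z \<in> nats_upto x \<times> nats_upto x" using z by (simp add: nats_upto_def)
    qed
  qed auto
  have "(\<Sum>n\<in>nats_upto x. sqfree_chi n) = (\<Sum>n\<in>nats_upto x. \<Sum>d | d\<^sup>2 dvd n. moebius_mu d * chi3 (n div d\<^sup>2))"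
  proof (rule sum.cong)
    fix n assume "n \<in> nats_upto x"
    then have n: "n > 0" by (simp add: nats_upto_def)
    have "sqfree_chi n = (\<Sum>d | d\<^sup>2 dvd n. moebius_mu d) * chi3 n"
      using n by (simp add: sqfree_chi_def sum_moebius_mu_square_divisors)
    also have "\<dots> = (\<Sum>d | d\<^sup>2 dvd n. moebius_mu d * chi3 (n div d\<^sup>2))"
      unfolding sum_distrib_right
    proof (rule sum.cong)
      fix d assume "d \<in> {d. d\<^sup>2 dvd n}"
      then have "n = d\<^sup>2 * (n div d\<^sup>2)" by simp
      moreover have "d > 0" using \<open>d \<in> _\<close> n by (auto intro: Nat.gr0I)
      ultimately have "chi3 n = chi3 (n div d\<^sup>2)" by (metis chi3_mult chi3_square mult_1)
      then show "moebius_mu d * chi3 n = moebius_mu d * chi3 (n div d\<^sup>2)" by simp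
    qed simp
    finally show "sqfree_chi n = (\<Sum>d | d\<^sup>2 dvd n. moebius_mu d * chi3 (n div d\<^sup>2))" .
  qed simp
  also have "\<dots> = (\<Sum>(n, d)\<in>Sigma (nats_upto x) (\<lambda>n. {d. d\<^sup>2 dvd n}). moebius_mu d * chi3 (n div d\<^sup>2))"
  proof (rule sum.Sigma)
    have "finite {d. d\<^sup>2 dvd n}" if "n > 0" for n :: nat
      using that by (simp flip: dvd_square_part_iff neq0_conv)
    then show "\<forall>n\<in>nats_upto x. finite {d. d\<^sup>2 dvd n}" by (auto simp: nats_upto_def)
  qed simp
  also have "\<dots> = (\<Sum>(d, m)\<in>P. moebius_mu d * chi3 m)"
  proof (rule sum.reindex_bij_witness[where j = "\<lambda>(n, d). (d, n div d\<^sup>2)" and i = "\<lambda>(d, m). (d\<^sup>2 * m, d)"])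
    fix a assume "a \<in> Sigma (nats_upto x) (\<lambda>n. {d. d\<^sup>2 dvd n})"
    then obtain n d where n: "a = (n, d)" "n \<in> nats_upto x" "d\<^sup>2 dvd n" by auto
    from n(3) obtain k where k: "n = d\<^sup>2 * k" ..
    have a: "a = (d\<^sup>2 * k, d)" "d\<^sup>2 * k \<ge> 1" "real (d\<^sup>2 * k) \<le> x"
      using n(1,2) unfolding nats_upto_def k by auto
    then have "d > 0" "k > 0" by (auto intro!: Nat.gr0I)
    then show "(case case a of (n, d) \<Rightarrow> (d, n div d\<^sup>2) of (d, m) \<Rightarrow> (d\<^sup>2 * m, d)) = a"
      "(case a of (n, d) \<Rightarrow> (d, n div d\<^sup>2)) \<in> P"
      "(case case a of (n, d) \<Rightarrow> (d, n div d\<^sup>2) of (d, m) \<Rightarrow> moebius_mu d * chi3 m) = (case a of (n, d) \<Rightarrow> moebius_mu d * chi3 (n div d\<^sup>2))"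
      using a by (auto simp: P_def)
  qed (auto simp: P_def nats_upto_def)
  also have "P = P1 \<union> P2" by (auto simp: P_def P1_def P2_def)
  also have "(\<Sum>(d, m)\<in>P1 \<union> P2. moebius_mu d * chi3 m) = (\<Sum>(d, m)\<in>P1. moebius_mu d * chi3 m) + (\<Sum>(d, m)\<in>P2. moebius_mu d * chi3 m)"
    by (rule sum.union_disjoint) (auto intro: finite_subset[OF _ finP] simp: P_def P1_def P2_def)
  also have "(\<Sum>(d, m)\<in>P1. moebius_mu d * chi3 m) =
      (\<Sum>(m, d)\<in>Sigma (nats_upto T) (\<lambda>m. nats_upto (sqrt (x / m))). chi3 m * moebius_mu d)"
  proof (rule sum.reindex_bij_witness[where j = prod.swap and i = prod.swap])
    fix a assume "a \<in> P1"
    then show "prod.swap a \<in> Sigma (nats_upto T) (\<lambda>m. nats_upto (sqrt (x / m)))"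
      by (auto simp: P1_def nats_upto_def field_simps intro!: real_le_rsqrt)
  next
    fix b assume "b \<in> Sigma (nats_upto T) (\<lambda>m. nats_upto (sqrt (x / m)))"
    then obtain m d where b: "b = (m, d)" "m \<ge> 1" "real m \<le> T" "d \<ge> 1" "real d \<le> sqrt (x / m)"
      by (auto simp: nats_upto_def)
    have "(real d)\<^sup>2 \<le> x / m" using b assms power_mono[OF b(5), of 2] by simp
    then show "prod.swap b \<in> P1" using b by (auto simp: P1_def field_simps)
  qed auto
  also have "\<dots> = (\<Sum>m\<in>nats_upto T. chi3 m * (\<Sum>d\<in>nats_upto (sqrt (x / m)). moebius_mu d))"
    by (subst sum.Sigma [symmetric]) (auto simp: sum_distrib_left)
  also have "(\<Sum>(d, m)\<in>P2. moebius_mu d * chi3 m) =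
      (\<Sum>(d, m)\<in>Sigma (nats_upto (sqrt (x / T))) (\<lambda>d. nats_upto (x / (real d)\<^sup>2) - nats_upto T). moebius_mu d * chi3 m)"
  proof (rule sum.cong)
    show "P2 = Sigma (nats_upto (sqrt (x / T))) (\<lambda>d. nats_upto (x / (real d)\<^sup>2) - nats_upto T)"
    proof safe
      fix d m assume "(d, m) \<in> P2"
      then have dm: "d \<ge> 1" "m \<ge> 1" "real m > T" "real (d\<^sup>2 * m) \<le> x" by (auto simp: P2_def)
      have "(real d)\<^sup>2 * T \<le> (real d)\<^sup>2 * m" using dm by (intro mult_left_mono) auto
      also have "\<dots> \<le> x" using dm by simp
      finally have "(real d)\<^sup>2 \<le> x / T" using assms by (simp add: field_simps)
      then show "d \<in> nats_upto (sqrt (x / T))" using dm by (auto simp: nats_upto_def intro!: real_le_rsqrt)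
      show "m \<in> nats_upto (x / (real d)\<^sup>2)" using dm by (auto simp: nats_upto_def field_simps)
      show False if "m \<in> nats_upto T" using that dm by (auto simp: nats_upto_def)
    next
      fix d m assume "d \<in> nats_upto (sqrt (x / T))" "m \<in> nats_upto (x / (real d)\<^sup>2)" "m \<notin> nats_upto T"
      then show "(d, m) \<in> P2" by (auto simp: P2_def nats_upto_def field_simps)
    qed
  qed simp
  also have "\<dots> = (\<Sum>d\<in>nats_upto (sqrt (x / T)). moebius_mu d * (\<Sum>m\<in>nats_upto (x / (real d)\<^sup>2) - nats_upto T. chi3 m))"
    by (subst sum.Sigma [symmetric]) (auto simp: sum_distrib_left)
  also have "\<dots> = (\<Sum>d\<in>nats_upto (sqrt (x / T)). moebius_mu d * ((\<Sum>m\<in>nats_upto (x / (real d)\<^sup>2). chi3 m) - (\<Sum>m\<in>nats_upto T. chi3 m)))"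
  proof (rule sum.cong)
    fix d assume d: "d \<in> nats_upto (sqrt (x / T))"
    then have "d \<ge> 1" "real d \<le> sqrt (x / T)" by (auto simp: nats_upto_def)
    then have "(real d)\<^sup>2 \<le> x / T" using assms power_mono[of "real d" "sqrt (x / T)" 2] by simp
    \<comment> \<open>This makes the range up to T part of the range up to x / d^2, so that the sum
      over the gap really is a difference of two partial sums.\<close>
    then have "T \<le> x / (real d)\<^sup>2" using \<open>d \<ge> 1\<close> assms by (simp add: field_simps)
    then have "nats_upto T \<subseteq> nats_upto (x / (real d)\<^sup>2)" by (auto simp: nats_upto_def)
    then show "moebius_mu d * (\<Sum>m\<in>nats_upto (x / (real d)\<^sup>2) - nats_upto T. chi3 m) =
        moebius_mu d * ((\<Sum>m\<in>nats_upto (x / (real d)\<^sup>2). chi3 m) - (\<Sum>m\<in>nats_upto T. chi3 m))"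
      by (simp add: sum_diff)
  qed simp
  finally show ?thesis .
qed

text \<open>Comparison with the integral of t^(-a), one unit step at a time: the mean value theorem
  bounds each term by an increment of t^(1 - a) / (1 - a).\<close>

lemma sum_powr_le:
  fixes a :: real
  assumes "0 < a" "a < 1" "x \<ge> 0"
  shows "(\<Sum>n\<in>nats_upto x. real n powr (- a)) \<le> x powr (1 - a) / (1 - a)"
proof -
  have *: "(\<Sum>n\<in>{1..N}. real n powr (- a)) \<le> real N powr (1 - a) / (1 - a)" for N
  proof (induction N)
    case (Suc N)
    have "real (Suc N) powr (- a) \<le> (real (Suc N) powr (1 - a) - real N powr (1 - a)) / (1 - a)"
    \<comment> \<open>At N = 0 the derivative t^(-a) blows up at the left endpoint; there the claim
      is just 1 \<le> 1 / (1 - a).\<close>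
    proof (cases "N = 0")
      case False
      have "\<exists>z. z > real N \<and> z < real (Suc N) \<and> real (Suc N) powr (1 - a) - real N powr (1 - a) =
              (real (Suc N) - real N) * ((1 - a) * z powr (- a))"
      proof (rule MVT2)
        fix z assume "real N \<le> z" "z \<le> real (Suc N)"
        then have "z > 0" using False by linarith
        then show "((\<lambda>z. z powr (1 - a)) has_real_derivative (1 - a) * z powr (- a)) (at z)"
          using has_real_derivative_powr[of z "1 - a"] by simp
      qed simp
      then obtain z where z: "z > real N" "z < real (Suc N)"
        "real (Suc N) powr (1 - a) - real N powr (1 - a) = (1 - a) * z powr (- a)" by auto
      have "real (Suc N) powr (- a) \<le> z powr (- a)" using z assms by (intro powr_mono2') auto
      then show ?thesis using z assms by simp
    qed (use assms in simp)
    then show ?case using Suc.IH assms by (simp add: diff_divide_distrib)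
  qed simp
  also have "real (nat \<lfloor>x\<rfloor>) powr (1 - a) / (1 - a) \<le> x powr (1 - a) / (1 - a)"
    using assms by (intro divide_right_mono powr_mono2) auto
  finally show ?thesis by (simp add: nats_upto_eq)
qed

lemma sum_nats_upto_chi3_bound:
  assumes "\<eta> > 0" "y \<ge> 1"
  shows "\<bar>real_of_int (\<Sum>n\<in>nats_upto y. chi3 n)\<bar> \<le> y powr \<eta> / (1 - 3 powr (- \<eta>))"
proof -
  have "(3::real) powr (- \<eta>) < 1" using assms by (intro powr_less_one) auto
  moreover have "nat \<lfloor>y\<rfloor> > 0" using assms by simp
  ultimately have "\<bar>real_of_int (\<Sum>n\<in>nats_upto y. chi3 n)\<bar> \<le> real (nat \<lfloor>y\<rfloor>) powr \<eta> / (1 - 3 powr (- \<eta>))"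
    using sum_chi3_bound[of \<eta> "nat \<lfloor>y\<rfloor>"] assms by (simp only: nats_upto_eq of_int_abs)
  also have "\<dots> \<le> y powr \<eta> / (1 - 3 powr (- \<eta>))"
    using assms \<open>3 powr (- \<eta>) < 1\<close> by (intro divide_right_mono powr_mono2) auto
  finally show ?thesis .
qed

text \<open>The sums over m > T are O((x / d^2)^\<eta>), and summing d^(-2 \<eta>) over d \<le> sqrt
  (x / T) gives x^\<eta> (x / T)^(1/2 - \<eta>) = sqrt x T^(\<eta> - 1/2). The condition \<eta> <
  1/2 keeps the exponent of d above -1. T stays free because one application fixes it and the other
  lets it grow with x.\<close>

lemma sum_sqfree_chi_bound:
  fixes \<eta> :: real
  assumes \<eta>: "0 < \<eta>" "\<eta> < 1/2"
  obtains C where "C > 0" "\<And>x T. 1 \<le> T \<Longrightarrow> T \<le> x \<Longrightarrow>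
    \<bar>real_of_int (\<Sum>n\<in>nats_upto x. sqfree_chi n)\<bar> \<le>
      (\<Sum>m\<in>nats_upto T. \<bar>mertens (sqrt (x / m))\<bar>) + C * sqrt x * T powr (\<eta> - 1/2)"
proof -
  define A where "A = 1 / (1 - 3 powr (- \<eta>))"
  have "(3::real) powr (- \<eta>) < 1" using \<eta> by (intro powr_less_one) auto
  then have A: "A > 0" by (simp add: A_def)
  have main: "\<bar>real_of_int (\<Sum>n\<in>nats_upto x. sqfree_chi n)\<bar> \<le>
      (\<Sum>m\<in>nats_upto T. \<bar>mertens (sqrt (x / m))\<bar>) + 2 * A / (1 - 2 * \<eta>) * sqrt x * T powr (\<eta> - 1/2)"
    if T: "1 \<le> T" "T \<le> x" for x T
  proof -
  define X where "X = (\<lambda>y. \<Sum>n\<in>nats_upto y. chi3 n)"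
  have X: "\<bar>real_of_int (X y)\<bar> \<le> A * y powr \<eta>" if "y \<ge> 1" for y
    using sum_nats_upto_chi3_bound[OF \<eta>(1) that] by (simp add: X_def A_def)
  have "real_of_int (\<Sum>n\<in>nats_upto x. sqfree_chi n) = (\<Sum>m\<in>nats_upto T. chi3 m * mertens (sqrt (x / m))) +
           (\<Sum>d\<in>nats_upto (sqrt (x / T)). real_of_int (moebius_mu d) * (real_of_int (X (x / (real d)\<^sup>2)) - real_of_int (X T)))"
    using T by (subst sum_sqfree_chi_hyperbola) (auto simp: mertens_def X_def)
  also have "\<bar>\<dots>\<bar> \<le> (\<Sum>m\<in>nats_upto T. \<bar>mertens (sqrt (x / m))\<bar>) +
     (\<Sum>d\<in>nats_upto (sqrt (x / T)). 2 * A * x powr \<eta> * real d powr (- (2 * \<eta>)))"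
  proof (intro order_trans[OF abs_triangle_ineq] add_mono order_trans[OF sum_abs] sum_mono)
    fix m assume "m \<in> nats_upto T"
    then have "\<bar>real_of_int (chi3 m)\<bar> = 1" using chi3_in[of m] by (auto simp: nats_upto_def)
    then show "\<bar>chi3 m * mertens (sqrt (x / m))\<bar> \<le> \<bar>mertens (sqrt (x / m))\<bar>"
      by (simp add: abs_mult)
  next
    fix d assume d: "d \<in> nats_upto (sqrt (x / T))"
    then have d1: "d \<ge> 1" "real d \<le> sqrt (x / T)" by (auto simp: nats_upto_def)
    then have "(real d)\<^sup>2 \<le> x / T" using T power_mono[of "real d" "sqrt (x / T)" 2] by simp
    then have Td: "T \<le> x / (real d)\<^sup>2" using d1 T by (simp add: field_simps)
    have "\<bar>real_of_int (moebius_mu d)\<bar> \<le> 1" using abs_moebius_mu_le_1[of d] by linarith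
    then have "\<bar>moebius_mu d * (real_of_int (X (x / (real d)\<^sup>2)) - X T)\<bar> \<le> 1 * (\<bar>real_of_int (X (x / (real d)\<^sup>2))\<bar> + \<bar>real_of_int (X T)\<bar>)"
      unfolding abs_mult by (intro mult_mono abs_triangle_ineq4) auto
    also have "\<dots> \<le> A * (x / (real d)\<^sup>2) powr \<eta> + A * T powr \<eta>"
      using X[of T] X[of "x / (real d)\<^sup>2"] T Td by auto
    also have "A * T powr \<eta> \<le> A * (x / (real d)\<^sup>2) powr \<eta>"
      using A Td T \<eta> by (intro mult_left_mono powr_mono2) auto
    also have "(x / (real d)\<^sup>2) powr \<eta> = x powr \<eta> * real d powr (- (2 * \<eta>))"
    proof -
      have "(real d)\<^sup>2 powr \<eta> = real d powr (2 * \<eta>)"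
        using d1 by (simp add: powr_powr flip: powr_numeral)
      then show ?thesis using T d1 by (simp add: powr_divide powr_minus_divide)
    qed
    finally show "\<bar>moebius_mu d * (real_of_int (X (x / (real d)\<^sup>2)) - X T)\<bar> \<le> 2 * A * x powr \<eta> * real d powr (- (2 * \<eta>))"
      by simp
  qed
  finally have split: "\<bar>real_of_int (\<Sum>n\<in>nats_upto x. sqfree_chi n)\<bar> \<le> (\<Sum>m\<in>nats_upto T. \<bar>mertens (sqrt (x / m))\<bar>) +
     (\<Sum>d\<in>nats_upto (sqrt (x / T)). 2 * A * x powr \<eta> * real d powr (- (2 * \<eta>)))" .
  have "(\<Sum>d\<in>nats_upto (sqrt (x / T)). 2 * A * x powr \<eta> * real d powr (- (2 * \<eta>))) \<le>
      2 * A * x powr \<eta> * (sqrt (x / T) powr (1 - 2 * \<eta>) / (1 - 2 * \<eta>))"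
    unfolding sum_distrib_left [symmetric] using A T \<eta> by (intro mult_left_mono sum_powr_le) auto
  also have "sqrt (x / T) powr (1 - 2 * \<eta>) = x powr (1/2 - \<eta>) * T powr (\<eta> - 1/2)"
  proof -
    have "sqrt (x / T) powr (1 - 2 * \<eta>) = (x / T) powr ((1/2) * (1 - 2 * \<eta>))"
      using T by (simp add: powr_half_sqrt [symmetric] powr_powr)
    also have "(1/2) * (1 - 2 * \<eta>) = 1/2 - \<eta>" by simp
    finally show ?thesis using T by (simp add: powr_divide powr_diff)
  qed
  also have "2 * A * x powr \<eta> * (x powr (1/2 - \<eta>) * T powr (\<eta> - 1/2) / (1 - 2 * \<eta>)) =
     2 * A / (1 - 2 * \<eta>) * (x powr \<eta> * x powr (1/2 - \<eta>)) * T powr (\<eta> - 1/2)"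
    by (simp add: field_simps)
  also have "x powr \<eta> * x powr (1/2 - \<eta>) = sqrt x"
    using T by (simp add: powr_half_sqrt flip: powr_add)
  finally show "\<bar>real_of_int (\<Sum>n\<in>nats_upto x. sqfree_chi n)\<bar> \<le>
      (\<Sum>m\<in>nats_upto T. \<bar>mertens (sqrt (x / m))\<bar>) + 2 * A / (1 - 2 * \<eta>) * sqrt x * T powr (\<eta> - 1/2)"
    using split by linarith
  qed
  show ?thesis using main A \<eta> by (intro that[of "2 * A / (1 - 2 * \<eta>)"]) auto
qed

lemma partial_sums_sqfree_chi: "partial_sums (\<lambda>n. of_int (sqfree_chi n)) x = of_real (real_of_int (\<Sum>n\<in>nats_upto x. sqfree_chi n))"
  by (simp add: partial_sums_def nats_upto_def)

lemma sqfree_chi_unconditional: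
  assumes M: "mertens \<in> o[at_top](\<lambda>x. x)"
  shows "partial_sums (\<lambda>n. of_int (sqfree_chi n)) \<in> o[at_top](\<lambda>x. complex_of_real (sqrt x))"
proof (rule landau_o.smallI)
  fix c :: real assume c: "c > 0"
  obtain C where C: "C > 0" "\<And>x T. 1 \<le> T \<Longrightarrow> T \<le> x \<Longrightarrow>
    \<bar>real_of_int (\<Sum>n\<in>nats_upto x. sqfree_chi n)\<bar> \<le>
      (\<Sum>m\<in>nats_upto T. \<bar>mertens (sqrt (x / m))\<bar>) + C * sqrt x * T powr (1/4 - 1/2)"
    using sum_sqfree_chi_bound[of "1/4"] by auto
  have "((\<lambda>T. C * T powr (1/4 - 1/2)) \<longlongrightarrow> C * 0) at_top"
    by (intro tendsto_mult tendsto_const tendsto_neg_powr filterlim_ident) auto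
  then have "eventually (\<lambda>T. C * T powr (1/4 - 1/2) < c / 2) at_top"
    using c by (intro order_tendstoD) auto
  then have "eventually (\<lambda>T. C * T powr (1/4 - 1/2) < c / 2 \<and> T \<ge> 1) at_top"
    by (intro eventually_conj eventually_ge_at_top)
  then obtain T where T: "C * T powr (1/4 - 1/2) < c / 2" "T \<ge> 1"
    using eventually_happens[of _ "at_top :: real filter"] by auto
  \<comment> \<open>At most T values of m occur, each allowed e sqrt x, so together they use up the
    remaining half c / 2. T is already fixed here, hence a pure o-statement for
    \<open>mertens\<close> is enough.\<close>
  define e where "e = c / (2 * T)"
  have e: "e > 0" using c T by (simp add: e_def)
  from landau_o.smallD[OF M e] obtain Y where Y: "\<And>y. y \<ge> Y \<Longrightarrow> \<bar>mertens y\<bar> \<le> e * \<bar>y\<bar>"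
    by (auto simp: eventually_at_top_linorder)
  \<comment> \<open>For every m \<le> T this puts sqrt (x / m) beyond the threshold Y; the maximum
    with 0 is taken because Y may be negative and gets squared.\<close>
  have "eventually (\<lambda>x. x \<ge> max T (T * (max Y 0)\<^sup>2)) at_top"
    by (rule eventually_ge_at_top)
  then show "eventually (\<lambda>x. norm (partial_sums (\<lambda>n. of_int (sqfree_chi n)) x) \<le> c * norm (complex_of_real (sqrt x))) at_top"
  proof eventually_elim
    case (elim x)
    have x: "x \<ge> 1" "T \<le> x" using elim T by auto
    have "(\<Sum>m\<in>nats_upto T. \<bar>mertens (sqrt (x / m))\<bar>) \<le> (\<Sum>m\<in>nats_upto T. e * sqrt x)"
    proof (rule sum_mono)
      fix m assume "m \<in> nats_upto T"
      then have m: "m \<ge> 1" "real m \<le> T" by (auto simp: nats_upto_def)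
      have "(max Y 0)\<^sup>2 * m \<le> (max Y 0)\<^sup>2 * T" using m by (intro mult_left_mono) auto
      then have "(max Y 0)\<^sup>2 \<le> x / m" using elim m by (simp add: field_simps)
      then have "max Y 0 \<le> sqrt (x / m)" by (rule real_le_rsqrt)
      then have "\<bar>mertens (sqrt (x / m))\<bar> \<le> e * \<bar>sqrt (x / m)\<bar>" by (intro Y) auto
      also have "\<dots> \<le> e * sqrt x"
        using e m x by (intro mult_left_mono) (auto simp: field_simps real_sqrt_divide mult_le_cancel_left1)
      finally show "\<bar>mertens (sqrt (x / m))\<bar> \<le> e * sqrt x" .
    qed
    also have "\<dots> = real (card (nats_upto T)) * (e * sqrt x)" by simp
    also have "\<dots> \<le> T * (e * sqrt x)" using T e x by (intro mult_right_mono card_nats_upto_le) auto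
    also have "\<dots> = c / 2 * sqrt x" using T by (simp add: e_def)
    finally have 1: "(\<Sum>m\<in>nats_upto T. \<bar>mertens (sqrt (x / m))\<bar>) \<le> c / 2 * sqrt x" .
    have "C * sqrt x * T powr (1/4 - 1/2) = (C * T powr (1/4 - 1/2)) * sqrt x" by simp
    also have "\<dots> \<le> c / 2 * sqrt x" using T x by (intro mult_right_mono) auto
    finally have "\<bar>real_of_int (\<Sum>n\<in>nats_upto x. sqfree_chi n)\<bar> \<le> c / 2 * sqrt x + c / 2 * sqrt x"
      using 1 C(2)[OF T(2) x(2)] by linarith
    then show ?case using x by (simp only: partial_sums_sqfree_chi norm_of_real) (simp add: field_simps)
  qed
qed

lemma sqfree_chi_conditional:
  assumes M: "\<And>\<delta>. \<delta> > 0 \<Longrightarrow> \<exists>K>0. \<forall>y\<ge>1. \<bar>mertens y\<bar> \<le> K * y powr (1/2 + \<delta>)"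
    and \<epsilon>: "\<epsilon> > 0"
  shows "partial_sums (\<lambda>n. of_int (sqfree_chi n)) \<in> o[at_top](\<lambda>x. complex_of_real (x powr (2/5 + \<epsilon>)))"
proof -
  \<comment> \<open>The cap at 1/4 keeps \<eta> below 1/2 and a below 1. Here a is half the Mertens
    exponent 1/2 + \<eta>, since \<open>mertens\<close> is evaluated at a square root.\<close>
  define \<eta> where "\<eta> = min \<epsilon> (1/4)"
  have \<eta>: "0 < \<eta>" "\<eta> \<le> 1/4" "\<eta> \<le> \<epsilon>" using \<epsilon> by (auto simp: \<eta>_def)
  define a where "a = 1/4 + \<eta>/2"
  have a: "0 < a" "a < 1" using \<eta> by (auto simp: a_def)
  obtain C where C: "C > 0" "\<And>x T. 1 \<le> T \<Longrightarrow> T \<le> x \<Longrightarrow>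
    \<bar>real_of_int (\<Sum>n\<in>nats_upto x. sqfree_chi n)\<bar> \<le>
      (\<Sum>m\<in>nats_upto T. \<bar>mertens (sqrt (x / m))\<bar>) + C * sqrt x * T powr (\<eta> - 1/2)"
    using sum_sqfree_chi_bound[of \<eta>] \<eta> by auto
  obtain K where K: "K > 0" "\<And>y. y \<ge> 1 \<Longrightarrow> \<bar>mertens y\<bar> \<le> K * y powr (1/2 + \<eta>)"
    using M[OF \<eta>(1)] by blast
  \<comment> \<open>Proving the bound with \<epsilon>/2 in place of \<epsilon> leaves room to pass
    from O to o at the end.\<close>
  have main: "\<bar>real_of_int (\<Sum>n\<in>nats_upto x. sqfree_chi n)\<bar> \<le> (K / (1 - a) + C) * x powr (2/5 + \<epsilon>/2)" if x: "x \<ge> 1" for x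
  proof -
    \<comment> \<open>The two contributions become x^(2/5 + 2 \<eta>/5) and x^(2/5 + \<eta>/5); both
      exponents are at most 2/5 + \<epsilon>/2.\<close>
    define T where "T = x powr (1/5)"
    have T1: "T \<ge> 1" using x by (simp add: T_def ge_one_powr_ge_zero)
    have Tx: "T \<le> x" using powr_mono[of "1/5" 1 x] x by (simp add: T_def)
    have "(\<Sum>m\<in>nats_upto T. \<bar>mertens (sqrt (x / m))\<bar>) \<le> (\<Sum>m\<in>nats_upto T. K * x powr a * real m powr (- a))"
    proof (rule sum_mono)
      fix m assume "m \<in> nats_upto T"
      then have m: "m \<ge> 1" "real m \<le> T" by (auto simp: nats_upto_def)
      then have "x / m \<ge> 1" using Tx by simp
      then have "\<bar>mertens (sqrt (x / m))\<bar> \<le> K * sqrt (x / m) powr (1/2 + \<eta>)" by (intro K) auto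
      also have "sqrt (x / m) powr (1/2 + \<eta>) = (x / m) powr a"
        using x by (simp add: powr_half_sqrt [symmetric] powr_powr a_def field_simps)
      also have "\<dots> = x powr a * real m powr (- a)"
        using x by (simp add: powr_divide powr_minus_divide)
      finally show "\<bar>mertens (sqrt (x / m))\<bar> \<le> K * x powr a * real m powr (- a)" by simp
    qed
    also have "\<dots> \<le> K * x powr a * (T powr (1 - a) / (1 - a))"
      unfolding sum_distrib_left [symmetric] using a K T1 by (intro mult_left_mono sum_powr_le) auto
    also have "\<dots> = K / (1 - a) * (x powr a * T powr (1 - a))" by simp
    also have "x powr a * T powr (1 - a) = x powr (2/5 + 2 * \<eta> / 5)"
    proof -
      have "a + 1/5 * (1 - a) = 2/5 + 2 * \<eta> / 5" by (simp add: a_def field_simps)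
      then show ?thesis using x by (simp add: T_def powr_powr flip: powr_add)
    qed
    also have "K / (1 - a) * \<dots> \<le> K / (1 - a) * x powr (2/5 + \<epsilon>/2)"
      using \<eta> x K a by (intro mult_left_mono powr_mono) auto
    finally have 1: "(\<Sum>m\<in>nats_upto T. \<bar>mertens (sqrt (x / m))\<bar>) \<le> K / (1 - a) * x powr (2/5 + \<epsilon>/2)" .
    have "sqrt x * T powr (\<eta> - 1/2) = x powr (2/5 + \<eta>/5)"
    proof -
      have "1/2 + 1/5 * (\<eta> - 1/2) = 2/5 + \<eta>/5" by (simp add: field_simps)
      then show ?thesis using x by (simp add: T_def powr_powr powr_half_sqrt [symmetric] flip: powr_add)
    qed
    also have "\<dots> \<le> x powr (2/5 + \<epsilon>/2)" using \<eta> x by (intro powr_mono) auto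
    finally have "C * (sqrt x * T powr (\<eta> - 1/2)) \<le> C * x powr (2/5 + \<epsilon>/2)"
      using C by (intro mult_left_mono) auto
    then show ?thesis using C(2)[OF T1 Tx] 1 by (simp add: algebra_simps)
  qed
  have "partial_sums (\<lambda>n. of_int (sqfree_chi n)) \<in> O[at_top](\<lambda>x. complex_of_real (x powr (2/5 + \<epsilon>/2)))"
  proof (rule landau_o.bigI)
    show "K / (1 - a) + C > 0" using K C a by (intro add_pos_pos) auto
    show "eventually (\<lambda>x. norm (partial_sums (\<lambda>n. of_int (sqfree_chi n)) x) \<le>
       (K / (1 - a) + C) * norm (complex_of_real (x powr (2/5 + \<epsilon>/2)))) at_top"
      using eventually_ge_at_top[of 1]
      by eventually_elim (use main in \<open>simp only: partial_sums_sqfree_chi norm_of_real, simp\<close>)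
  qed
  also have "(\<lambda>x. complex_of_real (x powr (2/5 + \<epsilon>/2))) \<in> o[at_top](\<lambda>x. complex_of_real (x powr (2/5 + \<epsilon>)))"
    unfolding landau_o.small.of_real_iff using \<epsilon> by (subst powr_smallo_iff) (auto intro: filterlim_ident)
  finally show ?thesis .
qed

section \<open>The zeta function and its reciprocal\<close>

text \<open>
  The function \<open>(s - 1) * \<zeta>(s)\<close> on \<open>Re s > 0\<close>, with its pole removed; this is the case \<open>K = 1\<close>
  of \<open>zD_recurrence\<close>.
\<close>
definition zeta_reg :: "complex \<Rightarrow> complex" where
  "zeta_reg s = 1 + (\<Sum>n. zR 1 n s)"

lemma holomorphic_zeta_reg: "zeta_reg holomorphic_on {s. Re s > 0}"
  using holomorphic_suminf_zR[of 1] unfolding zeta_reg_def by (intro holomorphic_intros) auto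

lemma zeta_reg_eq_zD: "Re s > 1 \<Longrightarrow> zeta_reg s = (s - 1) * zD s"
  using zD_recurrence[of s 1] by (simp add: zeta_reg_def)

text \<open>Carries the hypothesis on the zeros of \<open>riemann_zeta\<close> over to
  \<open>zeta_reg\<close>. Puncturing an open half-plane leaves it connected, so the identity
  spreads from Re s > 1.\<close>

lemma zeta_reg_eq_riemann_zeta:
  assumes "Re s > 0" "s \<noteq> 1"
  shows "zeta_reg s = (s - 1) * riemann_zeta s"
proof (rule analytic_continuation_open[of "{s. Re s > 1}" "{s. Re s > 0} - {1}" zeta_reg "\<lambda>s. (s - 1) * riemann_zeta s"])
  show "open ({s. Re s > 0} - {1})"
    by (intro open_Diff open_halfspace_Re_gt) auto
  show "{s. 1 < Re s} \<noteq> {}" by (auto intro: exI[of _ 2])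
  show "connected ({s. Re s > 0} - {1})"
    by (intro connected_open_delete open_halfspace_Re_gt convex_connected convex_halfspace_Re_gt) auto
  show "zeta_reg holomorphic_on {s. Re s > 0} - {1}"
    by (rule holomorphic_on_subset[OF holomorphic_zeta_reg]) auto
  have "riemann_zeta holomorphic_on - {1}"
    using is_zeta_continuation_riemann_zeta by (simp add: is_zeta_continuation_def)
  then show "(\<lambda>s. (s - 1) * riemann_zeta s) holomorphic_on {s. Re s > 0} - {1}"
    by (intro holomorphic_intros) (erule holomorphic_on_subset, auto)
  show "zeta_reg z = (z - 1) * riemann_zeta z" if "z \<in> {s. 1 < Re s}" for z
    using that is_zeta_continuation_riemann_zeta
    by (simp add: is_zeta_continuation_def zeta_reg_eq_zD zD_def)
qed (use assms in \<open>auto intro: open_halfspace_Re_gt\<close>)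

text \<open>The product s (s - 1) is the coefficient in the second-order Taylor remainder. Its
  factor s - 1 determines the value of \<open>zeta_reg\<close> at 1, and the product accounts for
  the quadratic growth on vertical lines.\<close>

lemma norm_zR_1_le:
  assumes "Re s \<ge> 1/2"
  shows "norm (zR 1 n s) \<le> norm s * norm (s - 1) * real (Suc n) powr (- 3/2)"
proof -
  have "norm (zR 1 n s) \<le> norm (zP (Suc 1) s) / fact 1 * real (Suc n) powr (- Re s - real 1)"
    using assms by (intro zR_bound) auto
  also have "norm (zP (Suc 1) s) = norm s * norm (s - 1)"
    by (simp add: zP_def norm_mult norm_minus_commute)
  also have "norm s * norm (s - 1) / fact 1 * real (Suc n) powr (- Re s - real 1) \<le>
      norm s * norm (s - 1) / fact 1 * real (Suc n) powr (- 3/2)"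
    using assms by (intro mult_left_mono powr_mono) auto
  finally show ?thesis by simp
qed

lemma zeta_reg_1 [simp]: "zeta_reg 1 = 1"
proof -
  have "zR 1 n 1 = 0" for n using norm_zR_1_le[of 1 n] by simp
  then show ?thesis by (simp add: zeta_reg_def)
qed

text \<open>The range of Re s is wide enough to contain the discs of radius 3/2 around the points 2
  + it, on which a logarithm of zeta is studied later. The factor 25 comes from bounding |s| and |s
  - 1| by 5 (1 + |Im s|).\<close>

lemma norm_zeta_reg_bound:
  obtains C where "C > 0" "\<And>s. Re s \<ge> 1/2 \<Longrightarrow> Re s \<le> 4 \<Longrightarrow> norm (zeta_reg s) \<le> C * (1 + \<bar>Im s\<bar>)\<^sup>2"
proof -
  have "summable (\<lambda>n. real n powr (- 3/2))" by (subst summable_real_powr_iff) auto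
  then have sm: "summable (\<lambda>n. real (Suc n) powr (- 3/2))"
    by (subst summable_Suc_iff[of "\<lambda>n. real n powr (- 3/2)"])
  define Z where "Z = (\<Sum>n. real (Suc n) powr (- 3/2))"
  have Z: "Z \<ge> 0" unfolding Z_def by (intro suminf_nonneg sm) auto
  show ?thesis
  proof (rule that[of "1 + 25 * Z"])
    show "1 + 25 * Z > 0" using Z by simp
    fix s assume s: "Re s \<ge> 1/2" "Re s \<le> 4"
    define y where "y = 1 + \<bar>Im s\<bar>"
    have y: "y \<ge> 1" by (simp add: y_def)
    have "norm s \<le> 5 * y" "norm (s - 1) \<le> 5 * y"
      using cmod_le[of s] cmod_le[of "s - 1"] s by (auto simp: y_def)
    then have "norm s * norm (s - 1) \<le> (5 * y) * (5 * y)" using y by (intro mult_mono) auto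
    then have *: "norm s * norm (s - 1) \<le> 25 * y\<^sup>2" by (simp add: power2_eq_square)
    have "norm (\<Sum>n. zR 1 n s) \<le> (\<Sum>n. norm s * norm (s - 1) * real (Suc n) powr (- 3/2))"
      using s by (intro norm_suminf_le norm_zR_1_le summable_mult sm)
    also have "\<dots> = norm s * norm (s - 1) * Z"
      unfolding Z_def by (intro suminf_mult sm)
    also have "\<dots> \<le> 25 * y\<^sup>2 * Z" using * Z by (intro mult_right_mono) auto
    finally have "norm (\<Sum>n. zR 1 n s) \<le> 25 * y\<^sup>2 * Z" .
    moreover have "1 \<le> y\<^sup>2" using y by simp
    ultimately have "norm (zeta_reg s) \<le> y\<^sup>2 + 25 * y\<^sup>2 * Z"
      unfolding zeta_reg_def using norm_triangle_ineq[of 1 "\<Sum>n. zR 1 n s"] by simp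
    then show "norm (zeta_reg s) \<le> (1 + 25 * Z) * (1 + \<bar>Im s\<bar>)\<^sup>2" by (simp add: y_def algebra_simps)
  qed
qed

section \<open>Absolutely convergent Dirichlet series of zeta and of the Moebius function\<close>

lemma norm_nat_powr: "norm (of_nat n powr (- s) :: complex) = real n powr (- Re s)"
  by (cases "n = 0") (auto simp: norm_powr_real_powr)

lemma nat_powr_mult: "(of_nat (m * n) powr s :: complex) = of_nat m powr s * of_nat n powr s"
  by (simp add: powr_times_real)

lemma summable_on_nat_powr:
  assumes "(\<sigma>::real) > 1"
  shows "(\<lambda>n. real n powr (- \<sigma>)) summable_on A"
proof -
  have "(\<lambda>n. real n powr (- \<sigma>)) summable_on UNIV"
    using assms by (subst summable_on_UNIV_nonneg_real_iff) (auto simp: summable_real_powr_iff)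
  then show ?thesis by (rule summable_on_subset) auto
qed

lemma zD_has_sum:
  assumes "Re s > 1"
  shows "((\<lambda>n. of_nat n powr (- s)) has_sum zD s) UNIV"
proof (rule norm_summable_imp_has_sum)
  show "summable (\<lambda>n. norm (of_nat n powr (- s) :: complex))"
    using assms by (simp add: norm_nat_powr summable_real_powr_iff)
  \<comment> \<open>The term of index 0 is \<open>0 powr (- s) = 0\<close>, so the sum may run over
    all naturals, the convenient index set for unordered sums.\<close>
  have "(\<lambda>n. of_nat (Suc n) powr (- s)) sums (zD s - of_nat 0 powr (- s))"
    using zD_sums[OF assms] by simp
  then show "(\<lambda>n. of_nat n powr (- s)) sums zD s"
    by (subst (asm) sums_Suc_iff) simp
qed

definition moebius_series :: "complex \<Rightarrow> complex" where
  "moebius_series s = (\<Sum>\<^sub>\<infinity>n. of_int (moebius_mu n) * of_nat n powr (- s))"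

lemma norm_moebius_mu_term_le: "norm (of_int (moebius_mu n) * of_nat n powr (- s) :: complex) \<le> real n powr (- Re s)"
proof -
  have "\<bar>real_of_int (moebius_mu n)\<bar> \<le> 1" using abs_moebius_mu_le_1[of n] by linarith
  then show ?thesis by (simp add: norm_mult norm_nat_powr mult_left_le_one_le)
qed

lemma moebius_series_abs_summable:
  assumes "Re s > 1"
  shows "(\<lambda>n. norm (of_int (moebius_mu n) * of_nat n powr (- s) :: complex)) summable_on A"
  by (rule Infinite_Sum.abs_summable_on_comparison_test'[where g = "\<lambda>n. real n powr (- Re s)"])
     (use assms in \<open>auto intro: summable_on_nat_powr norm_moebius_mu_term_le\<close>)

lemma moebius_series_has_sum:
  assumes "Re s > 1"
  shows "((\<lambda>n. of_int (moebius_mu n) * of_nat n powr (- s)) has_sum moebius_series s) UNIV"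
  unfolding moebius_series_def using abs_summable_summable[OF moebius_series_abs_summable[OF assms]] by simp

lemma norm_moebius_series_le:
  assumes "\<sigma> > 1" "Re s \<ge> \<sigma>"
  shows "norm (moebius_series s) \<le> (\<Sum>\<^sub>\<infinity>n. real n powr (- \<sigma>))"
  unfolding moebius_series_def
proof (rule norm_infsum_le)
  show "((\<lambda>n. of_int (moebius_mu n) * of_nat n powr (- s)) has_sum (\<Sum>\<^sub>\<infinity>n. of_int (moebius_mu n) * of_nat n powr (- s))) UNIV"
    using moebius_series_has_sum[of s] assms by (simp add: moebius_series_def)
  show "((\<lambda>n. real n powr (- \<sigma>)) has_sum (\<Sum>\<^sub>\<infinity>n. real n powr (- \<sigma>))) UNIV"
    using assms by (intro has_sum_infsum summable_on_nat_powr)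
  show "norm (of_int (moebius_mu n) * of_nat n powr (- s) :: complex) \<le> real n powr (- \<sigma>)" for n
  proof -
    have "real n powr (- Re s) \<le> real n powr (- \<sigma>)"
      using assms by (cases "n = 0") (auto intro!: powr_mono)
    then show ?thesis using norm_moebius_mu_term_le[of n s] by linarith
  qed
qed

lemma norm_zD_le:
  assumes "\<sigma> > 1" "Re s \<ge> \<sigma>"
  shows "norm (zD s) \<le> (\<Sum>\<^sub>\<infinity>n. real n powr (- \<sigma>))"
proof (rule norm_infsum_le)
  show "((\<lambda>n. of_nat n powr (- s)) has_sum zD s) UNIV"
    using assms by (intro zD_has_sum) auto
  show "((\<lambda>n. real n powr (- \<sigma>)) has_sum (\<Sum>\<^sub>\<infinity>n. real n powr (- \<sigma>))) UNIV"
    using assms by (intro has_sum_infsum summable_on_nat_powr)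
  show "norm (of_nat n powr (- s) :: complex) \<le> real n powr (- \<sigma>)" for n
    using assms by (cases "n = 0") (auto simp: norm_nat_powr intro!: powr_mono)
qed

text \<open>The product of the two series is summed over pairs (d, m) and regrouped by n = d m,
  which absolute summability permits; the inner sums are divisor sums of mu and leave only n =
  1.\<close>

lemma moebius_series_mult_zD:
  assumes s: "Re s > 1"
  shows "moebius_series s * zD s = 1"
proof -
  define a where "a = (\<lambda>n. of_nat n powr (- s) :: complex)"
  define b where "b = (\<lambda>n. of_int (moebius_mu n) * a n)"
  define G where "G = (\<lambda>(d, m). b d * a m)"
  \<comment> \<open>Index 0 carries no weight, but it is dropped before the regrouping: every d
    divides 0, so infinitely many pairs would lie over the product 0.\<close>
  have a: "(a has_sum zD s) {0<..}"
    using zD_has_sum[OF s] unfolding a_def by (rule has_sum_cong_neutral[THEN iffD1, rotated -1]) auto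
  have b: "(b has_sum moebius_series s) {0<..}"
    using moebius_series_has_sum[OF s] unfolding a_def b_def by (rule has_sum_cong_neutral[THEN iffD1, rotated -1]) auto
  have "(\<lambda>z. norm (G z)) summable_on {0<..} \<times> {0<..}"
  proof (subst Infinite_Sum.abs_summable_on_Sigma_iff, safe)
    have na: "(\<lambda>n. norm (a n)) summable_on A" for A
      using s by (simp add: a_def norm_nat_powr summable_on_nat_powr)
    show "(\<lambda>m. norm (G (d, m))) summable_on {0<..}" for d
      unfolding G_def by (simp add: norm_mult) (intro summable_on_cmult_right na)
    have "(\<lambda>d. norm (b d) * (\<Sum>\<^sub>\<infinity>m\<in>{0<..}. norm (a m))) summable_on {0<..}"
      using moebius_series_abs_summable[OF s] by (intro summable_on_cmult_left) (simp add: b_def a_def)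
    then show "(\<lambda>d. norm (\<Sum>\<^sub>\<infinity>m\<in>{0<..}. norm (G (d, m)))) summable_on {0<..}"
      unfolding G_def by (simp add: norm_mult infsum_cmult_right' abs_mult infsum_nonneg)
  qed
  then have smG: "G summable_on {0<..} \<times> {0<..}" by (rule abs_summable_summable)
  have "(G has_sum moebius_series s * zD s) ({0<..} \<times> {0<..})"
  proof (rule has_sum_SigmaI[OF _ _ smG])
    show "((\<lambda>m. G (d, m)) has_sum b d * zD s) {0<..}" for d
      unfolding G_def using has_sum_cmult_right[OF a] by simp
    show "((\<lambda>d. b d * zD s) has_sum moebius_series s * zD s) {0<..}"
      by (rule has_sum_cmult_left[OF b])
  qed
  also have "(G has_sum moebius_series s * zD s) ({0<..} \<times> {0<..}) \<longleftrightarrow>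
      ((\<lambda>(n, d). of_int (moebius_mu d) * a n) has_sum moebius_series s * zD s) (Sigma {0<..} (\<lambda>n. {d. d dvd n}))"
  proof (rule has_sum_reindex_bij_witness[where j = "\<lambda>(d, m). (d * m, d)" and i = "\<lambda>(n, d). (d, n div d)"])
    show "(case b of (n, d) \<Rightarrow> (d, n div d)) \<in> {0<..} \<times> {0<..}"
      if "b \<in> Sigma {0<..} (\<lambda>n. {d. d dvd n})" for b :: "nat \<times> nat"
      using that by (auto simp: dvd_div_eq_0_iff intro!: Nat.gr0I)
  qed (auto simp: G_def b_def a_def nat_powr_mult simp del: of_nat_mult)
  finally have "((\<lambda>n. (if n = 1 then 1 else 0) * a n) has_sum moebius_series s * zD s) {0<..}"
  proof (rule has_sum_SigmaD)
    fix n :: nat assume n: "n \<in> {0<..}"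
    have "(\<Sum>d | d dvd n. of_int (moebius_mu d) * a n) = of_int (\<Sum>d | d dvd n. moebius_mu d) * a n"
      by (simp add: sum_distrib_right)
    also have "\<dots> = (if n = 1 then 1 else 0) * a n"
      using n by (simp add: sum_moebius_mu_divisors)
    finally show "((\<lambda>y. case (n, y) of (n, d) \<Rightarrow> of_int (moebius_mu d) * a n) has_sum (if n = 1 then 1 else 0) * a n) {d. d dvd n}"
      using n by (auto intro!: has_sum_finiteI)
  qed
  moreover have "((\<lambda>n. (if n = 1 then 1 else 0) * a n) has_sum 1) {0<..}"
    by (rule has_sum_finite_neutralI[of "{1}"]) (auto simp: a_def)
  ultimately show ?thesis by (rule has_sum_unique)
qed

lemma zD_nonzero: "Re s > 1 \<Longrightarrow> zD s \<noteq> 0"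
  using moebius_series_mult_zD[of s] by auto

lemma moebius_series_eq: "Re s > 1 \<Longrightarrow> moebius_series s = 1 / zD s"
  using moebius_series_mult_zD[of s] zD_nonzero[of s] by (simp add: field_simps)

section \<open>Euler products and the 3-4-1 inequality\<close>

text \<open>Real part of the power series of log (1 - w). The term of index 0 is a division by zero,
  hence 0, so the series may start there.\<close>

lemma ln_one_minus_sums:
  fixes w :: complex
  assumes "norm w < 1"
  shows "(\<lambda>n. Re (w ^ n) / of_nat n) sums (- ln (norm (1 - w)))"
proof -
  have "w \<noteq> 1" using assms by auto
  have "(\<lambda>n. - (w ^ n) / of_nat n) sums ln (1 - w)"
    using Ln_series'[of "- w"] assms by simp
  then have "(\<lambda>n. - Re (- (w ^ n) / of_nat n)) sums - Re (ln (1 - w))"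
    by (intro sums_minus sums_Re)
  then show ?thesis using \<open>w \<noteq> 1\<close> by simp
qed

text \<open>The inequality 3 + 4 cos x + cos (2 x) = 2 (1 + cos x)^2 \<ge> 0 for a single prime: the
  logarithm of the left side is minus the sum over k of r^k / k times this expression at the angle
  of u^k. The factors are reciprocals of Euler factors, hence a bound from above.\<close>

lemma three_four_one_local:
  fixes r :: real and u :: complex
  assumes r: "0 \<le> r" "r < 1" and u: "norm u = 1"
  shows "norm (1 - of_real r :: complex) ^ 3 * norm (1 - of_real r * u) ^ 4 * norm (1 - of_real r * u\<^sup>2) \<le> 1"
proof -
  have n: "norm (of_real r :: complex) < 1" "norm (of_real r * u) < 1" "norm (of_real r * u\<^sup>2) < 1"
    using r u by (auto simp: norm_mult norm_power)
  have nz: "1 - of_real r \<noteq> (0::complex)" "1 - of_real r * u \<noteq> 0" "1 - of_real r * u\<^sup>2 \<noteq> 0"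
    using n by auto
  have pos: "S \<ge> 0" if "f sums S" "\<And>k. f k \<ge> 0" for f :: "nat \<Rightarrow> real" and S
    using sums_le[OF _ sums_zero that(1)] that(2) by auto
  have sm: "(\<lambda>k. 3 * (Re (of_real r ^ k) / of_nat k) + 4 * (Re ((of_real r * u) ^ k) / of_nat k)
            + Re ((of_real r * u\<^sup>2) ^ k) / of_nat k) sums
        (3 * - ln (norm (1 - of_real r :: complex)) + 4 * - ln (norm (1 - of_real r * u)) + - ln (norm (1 - of_real r * u\<^sup>2)))"
    by (intro sums_add sums_mult ln_one_minus_sums n)
  have nn: "3 * (Re (of_real r ^ k) / of_nat k) + 4 * (Re ((of_real r * u) ^ k) / of_nat k)
            + Re ((of_real r * u\<^sup>2) ^ k) / of_nat k \<ge> 0" for k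
  proof -
    define v where "v = u ^ k"
    have v: "(Re v)\<^sup>2 + (Im v)\<^sup>2 = 1"
      using u by (simp add: v_def norm_power flip: cmod_power2)
    have "3 + 4 * Re v + Re (v\<^sup>2) = 2 * (1 + Re v)\<^sup>2"
      using v by (simp add: power2_eq_square algebra_simps)
    then have "3 + 4 * Re v + Re (v\<^sup>2) \<ge> 0" by simp
    moreover have "3 * (Re (of_real r ^ k) / of_nat k) + 4 * (Re ((of_real r * u) ^ k) / of_nat k)
            + Re ((of_real r * u\<^sup>2) ^ k) / of_nat k = r ^ k / k * (3 + 4 * Re v + Re (v\<^sup>2))"
    proof -
      have e: "Re (of_real r ^ k) = r ^ k" "Re ((of_real r * u) ^ k) = r ^ k * Re v"
        "Re ((of_real r * u\<^sup>2) ^ k) = r ^ k * Re (v\<^sup>2)"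
        by (simp_all add: v_def power_mult_distrib power_mult [symmetric] mult.commute[of 2 k] flip: of_real_power)
      show ?thesis unfolding e by (simp add: add_divide_distrib distrib_left mult_ac)
    qed
    ultimately show ?thesis using r by simp
  qed
  note pos[OF sm nn]
  moreover have "x ^ 3 * y ^ 4 * z \<le> 1"
    if "x > 0" "y > 0" "z > 0" "3 * - ln x + 4 * - ln y + - ln z \<ge> 0" for x y z :: real
  proof -
    have "ln (x ^ 3 * y ^ 4 * z) = 3 * ln x + 4 * ln y + ln z"
      using that by (simp add: ln_mult ln_realpow)
    then have "ln (x ^ 3 * y ^ 4 * z) \<le> 0" using that by simp
    then show ?thesis using that by (subst (asm) ln_le_zero_iff) auto
  qed
  ultimately show ?thesis using nz by simp
qed

text \<open>The sieve of Eratosthenes: multiplying by 1 - p^(-s) subtracts the terms at multiples of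
  p. Since p differs from the primes already used, these multiples are p times the integers that
  survived so far.\<close>

lemma sieve_has_sum:
  assumes s: "Re s > 1" and P: "finite P" "\<And>p. p \<in> P \<Longrightarrow> prime p"
  shows "((\<lambda>n. of_nat n powr (- s)) has_sum (zD s * (\<Prod>p\<in>P. 1 - of_nat p powr (- s))))
           {n. \<forall>p\<in>P. \<not> p dvd n \<or> n = 0}"
  using P
proof (induction P rule: finite_induct)
  case empty
  then show ?case using zD_has_sum[OF s] by simp
next
  case (insert p P)
  define a where "a = (\<lambda>n. of_nat n powr (- s) :: complex)"
  define A where "A = (\<lambda>P. {n::nat. \<forall>p\<in>P. \<not> p dvd n \<or> n = 0})"
  define S where "S = zD s * (\<Prod>p\<in>P. 1 - a p)"
  have p: "prime p" using insert.prems by simp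
  have IH: "(a has_sum S) (A P)" using insert by (simp add: a_def A_def S_def)
  have "((\<lambda>m. a p * a m) has_sum a p * S) (A P)"
    by (rule has_sum_cmult_right[OF IH])
  also have "(\<lambda>m. a p * a m) = a \<circ> (\<lambda>m. p * m)"
    by (auto simp: a_def fun_eq_iff nat_powr_mult simp del: of_nat_mult)
  also have "(a \<circ> (\<lambda>m. p * m) has_sum a p * S) (A P) \<longleftrightarrow> (a has_sum a p * S) ((\<lambda>m. p * m) ` A P)"
    using p by (intro has_sum_reindex [symmetric] inj_onI) auto
  finally have 1: "(a has_sum a p * S) ((\<lambda>m. p * m) ` A P)" .
  have q: "\<not> q dvd p" if "q \<in> P" for q
    using that insert.prems insert.hyps p primes_dvd_imp_eq[of q p] by auto
  have im: "(\<lambda>m. p * m) ` A P = {n \<in> A P. p dvd n}"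
  proof safe
    fix m assume "m \<in> A P"
    then show "p * m \<in> A P"
      using q insert.prems by (auto simp: A_def prime_dvd_mult_iff)
  next
    fix n assume n: "n \<in> A P" "p dvd n"
    then obtain m where m: "n = p * m" by auto
    have "m = 0 \<or> \<not> q dvd m" if "q \<in> P" for q
    proof -
      have "\<not> q dvd n \<or> n = 0" using n(1) that unfolding A_def by blast
      then show ?thesis using m p dvd_mult[of q m p] by (metis mult_eq_0_iff not_prime_0)
    qed
    then have "m \<in> A P" by (auto simp: A_def)
    then show "n \<in> (\<lambda>m. p * m) ` A P" using m by auto
  qed simp
  have "(a has_sum (S - a p * S)) (A P - (\<lambda>m. p * m) ` A P)"
    by (intro has_sum_Diff IH 1) (auto simp: im)
  \<comment> \<open>Removing the multiples of p also removes 0; it has weight 0 and is put back so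
    that the index set keeps its form.\<close>
  also have "?this \<longleftrightarrow> (a has_sum (S - a p * S)) (A (insert p P))"
    unfolding im by (rule has_sum_cong_neutral) (auto simp: A_def a_def)
  also have "S - a p * S = zD s * (\<Prod>p\<in>insert p P. 1 - a p)"
    using insert.hyps by (simp add: S_def algebra_simps)
  finally show ?case by (simp add: a_def A_def)
qed

text \<open>After sieving by the primes up to N only 1 and integers above N carry weight, and the
  latter form a tail of a convergent series. Keeping \<open>zD s\<close> as a factor, rather than
  forming an infinite product, gives the form in which the limit is taken in the 3-4-1
  inequality.\<close>

lemma euler_product:
  assumes s: "Re s > 1"
  shows "(\<lambda>N. zD s * (\<Prod>p | prime p \<and> p \<le> N. 1 - of_nat p powr (- s))) \<longlonglongrightarrow> 1"
proof -
  define g where "g = (\<lambda>n. real n powr (- Re s))"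
  have g: "g summable_on A" for A using s unfolding g_def by (rule summable_on_nat_powr)
  define tail where "tail = (\<lambda>N. infsum g UNIV - sum g {..<Suc N})"
  have "(\<lambda>N. sum g {..<N}) \<longlonglongrightarrow> infsum g UNIV"
    using has_sum_imp_sums[OF has_sum_infsum[OF g[of UNIV]]] by (simp add: sums_def)
  then have "(\<lambda>N. sum g {..<Suc N}) \<longlonglongrightarrow> infsum g UNIV"
    by (rule LIMSEQ_Suc)
  then have tail: "tail \<longlonglongrightarrow> 0"
    unfolding tail_def
    using tendsto_diff[OF tendsto_const[of "infsum g UNIV"] \<open>(\<lambda>N. sum g {..<Suc N}) \<longlonglongrightarrow> infsum g UNIV\<close>]
    by (simp del: sum.lessThan_Suc)
  have "norm (zD s * (\<Prod>p | prime p \<and> p \<le> N. 1 - of_nat p powr (- s)) - 1) \<le> tail N" for N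
  proof -
    define P where "P = {p. prime p \<and> p \<le> N}"
    define A where "A = {n::nat. \<forall>p\<in>P. \<not> p dvd n \<or> n = 0}"
    define S where "S = zD s * (\<Prod>p\<in>P. 1 - of_nat p powr (- s))"
    have "finite P" by (rule finite_subset[of _ "{..N}"]) (auto simp: P_def)
    then have "((\<lambda>n. of_nat n powr (- s)) has_sum S) A"
      unfolding A_def S_def by (intro sieve_has_sum s) (auto simp: P_def)
    moreover have "((\<lambda>n. of_nat n powr (- s)) has_sum 1) {1::nat}"
      by (rule has_sum_finiteI) auto
    moreover have "{1} \<subseteq> A" by (auto simp: A_def P_def)
    ultimately have 1: "((\<lambda>n. of_nat n powr (- s)) has_sum (S - 1)) (A - {1})"
      by (rule has_sum_Diff)
    have "(g has_sum tail N) (UNIV - {..<Suc N})"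
      unfolding tail_def by (intro has_sum_Diff has_sum_infsum g has_sum_finiteI) auto
    then have tl: "tail N = infsum g (UNIV - {..<Suc N})" by (simp add: infsumI)
    have "norm (S - 1) \<le> infsum g (A - {1})"
      by (rule norm_infsum_le[OF 1 has_sum_infsum[OF g]]) (simp add: g_def norm_nat_powr)
    also have "\<dots> \<le> infsum g (UNIV - {..<Suc N})"
    proof (rule infsum_mono_neutral[OF g g])
      \<comment> \<open>An index of the sieved set that is not above N can only be 0, because an n
        with 2 \<le> n \<le> N has a prime factor p \<le> N.\<close>
      fix n assume n: "n \<in> (A - {1}) - (UNIV - {..<Suc N})"
      have "n = 0"
      proof (rule ccontr)
        assume "n \<noteq> 0"
        moreover obtain p where p: "prime p" "p dvd n" using n prime_factor_nat[of n] by auto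
        ultimately have "p \<le> n" by (auto intro: dvd_imp_le)
        then have "p \<in> P" using p n by (auto simp: P_def)
        then show False using n p \<open>n \<noteq> 0\<close> by (auto simp: A_def)
      qed
      then show "g n \<le> 0" by (simp add: g_def)
    qed (auto simp: g_def)
    finally have "norm (S - 1) \<le> tail N" by (simp only: tl)
    then show ?thesis by (simp add: S_def P_def)
  qed
  then show ?thesis
    by (intro LIM_zero_cancel[OF Lim_null_comparison[OF _ tail]] always_eventually) auto
qed

text \<open>Each \<open>zD s\<close> times its finite product tends to 1, while the weighted product
  of the finite products is at most 1, prime by prime. So the weighted product of the zeta values
  alone has to be at least 1.\<close>

lemma three_four_one_zD:
  fixes \<sigma> t :: real
  assumes "\<sigma> > 1"
  shows "norm (zD \<sigma>) ^ 3 * norm (zD (Complex \<sigma> t)) ^ 4 * norm (zD (Complex \<sigma> (2 * t))) \<ge> 1"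
proof -
  define E where "E = (\<lambda>s N. \<Prod>p | prime p \<and> p \<le> N. 1 - of_nat p powr (- s) :: complex)"
  define c where "c = norm (zD \<sigma>) ^ 3 * norm (zD (Complex \<sigma> t)) ^ 4 * norm (zD (Complex \<sigma> (2 * t)))"
  have E: "(\<lambda>N. zD s * E s N) \<longlonglongrightarrow> 1" if "Re s > 1" for s
    using euler_product[OF that] by (simp add: E_def)
  have lim: "(\<lambda>N. norm (zD \<sigma> * E \<sigma> N) ^ 3 * norm (zD (Complex \<sigma> t) * E (Complex \<sigma> t) N) ^ 4 *
          norm (zD (Complex \<sigma> (2 * t)) * E (Complex \<sigma> (2 * t)) N)) \<longlonglongrightarrow> norm (1::complex) ^ 3 * norm (1::complex) ^ 4 * norm (1::complex)"
    using assms by (intro tendsto_mult tendsto_power tendsto_norm E) auto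
  have le: "norm (zD \<sigma> * E \<sigma> N) ^ 3 * norm (zD (Complex \<sigma> t) * E (Complex \<sigma> t) N) ^ 4 *
          norm (zD (Complex \<sigma> (2 * t)) * E (Complex \<sigma> (2 * t)) N) \<le> c" for N
  proof -
    have "norm (E \<sigma> N) ^ 3 * norm (E (Complex \<sigma> t) N) ^ 4 * norm (E (Complex \<sigma> (2 * t)) N) =
      (\<Prod>p | prime p \<and> p \<le> N. norm (1 - of_nat p powr (- of_real \<sigma>) :: complex) ^ 3 *
          norm (1 - of_nat p powr (- Complex \<sigma> t) :: complex) ^ 4 *
          norm (1 - of_nat p powr (- Complex \<sigma> (2 * t)) :: complex))"
      by (simp add: E_def prod.distrib flip: prod_norm prod_power_distrib)
    also have "\<dots> \<le> 1"
    proof (rule prod_le_1, safe)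
      fix p :: nat assume p: "prime p"
      define r where "r = real p powr (- \<sigma>)"
      define u where "u = cis (- t * ln p)"
      have p2: "real p \<ge> 2" using prime_ge_2_nat[OF p] by simp
      have r: "0 \<le> r" "r < 1" using p2 assms by (auto simp: r_def intro: powr_less_one)
      have L: "ln (of_nat p :: complex) = of_real (ln (real p))"
        using p2 Ln_of_real[of "real p"] by simp
      have pw: "of_nat p powr (- Complex \<sigma> x) = of_real r * cis (- x * ln p)" for x
        using p2 by (simp add: powr_def r_def exp_eq_polar L)
      have 1: "of_nat p powr (- of_real \<sigma>) = complex_of_real r"
        using p2 by (simp add: powr_def r_def exp_eq_polar L)
      have 2: "of_nat p powr (- Complex \<sigma> t) = of_real r * u" unfolding pw u_def ..
      have 3: "of_nat p powr (- Complex \<sigma> (2 * t)) = of_real r * u\<^sup>2" unfolding pw u_def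
        by (simp add: Complex.DeMoivre mult.assoc)
      show "norm (1 - of_nat p powr (- of_real \<sigma>) :: complex) ^ 3 *
          norm (1 - of_nat p powr (- Complex \<sigma> t) :: complex) ^ 4 *
          norm (1 - of_nat p powr (- Complex \<sigma> (2 * t)) :: complex) \<le> 1"
        unfolding 1 2 3 by (rule three_four_one_local[OF r]) (simp add: u_def)
    qed auto
    finally have "c * (norm (E \<sigma> N) ^ 3 * norm (E (Complex \<sigma> t) N) ^ 4 * norm (E (Complex \<sigma> (2 * t)) N)) \<le> c * 1"
      by (intro mult_left_mono) (auto simp: c_def)
    moreover have "(a * x) ^ 3 * (b * y) ^ 4 * (d * z) = a ^ 3 * b ^ 4 * d * (x ^ 3 * y ^ 4 * z)"
      for a b d x y z :: real by (simp add: power_mult_distrib)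
    ultimately show ?thesis unfolding norm_mult c_def by (simp only: mult_1_right)
  qed
  have "norm (1::complex) ^ 3 * norm (1::complex) ^ 4 * norm (1::complex) \<le> c"
    by (rule LIMSEQ_le_const2[OF lim], rule exI[of _ 0], intro allI impI, rule le)
  then show ?thesis by (simp add: c_def)
qed

section \<open>Nonvanishing of zeta on Re s = 1 and a polynomial lower bound\<close>

lemma three_four_one_zh:
  obtains C where "C > 0" "\<And>\<sigma> t. 1 < \<sigma> \<Longrightarrow> \<sigma> \<le> 2 \<Longrightarrow>
    (\<sigma> - 1) ^ 3 * \<bar>t\<bar> ^ 5 \<le> C ^ 4 * (1 + \<bar>t\<bar>)\<^sup>2 * norm (zeta_reg (Complex \<sigma> t)) ^ 4"
proof -
  obtain B where B: "B > 0" "\<And>s. Re s \<ge> 1/2 \<Longrightarrow> Re s \<le> 4 \<Longrightarrow> norm (zeta_reg s) \<le> B * (1 + \<bar>Im s\<bar>)\<^sup>2"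
    using norm_zeta_reg_bound by blast
  define C where "C = max 4 B"
  have C: "C \<ge> 4" "B \<le> C" by (auto simp: C_def)
  have Bound: "norm (zeta_reg s) \<le> C * (1 + \<bar>Im s\<bar>)\<^sup>2" if "Re s \<ge> 1/2" "Re s \<le> 4" for s
    using B(2)[OF that] mult_right_mono[OF C(2), of "(1 + \<bar>Im s\<bar>)\<^sup>2"] by simp
  show ?thesis
  proof (rule that[of "2 * C"])
    show "2 * C > 0" using C by simp
    fix \<sigma> t :: real
    assume \<sigma>: "1 < \<sigma>" "\<sigma> \<le> 2"
    define y where "y = 1 + \<bar>t\<bar>"
    define z1 z2 z3 where "z1 = norm (zeta_reg \<sigma>)" and "z2 = norm (zeta_reg (Complex \<sigma> t))" and "z3 = norm (zeta_reg (Complex \<sigma> (2 * t)))"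
    define e1 e2 e3 where "e1 = norm (zD \<sigma>)" and "e2 = norm (zD (Complex \<sigma> t))" and "e3 = norm (zD (Complex \<sigma> (2 * t)))"
    have nn: "e1 \<ge> 0" "e2 \<ge> 0" "e3 \<ge> 0" "z2 \<ge> 0" "z1 \<ge> 0" by (simp_all add: e1_def e2_def e3_def z2_def z1_def)
    have "norm (complex_of_real \<sigma> - 1) = \<sigma> - 1"
      using norm_of_real[of "\<sigma> - 1", where 'a = complex] \<sigma> by simp
    then have 1: "(\<sigma> - 1) * e1 = z1"
      using \<sigma> by (simp add: z1_def e1_def zeta_reg_eq_zD norm_mult)
    have im: "\<bar>x\<bar> \<le> norm (Complex \<sigma> x - 1)" for x
      using abs_Im_le_cmod[of "Complex \<sigma> x - 1"] by simp
    have 2: "\<bar>t\<bar> * e2 \<le> z2"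
      using \<sigma> im[of t] nn by (auto simp: z2_def e2_def zeta_reg_eq_zD norm_mult intro!: mult_right_mono)
    have 3: "\<bar>t\<bar> * e3 \<le> z3"
    proof -
      have "\<bar>t\<bar> \<le> norm (Complex \<sigma> (2 * t) - 1)" using im[of "2 * t"] by simp
      then show ?thesis
        using \<sigma> nn by (auto simp: z3_def e3_def zeta_reg_eq_zD norm_mult intro!: mult_right_mono)
    qed
    \<comment> \<open>Powers are supplied that turn zeta values into \<open>zeta_reg\<close>:
      \<sigma> - 1 three times, and |t| \<le> |s - 1| four times at height t and once at height 2 t.
      Bounding the first and third factors from above then leaves a lower bound for the
      second.\<close>
    have "(\<sigma> - 1) ^ 3 * \<bar>t\<bar> ^ 5 * 1 \<le> (\<sigma> - 1) ^ 3 * \<bar>t\<bar> ^ 5 * (e1 ^ 3 * e2 ^ 4 * e3)"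
      using three_four_one_zD[OF \<sigma>(1), of t] \<sigma> by (intro mult_left_mono) (auto simp: e1_def e2_def e3_def)
    also have "\<dots> = ((\<sigma> - 1) * e1) ^ 3 * (\<bar>t\<bar> * e2) ^ 4 * (\<bar>t\<bar> * e3)"
    proof -
      have "a ^ 3 * b ^ 5 * (c ^ 3 * d ^ 4 * e) = (a * c) ^ 3 * (b * d) ^ 4 * (b * e)" for a b c d e :: real
        by algebra
      then show ?thesis .
    qed
    also have "\<dots> \<le> z1 ^ 3 * z2 ^ 4 * z3"
      unfolding 1 using 2 3 nn by (intro mult_mono power_mono) auto
    also have "\<dots> \<le> C ^ 3 * z2 ^ 4 * (C * (2 * y)\<^sup>2)"
    proof (intro mult_mono power_mono)
      show "z1 \<le> C" using Bound[of \<sigma>] \<sigma> by (simp add: z1_def)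
      have "z3 \<le> C * (1 + \<bar>2 * t\<bar>)\<^sup>2" using Bound[of "Complex \<sigma> (2 * t)"] \<sigma> by (simp add: z3_def)
      also have "\<dots> \<le> C * (2 * y)\<^sup>2" using C by (intro mult_left_mono power_mono) (auto simp: y_def)
      finally show "z3 \<le> C * (2 * y)\<^sup>2" .
    qed (use nn C in \<open>auto simp: z3_def\<close>)
    also have "\<dots> = 4 * C ^ 4 * y\<^sup>2 * z2 ^ 4" by algebra
    also have "\<dots> \<le> (2 * C) ^ 4 * y\<^sup>2 * z2 ^ 4"
      using C nn by (intro mult_right_mono) (auto simp: power_mult_distrib)
    finally show "(\<sigma> - 1) ^ 3 * \<bar>t\<bar> ^ 5 \<le> (2 * C) ^ 4 * (1 + \<bar>t\<bar>)\<^sup>2 * norm (zeta_reg (Complex \<sigma> t)) ^ 4"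
      by (simp add: y_def z2_def)
  qed
qed

text \<open>Cauchy's estimate on discs of radius 1/2, which stay in Re s \<ge> 1/2, bounds the
  derivative along the horizontal segment at height t. The 8 is 2^2, from doubling 1 + |t|, divided
  by the radius.\<close>

lemma zeta_reg_lipschitz:
  obtains C where "C > 0" "\<And>a b t. a \<in> {1..2} \<Longrightarrow> b \<in> {1..2} \<Longrightarrow>
    norm (zeta_reg (Complex a t) - zeta_reg (Complex b t)) \<le> C * \<bar>a - b\<bar> * (1 + \<bar>t\<bar>)\<^sup>2"
proof -
  obtain B where B: "B > 0" "\<And>s. Re s \<ge> 1/2 \<Longrightarrow> Re s \<le> 4 \<Longrightarrow> norm (zeta_reg s) \<le> B * (1 + \<bar>Im s\<bar>)\<^sup>2"
    using norm_zeta_reg_bound by blast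
  show ?thesis
  proof (rule that[of "8 * B"])
    fix a b t :: real
    assume ab: "a \<in> {1..2}" "b \<in> {1..2}"
    define y where "y = 1 + \<bar>t\<bar>"
    define S where "S = {z. 1 \<le> Re z} \<inter> {z. Re z \<le> 2} \<inter> {z. Im z = t}"
    have holo: "zeta_reg field_differentiable (at z)" if "Re z > 0" for z
      using holomorphic_on_imp_differentiable_at[OF holomorphic_zeta_reg open_halfspace_Re_gt] that by simp
    have "norm (zeta_reg (Complex a t) - zeta_reg (Complex b t)) \<le> (8 * B * y\<^sup>2) * norm (Complex a t - Complex b t)"
    proof (rule field_differentiable_bound[where S = S and f' = "deriv zeta_reg"])
      show "convex S"
        unfolding S_def by (intro convex_Int convex_halfspace_Re_le convex_halfspace_Re_ge)
          (auto simp: convex_def algebra_simps simp flip: distrib_right)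
      fix z assume z: "z \<in> S"
      then show "(zeta_reg has_field_derivative deriv zeta_reg z) (at z within S)"
        using holo[of z] by (auto simp: S_def intro: DERIV_deriv_iff_field_differentiable[THEN iffD2] has_field_derivative_at_within)
      have ball: "Re w \<ge> 1/2" "Re w \<le> 4" "\<bar>Im w\<bar> \<le> \<bar>t\<bar> + 1/2" if "w \<in> cball z (1/2)" for w
        using that abs_Re_le_cmod[of "z - w"] abs_Im_le_cmod[of "z - w"] z by (auto simp: S_def dist_norm)
      have "norm ((deriv ^^ 1) zeta_reg z) \<le> fact 1 * (B * (2 * y)\<^sup>2) / (1/2) ^ 1"
      proof (rule Cauchy_inequality)
        show "zeta_reg holomorphic_on ball z (1/2)"
        proof (rule holomorphic_on_subset[OF holomorphic_zeta_reg])
          show "ball z (1/2) \<subseteq> {s. 0 < Re s}"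
          proof
            fix w assume "w \<in> ball z (1/2)"
            then have "w \<in> cball z (1/2)" by simp
            then show "w \<in> {s. 0 < Re s}" using ball(1)[of w] by simp
          qed
        qed
        show "continuous_on (cball z (1/2)) zeta_reg"
          by (rule continuous_on_subset[OF holomorphic_on_imp_continuous_on[OF holomorphic_zeta_reg]]) (use ball in force)
        fix w assume "norm (z - w) = 1/2"
        then have w: "w \<in> cball z (1/2)" by (simp add: dist_norm)
        have "norm (zeta_reg w) \<le> B * (1 + \<bar>Im w\<bar>)\<^sup>2" using ball[OF w] by (intro B) auto
        also have "\<dots> \<le> B * (2 * y)\<^sup>2"
          using ball[OF w] B by (intro mult_left_mono power_mono) (auto simp: y_def)
        finally show "norm (zeta_reg w) \<le> B * (2 * y)\<^sup>2" .
      qed simp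
      then show "norm (deriv zeta_reg z) \<le> 8 * B * y\<^sup>2" by (simp add: power_mult_distrib)
    qed (use ab in \<open>auto simp: S_def\<close>)
    also have "norm (Complex a t - Complex b t) = \<bar>a - b\<bar>"
      by (simp add: cmod_def)
    finally show "norm (zeta_reg (Complex a t) - zeta_reg (Complex b t)) \<le> 8 * B * \<bar>a - b\<bar> * (1 + \<bar>t\<bar>)\<^sup>2"
      by (simp add: y_def mult_ac)
  qed (use B in simp)
qed

text \<open>A zero at 1 + it would make \<open>zeta_reg\<close> at 1 + \<delta> + it of size
  O(\<delta>) by the Lipschitz bound, so its fourth power O(\<delta>^4); the 3-4-1 inequality keeps
  that fourth power above a constant times \<delta>^3, which fails as \<delta> tends to 0.\<close>

lemma zeta_reg_nonzero_line_1: "zeta_reg (Complex 1 t) \<noteq> 0"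
proof (cases "t = 0")
  case True
  then have "Complex 1 t = 1" by (simp add: complex_eq_iff)
  then show ?thesis by simp
next
  case False
  obtain K where K: "K > 0" "\<And>\<sigma> t. 1 < \<sigma> \<Longrightarrow> \<sigma> \<le> 2 \<Longrightarrow>
    (\<sigma> - 1) ^ 3 * \<bar>t\<bar> ^ 5 \<le> K ^ 4 * (1 + \<bar>t\<bar>)\<^sup>2 * norm (zeta_reg (Complex \<sigma> t)) ^ 4"
    using three_four_one_zh by blast
  obtain L where L: "L > 0" "\<And>a b t. a \<in> {1..2} \<Longrightarrow> b \<in> {1..2} \<Longrightarrow>
    norm (zeta_reg (Complex a t) - zeta_reg (Complex b t)) \<le> L * \<bar>a - b\<bar> * (1 + \<bar>t\<bar>)\<^sup>2"
    using zeta_reg_lipschitz by blast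
  define y where "y = 1 + \<bar>t\<bar>"
  define R where "R = K ^ 4 * y\<^sup>2 * (L * y\<^sup>2) ^ 4"
  have y: "y > 0" by (simp add: y_def)
  have R: "R > 0" unfolding R_def using K L y by (intro mult_pos_pos zero_less_power)
  show ?thesis
  proof
    assume *: "zeta_reg (Complex 1 t) = 0"
    have le: "\<bar>t\<bar> ^ 5 \<le> R * \<delta>" if \<delta>: "0 < \<delta>" "\<delta> \<le> 1" for \<delta>
    proof -
      have "norm (zeta_reg (Complex (1 + \<delta>) t)) \<le> L * \<delta> * y\<^sup>2"
        using L(2)[of "1 + \<delta>" 1 t] \<delta> by (simp add: * y_def)
      then have "norm (zeta_reg (Complex (1 + \<delta>) t)) ^ 4 \<le> (L * \<delta> * y\<^sup>2) ^ 4"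
        by (intro power_mono) auto
      then have "K ^ 4 * y\<^sup>2 * norm (zeta_reg (Complex (1 + \<delta>) t)) ^ 4 \<le> K ^ 4 * y\<^sup>2 * (L * \<delta> * y\<^sup>2) ^ 4"
        using K by (intro mult_left_mono) auto
      also have "\<dots> = \<delta> ^ 3 * (R * \<delta>)"
        unfolding R_def by algebra
      finally have up: "K ^ 4 * y\<^sup>2 * norm (zeta_reg (Complex (1 + \<delta>) t)) ^ 4 \<le> \<delta> ^ 3 * (R * \<delta>)" .
      have "\<delta> ^ 3 * \<bar>t\<bar> ^ 5 \<le> K ^ 4 * y\<^sup>2 * norm (zeta_reg (Complex (1 + \<delta>) t)) ^ 4"
        using K(2)[of "1 + \<delta>" t] \<delta> by (simp add: y_def)
      then have "\<delta> ^ 3 * \<bar>t\<bar> ^ 5 \<le> \<delta> ^ 3 * (R * \<delta>)" using up by (rule order_trans)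
      then show ?thesis using \<delta> by simp
    qed
    define \<delta> where "\<delta> = min 1 (\<bar>t\<bar> ^ 5 / (2 * R))"
    have "\<delta> > 0" "\<delta> \<le> 1" "R * \<delta> \<le> \<bar>t\<bar> ^ 5 / 2"
      using False R by (auto simp: \<delta>_def min_def field_simps)
    with le[of \<delta>] have "\<bar>t\<bar> ^ 5 \<le> \<bar>t\<bar> ^ 5 / 2" by linarith
    then show False using False by simp
  qed
qed

lemma zeta_reg_nonzero_ge_1:
  assumes "Re s \<ge> 1"
  shows "zeta_reg s \<noteq> 0"
proof (cases "Re s = 1")
  case True
  then show ?thesis using zeta_reg_nonzero_line_1[of "Im s"] by (metis complex.exhaust_sel)
next
  case False
  then show ?thesis using assms zD_nonzero[of s] by (auto simp: zeta_reg_eq_zD)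
qed

text \<open>The nonvanishing argument made quantitative: from 1 + \<eta> on, the 3-4-1 inequality
  gives a lower bound, and points closer to the line are reached by the Lipschitz bound. Low
  heights, where the factor |t|^5 degenerates, are handled by compactness.\<close>

lemma zeta_reg_lower_bound:
  obtains c where "c > 0" "\<And>s. 1 \<le> Re s \<Longrightarrow> Re s \<le> 2 \<Longrightarrow> norm (zeta_reg s) * (1 + \<bar>Im s\<bar>) ^ 3 \<ge> c"
proof -
  obtain K where K: "K > 0" "\<And>\<sigma> t. 1 < \<sigma> \<Longrightarrow> \<sigma> \<le> 2 \<Longrightarrow>
    (\<sigma> - 1) ^ 3 * \<bar>t\<bar> ^ 5 \<le> K ^ 4 * (1 + \<bar>t\<bar>)\<^sup>2 * norm (zeta_reg (Complex \<sigma> t)) ^ 4"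
    using three_four_one_zh by blast
  obtain L where L: "L > 0" "\<And>a b t. a \<in> {1..2} \<Longrightarrow> b \<in> {1..2} \<Longrightarrow>
    norm (zeta_reg (Complex a t) - zeta_reg (Complex b t)) \<le> L * \<bar>a - b\<bar> * (1 + \<bar>t\<bar>)\<^sup>2"
    using zeta_reg_lipschitz by blast
  \<comment> \<open>Makes the Lipschitz loss, which carries \<nu> L \<le> 1 / (6 K), at most half of
    the lower bound, which carries 1 / (3 K).\<close>
  define \<nu> where "\<nu> = min 1 (1 / (6 * K * L))"
  have \<nu>: "0 < \<nu>" "\<nu> \<le> 1" "\<nu> * L \<le> 1 / (6 * K)"
    using K L by (auto simp: \<nu>_def min_def field_simps)
  define c1 where "c1 = \<nu> ^ 3 / (6 * K)"
  have c1: "c1 > 0" using \<nu> K by (simp add: c1_def)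
  have far: "norm (zeta_reg (Complex \<sigma> t)) * (1 + \<bar>t\<bar>) ^ 3 \<ge> c1" if \<sigma>: "1 \<le> \<sigma>" "\<sigma> \<le> 2" and t: "\<bar>t\<bar> \<ge> 1" for \<sigma> t
  proof -
    define y where "y = 1 + \<bar>t\<bar>"
    have y: "y \<ge> 2" "y / 2 \<le> \<bar>t\<bar>" using t by (auto simp: y_def)
    \<comment> \<open>At abscissa 1 + \<eta> the 3-4-1 inequality gives about (\<eta> y)^(3/4), and
      the Lipschitz bound loses L \<eta> y^2. For this \<eta> they are \<nu>^3 y^(-3) and L \<nu>^4
      y^(-3), of the same order in y.\<close>
    define \<eta> where "\<eta> = \<nu> ^ 4 / y ^ 5"
    have y5: "y ^ 5 \<ge> 1" using y by (intro one_le_power) auto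
    have "\<nu> ^ 4 \<le> 1" using \<nu> by (intro power_le_one) auto
    then have "\<eta> \<le> 1" using y5 unfolding \<eta>_def by (subst pos_divide_le_eq) linarith+
    have \<eta>: "0 < \<eta>" "\<eta> \<le> 1" using \<nu> y \<open>\<eta> \<le> 1\<close> by (auto simp: \<eta>_def)
    define \<tau> where "\<tau> = max \<sigma> (1 + \<eta>)"
    have \<tau>: "1 < \<tau>" "\<tau> \<le> 2" "\<eta> \<le> \<tau> - 1" "\<bar>\<tau> - \<sigma>\<bar> \<le> \<eta>" using \<sigma> \<eta> by (auto simp: \<tau>_def)
    have yp: "y > 0" using y by simp
    have "(\<nu> ^ 3 / y ^ 3 / (3 * K)) ^ 4 \<le> norm (zeta_reg (Complex \<tau> t)) ^ 4"
    proof -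
      have "\<eta> ^ 3 * (y / 2) ^ 5 \<le> (\<tau> - 1) ^ 3 * \<bar>t\<bar> ^ 5"
        using \<tau> y \<eta> by (intro mult_mono power_mono) auto
      also have "\<dots> \<le> K ^ 4 * y\<^sup>2 * norm (zeta_reg (Complex \<tau> t)) ^ 4"
        using K(2)[OF \<tau>(1,2), of t] by (simp add: y_def)
      finally have "\<eta> ^ 3 * (y / 2) ^ 5 / (K ^ 4 * y\<^sup>2) \<le> norm (zeta_reg (Complex \<tau> t)) ^ 4"
        using K yp by (subst pos_divide_le_eq) (auto simp: mult_ac)
      moreover have "(\<nu> ^ 3 / y ^ 3 / (3 * K)) ^ 4 = \<nu> ^ 12 / (81 * K ^ 4 * y ^ 12)"
        by (simp add: power_divide power_mult_distrib flip: power_mult)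
      moreover have "\<eta> ^ 3 * (y / 2) ^ 5 / (K ^ 4 * y\<^sup>2) = \<nu> ^ 12 / (32 * K ^ 4 * y ^ 12)"
        using yp K by (simp add: \<eta>_def field_simps)
      \<comment> \<open>Since 81 = 3^4 exceeds 32 = 2^5, the number 3 can stand in for the fourth
        root of 32.\<close>
      moreover have "\<nu> ^ 12 / (81 * K ^ 4 * y ^ 12) \<le> \<nu> ^ 12 / (32 * K ^ 4 * y ^ 12)"
        using \<nu> K yp by (intro divide_left_mono mult_pos_pos) auto
      ultimately show ?thesis by linarith
    qed
    then have 1: "\<nu> ^ 3 / y ^ 3 / (3 * K) \<le> norm (zeta_reg (Complex \<tau> t))"
      using power_le_imp_le_base[of "\<nu> ^ 3 / y ^ 3 / (3 * K)" 3 "norm (zeta_reg (Complex \<tau> t))"] by simp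
    have "norm (zeta_reg (Complex \<tau> t) - zeta_reg (Complex \<sigma> t)) \<le> L * \<bar>\<tau> - \<sigma>\<bar> * y\<^sup>2"
      using L(2)[of \<tau> \<sigma> t] \<sigma> \<tau> by (simp add: y_def)
    also have "\<dots> \<le> L * \<eta> * y\<^sup>2" using \<tau> L by (intro mult_right_mono mult_left_mono) auto
    also have "\<dots> = (\<nu> * L) * \<nu> ^ 3 / y ^ 3"
      using yp by (simp add: \<eta>_def field_simps power2_eq_square eval_nat_numeral)
    also have "\<dots> \<le> 1 / (6 * K) * \<nu> ^ 3 / y ^ 3"
      using \<nu> yp by (intro divide_right_mono mult_right_mono) auto
    finally have 2: "norm (zeta_reg (Complex \<tau> t) - zeta_reg (Complex \<sigma> t)) \<le> c1 / y ^ 3" by (simp add: c1_def)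
    have "\<nu> ^ 3 / y ^ 3 / (3 * K) = c1 / y ^ 3 + c1 / y ^ 3" by (simp add: c1_def)
    with 1 2 norm_triangle_ineq2[of "zeta_reg (Complex \<tau> t)" "zeta_reg (Complex \<sigma> t)"]
    have "c1 / y ^ 3 \<le> norm (zeta_reg (Complex \<sigma> t))" by linarith
    then show ?thesis using yp by (simp add: y_def pos_divide_le_eq)
  qed
  define Q where "Q = cbox (Complex 1 (-1)) (Complex 2 1)"
  have Q: "Q \<noteq> {}" "compact Q" by (auto simp: Q_def box_ne_empty Basis_complex_def)
  have "continuous_on Q (\<lambda>s. norm (zeta_reg s))"
    by (intro continuous_on_norm continuous_on_subset[OF holomorphic_on_imp_continuous_on[OF holomorphic_zeta_reg]])
       (auto simp: Q_def in_cbox_complex_iff)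
  from continuous_attains_inf[OF Q(2,1) this] obtain s0
    where s0: "s0 \<in> Q" "\<And>s. s \<in> Q \<Longrightarrow> norm (zeta_reg s0) \<le> norm (zeta_reg s)" by blast
  have "norm (zeta_reg s0) > 0" using s0 zeta_reg_nonzero_ge_1[of s0] by (auto simp: Q_def in_cbox_complex_iff)
  then show ?thesis
  proof (intro that[of "min c1 (norm (zeta_reg s0))"])
    fix s assume s: "1 \<le> Re s" "Re s \<le> 2"
    show "norm (zeta_reg s) * (1 + \<bar>Im s\<bar>) ^ 3 \<ge> min c1 (norm (zeta_reg s0))"
    proof (cases "\<bar>Im s\<bar> \<ge> 1")
      case True
      then show ?thesis using far[of "Re s" "Im s"] s by (simp add: min.coboundedI1)
    next
      case False
      then have "norm (zeta_reg s0) * 1 \<le> norm (zeta_reg s) * (1 + \<bar>Im s\<bar>) ^ 3"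
        using s by (intro mult_mono s0) (auto simp: Q_def in_cbox_complex_iff)
      then show ?thesis by (simp add: min.coboundedI2)
    qed
  qed (use c1 in simp)
qed

section \<open>The reciprocal of zeta under the Riemann hypothesis\<close>

text \<open>The map w / (2 A - w) sends the half-plane Re w < A into the unit disc and fixes 0, so
  Schwarz's lemma applies to its composition with f.\<close>

lemma borel_caratheodory:
  assumes f: "f holomorphic_on ball 0 R" "f 0 = 0"
    and A: "A > 0" "\<And>z. norm z < R \<Longrightarrow> Re (f z) < A"
    and r: "norm z \<le> r" "r < R"
  shows "norm (f z) \<le> 2 * A * r / (R - r)"
proof -
  have r0: "r \<ge> 0" "R > 0" using r norm_ge_zero[of z] by linarith+
  define g where "g = (\<lambda>w. f (of_real R * w) / (of_real (2 * A) - f (of_real R * w)))"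
  have in_ball: "norm (of_real R * w) < R" if "norm w < 1" for w :: complex
    using that r0 by (simp add: norm_mult)
  have lt: "norm (f w) < norm (of_real (2 * A) - f w)" if "norm w < R" for w
  proof -
    have "(norm (of_real (2 * A) - f w))\<^sup>2 - (norm (f w))\<^sup>2 = 4 * A * (A - Re (f w))"
      unfolding cmod_power2 by (simp add: power2_eq_square algebra_simps)
    moreover have "\<dots> > 0" using A that by simp
    ultimately have "(norm (f w))\<^sup>2 < (norm (of_real (2 * A) - f w))\<^sup>2" by linarith
    then show ?thesis by (rule power2_less_imp_less) simp
  qed
  have nz: "of_real (2 * A) - f w \<noteq> 0" if "norm w < R" for w
    using lt[OF that] by auto
  have "norm (g w) \<le> norm w" if "norm w < 1" for w
  proof (rule Schwarz_Lemma(1)[OF _ _ _ that])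
    have "(\<lambda>w. f (of_real R * w)) holomorphic_on ball 0 1"
      by (intro holomorphic_on_compose_gen[OF _ f(1), unfolded o_def] holomorphic_intros) (auto dest: in_ball)
    then show "g holomorphic_on ball 0 1"
      unfolding g_def by (intro holomorphic_intros) (use nz in_ball in auto)
    show "g 0 = 0" by (simp add: g_def f(2))
    show "norm (g w) < 1" if "norm w < 1" for w
      using lt[OF in_ball[OF that]] by (simp add: g_def norm_divide divide_less_eq)
  qed
  moreover have "norm (z / of_real R) < 1" using r r0 by (simp add: norm_divide divide_less_eq)
  ultimately have "norm (g (z / of_real R)) \<le> norm (z / of_real R)" by blast
  also have "\<dots> \<le> r / R" using r r0 by (simp add: norm_divide divide_right_mono)
  also have "g (z / of_real R) = f z / (of_real (2 * A) - f z)" using r0 by (simp add: g_def)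
  finally have "norm (f z) \<le> r / R * norm (of_real (2 * A) - f z)"
    using nz[of z] r by (simp add: norm_divide divide_le_eq split: if_splits)
  also have "\<dots> \<le> r / R * (2 * A + norm (f z))"
    using A r0 norm_triangle_ineq4[of "of_real (2 * A)" "f z"] by (intro mult_left_mono) (auto simp: norm_mult)
  finally have "norm (f z) * (R - r) \<le> 2 * A * r"
    using r0 by (simp add: field_simps)
  then show ?thesis using r by (simp add: pos_le_divide_eq)
qed

text \<open>
  A substitute for Hadamard's three circles theorem: a Taylor coefficient is bounded by means of
  the inner disc if its index is small and by means of the outer disc if its index is large.
\<close>
lemma two_discs:
  assumes "0 < r" "r \<le> \<rho>" "\<rho> < R" "\<epsilon> > 0"
  obtains K :: real where "K \<ge> 0" "\<And>f B L z. f holomorphic_on ball 0 R' \<Longrightarrow> R < R' \<Longrightarrow>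
    (\<And>z. norm z \<le> r \<Longrightarrow> norm (f z) \<le> B) \<Longrightarrow> (\<And>z. norm z \<le> R \<Longrightarrow> norm (f z) \<le> L) \<Longrightarrow>
    norm z \<le> \<rho> \<Longrightarrow> norm (f z :: complex) \<le> K * B + \<epsilon> * L"
proof -
  define q where "q = \<rho> / R"
  have q: "0 < q" "q < 1" using assms by (auto simp: q_def)
  have "(\<lambda>N. q ^ N / (1 - q)) \<longlonglongrightarrow> 0 / (1 - q)"
    using q by (intro tendsto_divide LIMSEQ_power_zero tendsto_const) auto
  then have "eventually (\<lambda>N. q ^ N / (1 - q) < \<epsilon>) sequentially"
    using assms by (intro order_tendstoD) auto
  \<comment> \<open>N, and with it K, depends only on the radii and \<epsilon>; the result is later
    applied to a family of functions indexed by the height.\<close>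
  then obtain N where N: "q ^ N / (1 - q) < \<epsilon>" by (auto simp: eventually_sequentially)
  define K where "K = (\<Sum>k<N. (\<rho> / r) ^ k)"
  show ?thesis
  proof (rule that[of K])
    show "K \<ge> 0" using assms by (auto simp: K_def intro!: sum_nonneg)
    fix f B L and z :: complex
    assume f: "f holomorphic_on ball 0 R'" and R': "R < R'"
      and B: "\<And>z. norm z \<le> r \<Longrightarrow> norm (f z) \<le> B" and L: "\<And>z. norm z \<le> R \<Longrightarrow> norm (f z) \<le> L"
      and z: "norm z \<le> \<rho>"
    define a where "a = (\<lambda>k. (deriv ^^ k) f 0 / fact k)"
    have coeff: "norm (a k) \<le> M / x ^ k"
      if "0 < x" "x \<le> R" "\<And>z. norm z \<le> x \<Longrightarrow> norm (f z) \<le> M" for k x M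
    proof -
      have "norm ((deriv ^^ k) f 0) \<le> fact k * M / x ^ k"
      proof (rule Cauchy_inequality)
        show "f holomorphic_on ball 0 x" using that R' by (intro holomorphic_on_subset[OF f]) auto
        show "continuous_on (cball 0 x) f"
          using that R' by (intro continuous_on_subset[OF holomorphic_on_imp_continuous_on[OF f]]) auto
      qed (use that in auto)
      then show ?thesis by (simp add: a_def norm_divide field_simps)
    qed
    have L0: "L \<ge> 0" using order_trans[OF norm_ge_zero L[of 0]] assms by simp
    have B0: "B \<ge> 0" using order_trans[OF norm_ge_zero B[of 0]] assms by simp
    have "z \<in> ball 0 R'" using z assms R' by auto
    from holomorphic_power_series[OF f this] have s: "(\<lambda>k. a k * z ^ k) sums f z" by (simp add: a_def)
    have small: "norm (a k * z ^ k) \<le> B * (\<rho> / r) ^ k" for k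
    proof -
      have "norm (a k * z ^ k) \<le> B / r ^ k * \<rho> ^ k"
        unfolding norm_mult norm_power using assms B0 z
        by (intro mult_mono coeff[of r] B power_mono) auto
      then show ?thesis by (simp add: power_divide)
    qed
    have large: "norm (a k * z ^ k) \<le> L * q ^ k" for k
    proof -
      have "norm (a k * z ^ k) \<le> L / R ^ k * \<rho> ^ k"
        unfolding norm_mult norm_power using assms L0 z
        by (intro mult_mono coeff[of R] L power_mono) auto
      then show ?thesis by (simp add: power_divide q_def)
    qed
    have "f z = (\<Sum>k. a (k + N) * z ^ (k + N)) + (\<Sum>k<N. a k * z ^ k)"
      using suminf_split_initial_segment[OF sums_summable[OF s], of N] sums_unique[OF s] by simp
    also have "norm \<dots> \<le> norm (\<Sum>k. a (k + N) * z ^ (k + N)) + norm (\<Sum>k<N. a k * z ^ k)"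
      by (rule norm_triangle_ineq)
    also have "norm (\<Sum>k<N. a k * z ^ k) \<le> (\<Sum>k<N. B * (\<rho> / r) ^ k)"
      by (intro order_trans[OF norm_sum] sum_mono small)
    also have "\<dots> = K * B" by (simp add: K_def sum_distrib_left mult.commute)
    also have "norm (\<Sum>k. a (k + N) * z ^ (k + N)) \<le> (\<Sum>k. L * q ^ N * q ^ k)"
    proof (rule norm_suminf_le)
      show "norm (a (k + N) * z ^ (k + N)) \<le> L * q ^ N * q ^ k" for k
        using large[of "k + N"] by (simp add: power_add mult_ac)
      show "summable (\<lambda>k. L * q ^ N * q ^ k)" using q by (intro summable_mult summable_geometric) auto
    qed
    also have "\<dots> = L * (q ^ N / (1 - q))" using q by (subst suminf_mult) (auto simp: suminf_geometric)
    also have "\<dots> \<le> L * \<epsilon>" using N L0 by (intro mult_left_mono) auto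
    finally show "norm (f z) \<le> K * B + \<epsilon> * L" by (simp add: mult.commute)
  qed
qed

lemma zeta_reg_nonzero_RH:
  assumes RH: riemann_hypothesis and s: "Re s > 1/2"
  shows "zeta_reg s \<noteq> 0"
proof (cases "Re s \<ge> 1")
  case False
  then have "s \<noteq> 1" by auto
  moreover have "riemann_zeta s \<noteq> 0" using RH s False by (auto simp: riemann_hypothesis_def)
  ultimately show ?thesis using s by (simp add: zeta_reg_eq_riemann_zeta)
qed (rule zeta_reg_nonzero_ge_1)

text \<open>Around s0 = 2 + it the disc of radius 3/2 lies in Re s > 1/2, so a logarithm of
  \<open>zeta_reg\<close> normalised at s0 exists there. Its real part is O(log) on this disc by
  polynomial growth, and O(1) on the disc of radius 3/4, where Re s \<ge> 5/4. Borel-Caratheodory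
  turns both into bounds of the modulus on smaller discs, and \<open>two_discs\<close> lowers the
  coefficient of the logarithm to \<epsilon> as far as Re s = b.\<close>

lemma inverse_zeta_growth_RH:
  fixes b \<epsilon> :: real
  assumes RH: riemann_hypothesis and b: "1/2 < b" "b \<le> 1" and \<epsilon>: "\<epsilon> > 0"
  obtains C where "C > 0" "\<And>s. b \<le> Re s \<Longrightarrow> Re s \<le> 2 \<Longrightarrow>
    norm ((s - 1) / (s * zeta_reg s)) \<le> C * (1 + \<bar>Im s\<bar>) powr (\<epsilon> - 1)"
proof -
  \<comment> \<open>The distance from 2 to b is \<rho>; R lies halfway between it and 3/2, the
    distance to the critical line.\<close>
  define \<rho> where "\<rho> = 2 - b"
  define R where "R = (\<rho> + 3/2) / 2"
  have \<rho>: "1 \<le> \<rho>" "\<rho> < R" "R < 3/2" using b by (auto simp: \<rho>_def R_def)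
  obtain C0 where C0: "C0 > 0" "\<And>s. Re s \<ge> 1/2 \<Longrightarrow> Re s \<le> 4 \<Longrightarrow> norm (zeta_reg s) \<le> C0 * (1 + \<bar>Im s\<bar>)\<^sup>2"
    using norm_zeta_reg_bound by blast
  define Z where "Z = 1 + (\<Sum>\<^sub>\<infinity>n. real n powr (- (5/4)))"
  have Z: "Z \<ge> 1" by (auto simp: Z_def intro!: infsum_nonneg)
  have zD_le: "norm (zD s) \<le> Z" and moebius_series_le: "norm (moebius_series s) \<le> Z" if "Re s \<ge> 5/4" for s
    using norm_zD_le[of "5/4" s] norm_moebius_series_le[of "5/4" s] that by (auto simp: Z_def)
  define M where "M = R / (3/2 - R)"
  have M: "M > 0" using \<rho> by (simp add: M_def)
  \<comment> \<open>The outer bound will be 2 (A1 + 2 ln y) M; multiplied by \<epsilon>' its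
    logarithmic part becomes \<epsilon> ln y.\<close>
  define \<epsilon>' where "\<epsilon>' = \<epsilon> / (4 * M)"
  have \<epsilon>': "\<epsilon>' > 0" using M \<epsilon> by (simp add: \<epsilon>'_def)
  obtain K where K: "K \<ge> 0" "\<And>f B L z. f holomorphic_on ball 0 (3/2) \<Longrightarrow> R < 3/2 \<Longrightarrow>
    (\<And>z. norm z \<le> 1/2 \<Longrightarrow> norm (f z) \<le> B) \<Longrightarrow> (\<And>z. norm z \<le> R \<Longrightarrow> norm (f z) \<le> L) \<Longrightarrow>
    norm z \<le> \<rho> \<Longrightarrow> norm (f z :: complex) \<le> K * B + \<epsilon>' * L"
    using two_discs[of "1/2" \<rho> R \<epsilon>' "3/2"] \<rho> \<epsilon>' by auto
  \<comment> \<open>Adding 1 and taking absolute values gives the strict inequality and the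
    positivity that Borel-Caratheodory asks for.\<close>
  define A1 where "A1 = 1 + \<bar>ln (9 * C0 * Z)\<bar>"
  define A2 where "A2 = 1 + \<bar>ln (2 * Z * Z)\<bar>"
  define K2 where "K2 = K * (4 * A2) + \<epsilon>' * (2 * A1 * M)"
  have main: "norm ((s - 1) / (s * zeta_reg s)) \<le> 2 * Z * exp K2 * (1 + \<bar>Im s\<bar>) powr (\<epsilon> - 1)"
    if s: "b \<le> Re s" "Re s \<le> 2" for s
  proof -
    define t where "t = Im s"
    define y where "y = 1 + \<bar>t\<bar>"
    define s0 where "s0 = Complex 2 t"
    have y: "y \<ge> 1" by (simp add: y_def)
    have s0_1: "1 \<le> norm (s0 - 1)" "y \<le> 2 * norm (s0 - 1)"
      using abs_Re_le_cmod[of "s0 - 1"] abs_Im_le_cmod[of "s0 - 1"] by (auto simp: s0_def y_def)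
    have inv0: "1 / norm (zeta_reg s0) \<le> Z / norm (s0 - 1)"
    proof -
      have "norm (1 / zD s0) \<le> Z" using moebius_series_le[of s0] moebius_series_eq[of s0] by (simp add: s0_def)
      then have "norm (1 / zD s0) / norm (s0 - 1) \<le> Z / norm (s0 - 1)"
        by (rule divide_right_mono) simp
      moreover have "zeta_reg s0 = (s0 - 1) * zD s0" by (rule zeta_reg_eq_zD) (simp add: s0_def)
      ultimately show ?thesis by (simp add: norm_mult norm_divide mult.commute)
    qed
    have Re_ball: "Re (s0 + w) > 1/2" "Re (s0 + w) \<le> 4" "\<bar>Im (s0 + w)\<bar> \<le> \<bar>t\<bar> + 3/2" if "norm w < 3/2" for w
      using that abs_Re_le_cmod[of w] abs_Im_le_cmod[of w] by (auto simp: s0_def)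
    have zeta_reg_nz: "zeta_reg (s0 + w) \<noteq> 0" if "norm w < 3/2" for w
      by (rule zeta_reg_nonzero_RH[OF RH Re_ball(1)[OF that]])
    have nz0: "zeta_reg s0 \<noteq> 0" using zeta_reg_nz[of 0] by simp
    have "(\<lambda>w. zeta_reg (s0 + w)) holomorphic_on ball 0 (3/2)"
      by (intro holomorphic_on_compose_gen[OF _ holomorphic_zeta_reg, unfolded o_def] holomorphic_intros)
         (use Re_ball(1) in force)
    then have "(\<lambda>w. zeta_reg (s0 + w) / zeta_reg s0) holomorphic_on ball 0 (3/2)"
      using nz0 by (intro holomorphic_intros) auto
    then obtain g where g: "g holomorphic_on ball 0 (3/2)"
      "\<And>w. w \<in> ball 0 (3/2) \<Longrightarrow> exp (g w) = zeta_reg (s0 + w) / zeta_reg s0"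
      using holomorphic_logarithm_exists[of "ball 0 (3/2)" "\<lambda>w. zeta_reg (s0 + w) / zeta_reg s0" 0] zeta_reg_nz nz0 by auto
    define f where "f = (\<lambda>w. g w - g 0)"
    have f: "f holomorphic_on ball 0 (3/2)" "f 0 = 0"
      unfolding f_def by (auto intro!: holomorphic_intros g(1))
    have exp_f: "exp (f w) = zeta_reg (s0 + w) / zeta_reg s0" if "norm w < 3/2" for w
      using g(2)[of w] g(2)[of 0] nz0 that by (simp add: f_def exp_diff)
    have Re_f: "Re (f w) = ln (norm (zeta_reg (s0 + w)) * (1 / norm (zeta_reg s0)))" if "norm w < 3/2" for w
    proof -
      have "exp (Re (f w)) = norm (zeta_reg (s0 + w)) * (1 / norm (zeta_reg s0))"
        using arg_cong[OF exp_f[OF that], of norm] by (simp add: norm_divide)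
      then show ?thesis by (metis ln_exp)
    qed
    have outer: "Re (f w) < A1 + 2 * ln y" if w: "norm w < 3/2" for w
    proof -
      have "norm (zeta_reg (s0 + w)) \<le> C0 * (1 + \<bar>Im (s0 + w)\<bar>)\<^sup>2"
        using Re_ball[OF w] by (intro C0) auto
      also have "\<dots> \<le> C0 * (3 * y)\<^sup>2"
        using C0 Re_ball[OF w] by (intro mult_left_mono power_mono) (auto simp: y_def)
      finally have "norm (zeta_reg (s0 + w)) * (1 / norm (zeta_reg s0)) \<le> C0 * (3 * y)\<^sup>2 * (Z / norm (s0 - 1))"
        using C0 by (intro mult_mono inv0) auto
      also have "\<dots> \<le> C0 * (3 * y)\<^sup>2 * (Z / 1)"
        using C0 Z s0_1 by (intro mult_left_mono divide_left_mono) auto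
      also have "\<dots> = (9 * C0 * Z) * y\<^sup>2" by (simp add: power_mult_distrib)
      finally have "Re (f w) \<le> ln ((9 * C0 * Z) * y\<^sup>2)"
        unfolding Re_f[OF w] using zeta_reg_nz[OF w] nz0 by (intro ln_mono) auto
      also have "\<dots> = ln (9 * C0 * Z) + 2 * ln y"
        using C0 Z y by (simp add: ln_mult ln_realpow)
      finally show ?thesis by (simp add: A1_def)
    qed
    have inner: "Re (f w) < A2" if w: "norm w < 3/4" for w
    proof -
      have Re: "Re (s0 + w) \<ge> 5/4" using w abs_Re_le_cmod[of w] by (auto simp: s0_def)
      have "norm (zeta_reg (s0 + w)) = norm (s0 - 1 + w) * norm (zD (s0 + w))"
      proof -
        have "zeta_reg (s0 + w) = (s0 - 1 + w) * zD (s0 + w)"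
          using Re zeta_reg_eq_zD[of "s0 + w"] by (simp add: add.commute add_diff_eq)
        then show ?thesis by (simp only: norm_mult)
      qed
      also have "\<dots> \<le> (norm (s0 - 1) + norm w) * Z"
        using Re Z by (intro mult_mono norm_triangle_ineq zD_le) auto
      also have "\<dots> \<le> (2 * norm (s0 - 1)) * Z"
        using w s0_1 Z by (intro mult_right_mono) auto
      finally have "norm (zeta_reg (s0 + w)) * (1 / norm (zeta_reg s0)) \<le> (2 * norm (s0 - 1)) * Z * (Z / norm (s0 - 1))"
        using Z by (intro mult_mono inv0) auto
      also have "\<dots> = 2 * Z * Z" using s0_1 by auto
      finally have "Re (f w) \<le> ln (2 * Z * Z)"
        using zeta_reg_nz[of w] nz0 w Re_f[of w] by (auto intro!: ln_mono)
      then show ?thesis by (simp add: A2_def)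
    qed
    have A1: "A1 + 2 * ln y > 0" using y by (simp add: A1_def add_pos_nonneg)
    have A2: "A2 > 0" by (simp add: A2_def)
    have "norm (f (s - s0)) \<le> K * (4 * A2) + \<epsilon>' * (2 * (A1 + 2 * ln y) * M)"
    proof (rule K(2)[OF f(1) \<rho>(3)])
      show "norm (f z) \<le> 2 * (A1 + 2 * ln y) * M" if "norm z \<le> R" for z
        using borel_caratheodory[OF f A1 outer that \<rho>(3)] by (simp add: M_def)
      have "f holomorphic_on ball 0 (3/4)" by (rule holomorphic_on_subset[OF f(1)]) auto
      then show "norm (f z) \<le> 4 * A2" if "norm z \<le> 1/2" for z
        using borel_caratheodory[of f "3/4" A2 z "1/2"] f(2) A2 inner that by simp
      have "s - s0 = of_real (Re s - 2)" by (simp add: s0_def t_def complex_eq_iff)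
      then show "norm (s - s0) \<le> \<rho>" using s by (simp add: \<rho>_def del: of_real_diff)
    qed
    also have "\<dots> = K2 + \<epsilon> * ln y" using M by (simp add: K2_def \<epsilon>'_def field_simps)
    finally have fs: "norm (f (s - s0)) \<le> K2 + \<epsilon> * ln y" .
    have "s - s0 = of_real (Re s - 2)" by (simp add: s0_def t_def complex_eq_iff)
    then have ss0: "norm (s - s0) < 3/2" using s b by (simp del: of_real_diff)
    have "norm (1 / zeta_reg s) = norm (exp (- f (s - s0))) * (1 / norm (zeta_reg s0))"
    proof -
      have e: "exp (f (s - s0)) = zeta_reg s / zeta_reg s0" using exp_f[OF ss0] by simp
      have "1 / zeta_reg s = exp (- f (s - s0)) * (1 / zeta_reg s0)" unfolding exp_minus e using nz0 by simp
      then show ?thesis by (simp only: norm_mult norm_divide norm_one)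
    qed
    also have "\<dots> \<le> exp (K2 + \<epsilon> * ln y) * (Z / norm (s0 - 1))"
      using fs inv0 abs_Re_le_cmod[of "f (s - s0)"] by (intro mult_mono) auto
    \<comment> \<open>The saving y^(-1) comes from the factor s0 - 1 contained in
      \<open>zeta_reg s0\<close>.\<close>
    also have "\<dots> \<le> exp (K2 + \<epsilon> * ln y) * (Z / (y / 2))"
      using s0_1 y Z less_le_trans[OF zero_less_one s0_1(1)]
      by (intro mult_left_mono divide_left_mono mult_pos_pos) auto
    also have "\<dots> = 2 * Z * exp K2 * y powr (\<epsilon> - 1)"
      using y by (simp add: exp_add powr_diff powr_def[of _ \<epsilon>])
    finally have inv: "norm (1 / zeta_reg s) \<le> 2 * Z * exp K2 * y powr (\<epsilon> - 1)" .
    have "norm ((s - 1) / (s * zeta_reg s)) = norm (s - 1) / norm s * norm (1 / zeta_reg s)"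
      by (simp add: norm_mult norm_divide)
    also have "\<dots> \<le> 1 * norm (1 / zeta_reg s)"
    proof (intro mult_right_mono)
      have "(norm (s - 1))\<^sup>2 \<le> (norm s)\<^sup>2"
        using s b unfolding cmod_power2 by (simp add: power2_eq_square algebra_simps)
      then have "norm (s - 1) \<le> norm s" by (rule power2_le_imp_le) simp
      then show "norm (s - 1) / norm s \<le> 1" by (simp add: divide_le_eq_1)
    qed simp
    finally show ?thesis using inv by (simp add: y_def t_def)
  qed
  show ?thesis using main Z by (intro that[of "2 * Z * exp K2"]) auto
qed

section \<open>Gaussian smoothing of the Mertens function\<close>

lemma mertens_measurable [measurable]: "mertens \<in> borel_measurable borel"
proof -
  have "(\<lambda>x::real. \<Sum>n\<in>{1..nat \<lfloor>x\<rfloor>}. real_of_int (moebius_mu n)) \<in> borel_measurable borel"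
    by (rule measurable_compose[OF measurable_real_floor, where g = "\<lambda>k. \<Sum>n\<in>{1..nat k}. real_of_int (moebius_mu n)"]) simp
  then show ?thesis by (simp add: mertens_def[abs_def] nats_upto_eq)
qed

lemma exp_tail_real:
  fixes \<sigma> a :: real
  assumes "\<sigma> > 0"
  shows "integrable lborel (\<lambda>v. indicator {a..} v * exp (- \<sigma> * v))"
    and "(\<integral>v. indicator {a..} v * exp (- \<sigma> * v) \<partial>lborel) = exp (- \<sigma> * a) / \<sigma>"
proof -
  have lim: "((\<lambda>v. - exp (- \<sigma> * v) / \<sigma>) \<longlongrightarrow> 0) at_top"
    using assms by real_asymp
  have "(\<integral>\<^sup>+v. ennreal (exp (- \<sigma> * v)) * indicator {a..} v \<partial>lborel) = 0 - (- exp (- \<sigma> * a) / \<sigma>)"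
  proof (rule nn_integral_FTC_atLeast[OF _ _ _ lim])
    show "((\<lambda>v. - exp (- \<sigma> * v) / \<sigma>) has_real_derivative exp (- \<sigma> * x)) (at x)" for x
      using assms by (auto intro!: derivative_eq_intros)
  qed auto
  then have *: "(\<integral>\<^sup>+v. ennreal (indicator {a..} v * exp (- \<sigma> * v)) \<partial>lborel) = ennreal (exp (- \<sigma> * a) / \<sigma>)"
    by (simp add: ennreal_mult' mult.commute ennreal_indicator)
  show "integrable lborel (\<lambda>v. indicator {a..} v * exp (- \<sigma> * v))"
    by (rule integrableI_nn_integral_finite[OF _ _ *]) (use assms in auto)
  show "(\<integral>v. indicator {a..} v * exp (- \<sigma> * v) \<partial>lborel) = exp (- \<sigma> * a) / \<sigma>"
    by (rule integral_eq_nn_integral[THEN trans]) (use * assms in auto)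
qed

lemma exp_tail_complex:
  fixes s :: complex and a :: real
  assumes "Re s > 0"
  shows "integrable lborel (\<lambda>v. indicator {a..} v *\<^sub>R exp (- s * of_real v))"
    and "(\<integral>v. indicator {a..} v *\<^sub>R exp (- s * of_real v) \<partial>lborel) = exp (- s * of_real a) / s"
proof -
  have s: "s \<noteq> 0" using assms by auto
  show int: "integrable lborel (\<lambda>v. indicator {a..} v *\<^sub>R exp (- s * of_real v))"
    by (rule Bochner_Integration.integrable_bound[OF exp_tail_real(1)[OF assms, of a]])
       (auto simp: indicator_def)
  define F where "F = (\<lambda>v::real. - exp (- s * of_real v) / s)"
  have "(LBINT v=ereal a..\<infinity>. exp (- s * of_real v)) = 0 - F a"
  proof (rule interval_integral_FTC_integrable)
    show "(F has_vector_derivative exp (- s * of_real x)) (at x)" for x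
      unfolding F_def using s
      by (auto intro!: derivative_eq_intros has_vector_derivative_real_field simp: field_simps)
    show "set_integrable lborel (einterval (ereal a) \<infinity>) (\<lambda>v. exp (- s * of_real v))"
    proof (rule set_integrable_subset[of _ "{a..}"])
      show "set_integrable lborel {a..} (\<lambda>v. exp (- s * of_real v))"
        using int by (simp add: set_integrable_def)
    qed (auto simp: einterval_def)
    have "continuous (at a) F" unfolding F_def using s by (intro continuous_intros) auto
    then have "(F \<longlongrightarrow> F a) (at_right a)"
      by (auto simp: continuous_at_imp_continuous_at_within continuous_within[symmetric] intro: continuous_within_subset)
    then show "((F \<circ> real_of_ereal) \<longlongrightarrow> F a) (at_right (ereal a))"
      by (simp add: ereal_tendsto_simps)
    have "((\<lambda>v. exp (- \<sigma> * v)) \<longlongrightarrow> 0) at_top" if "\<sigma> > 0" for \<sigma> :: real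
      using that by real_asymp
    from this[OF assms] have "((\<lambda>v. exp (- Re s * v) / norm s) \<longlongrightarrow> 0) at_top"
      by (rule tendsto_divide_zero)
    then have "(F \<longlongrightarrow> 0) at_top"
      by (intro tendsto_norm_zero_cancel[of F]) (simp add: F_def norm_divide)
    then show "((F \<circ> real_of_ereal) \<longlongrightarrow> 0) (at_left \<infinity>)"
      by (simp add: ereal_tendsto_simps)
  qed (auto intro!: continuous_intros)
  moreover have "(LBINT v=ereal a..\<infinity>. exp (- s * of_real v)) = (LBINT v:{a<..}. exp (- s * of_real v))"
    by (simp add: interval_lebesgue_integral_def einterval_def greaterThan_def)
  moreover have "(LBINT v:{a<..}. exp (- s * of_real v)) = (LBINT v:{a..}. exp (- s * of_real v))"
    unfolding set_lebesgue_integral_def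
    by (rule integral_cong_AE) (auto intro!: AE_I[where N = "{a}"] simp: indicator_def)
  ultimately show "(\<integral>v. indicator {a..} v *\<^sub>R exp (- s * of_real v) \<partial>lborel) = exp (- s * of_real a) / s"
    by (simp add: set_lebesgue_integral_def F_def)
qed

text \<open>Written as a superposition of steps mu(n) starting at v = ln n,
  \<open>mertens (exp v)\<close> can be transformed termwise: a step yields mu(n) n^(-s) / s, and
  the L1 norms are at most n^(- Re s) / Re s, which is summable for Re s > 1.\<close>

lemma mertens_laplace:
  assumes s: "Re s > 1"
  shows "integrable lborel (\<lambda>v. of_real (mertens (exp v)) * exp (- s * of_real v))"
    and "(\<integral>v. of_real (mertens (exp v)) * exp (- s * of_real v) \<partial>lborel) = moebius_series s / s"
proof -
  define h :: "nat \<Rightarrow> real \<Rightarrow> complex" where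
    "h = (\<lambda>n v. of_int (moebius_mu n) * (if n = 0 then 0 else indicator {ln n..} v *\<^sub>R exp (- s * of_real v)))"
  have s0: "Re s > 0" using s by simp
  have ex: "exp (- s * of_real (ln (real n))) = of_nat n powr (- s)" if "n > 0" for n
  proof -
    have "ln (of_nat n :: complex) = of_real (ln (real n))"
      using Ln_of_real[of "real n"] that by simp
    then show ?thesis using that by (simp add: powr_def)
  qed
  have h_pos: "h n = (\<lambda>v. of_int (moebius_mu n) * (indicator {ln n..} v *\<^sub>R exp (- s * of_real v)))" if "n > 0" for n
    using that by (simp add: h_def)
  have h_0: "h 0 = (\<lambda>v. 0)" by (simp add: h_def)
  have h_int: "integrable lborel (h n)" for n
    by (cases "n = 0") (simp_all only: h_0 h_pos neq0_conv integrable_mult_right exp_tail_complex(1)[OF s0] integrable_zero)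
  have h_eq: "(\<integral>v. h n v \<partial>lborel) = of_int (moebius_mu n) * of_nat n powr (- s) / s" for n
  proof (cases "n = 0")
    case False
    then have "n > 0" by simp
    show ?thesis unfolding h_pos[OF \<open>n > 0\<close>] integral_mult_right_zero exp_tail_complex(2)[OF s0] ex[OF \<open>n > 0\<close>]
      by simp
  qed (simp add: h_0)
  have h_norm: "(\<integral>v. norm (h n v) \<partial>lborel) = norm (of_int (moebius_mu n) :: complex) * (real n powr (- Re s) / Re s)" for n
  proof (cases "n = 0")
    case False
    then have "(\<lambda>v. norm (h n v)) = (\<lambda>v. norm (of_int (moebius_mu n) :: complex) * (indicator {ln n..} v * exp (- Re s * v)))"
      by (auto simp: h_def norm_mult fun_eq_iff)
    moreover have "exp (- Re s * ln n) = real n powr (- Re s)" using False by (simp add: powr_def)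
    ultimately show ?thesis using exp_tail_real(2)[OF s0, of "ln n"] by simp
  qed (simp add: h_def)
  have sums: "(\<lambda>n. h n v) sums (of_real (mertens (exp v)) * exp (- s * of_real v))" for v
  proof -
    have "(\<lambda>n. h n v) sums (\<Sum>n\<in>nats_upto (exp v). h n v)"
    proof (rule sums_finite)
      fix n assume "n \<notin> nats_upto (exp v)"
      then have "n = 0 \<or> exp v < real n" by (auto simp: nats_upto_def)
      then have "n = 0 \<or> v < ln (real n)" by (metis exp_gt_zero ln_exp ln_less_cancel_iff of_nat_0_less_iff gr0I)
      then show "h n v = 0" by (auto simp: h_def)
    qed simp
    also have "(\<Sum>n\<in>nats_upto (exp v). h n v) = (\<Sum>n\<in>nats_upto (exp v). of_int (moebius_mu n) * exp (- s * of_real v))"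
    proof (rule sum.cong)
      fix n assume "n \<in> nats_upto (exp v)"
      then have "n > 0" "real n \<le> exp v" by (auto simp: nats_upto_def)
      then have "ln (real n) \<le> v" by (metis ln_exp ln_le_cancel_iff of_nat_0_less_iff exp_gt_zero)
      then show "h n v = of_int (moebius_mu n) * exp (- s * of_real v)" using \<open>n > 0\<close> by (simp add: h_def)
    qed simp
    finally show ?thesis by (simp add: mertens_def sum_distrib_right)
  qed
  have sm: "AE v in lborel. summable (\<lambda>n. norm (h n v))"
  proof (intro AE_I2)
    fix v
    show "summable (\<lambda>n. norm (h n v))"
    proof (rule summable_finite[of "nats_upto (exp v)"])
      fix n assume "n \<notin> nats_upto (exp v)"
      then have "n = 0 \<or> exp v < real n" by (auto simp: nats_upto_def)
      then have "n = 0 \<or> v < ln (real n)" by (metis exp_gt_zero ln_exp ln_less_cancel_iff of_nat_0_less_iff gr0I)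
      then show "norm (h n v) = 0" by (auto simp: h_def)
    qed simp
  qed
  have sn: "summable (\<lambda>n. \<integral>v. norm (h n v) \<partial>lborel)"
    unfolding h_norm
  proof (rule summable_comparison_test')
    show "summable (\<lambda>n. real n powr (- Re s) / Re s)"
      using s by (intro summable_divide) (simp add: summable_real_powr_iff)
    show "norm (norm (of_int (moebius_mu n) :: complex) * (real n powr (- Re s) / Re s)) \<le> real n powr (- Re s) / Re s" for n
    proof -
      have "\<bar>real_of_int (moebius_mu n)\<bar> \<le> 1" using abs_moebius_mu_le_1[of n] by linarith
      from mult_right_mono[OF this, of "real n powr (- Re s) / Re s"] show ?thesis
        using s by (simp add: abs_mult)
    qed
  qed
  have eq: "(\<Sum>n. h n v) = of_real (mertens (exp v)) * exp (- s * of_real v)" for v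
    using sums[of v] by (simp add: sums_iff)
  show "integrable lborel (\<lambda>v. of_real (mertens (exp v)) * exp (- s * of_real v))"
    using integrable_suminf[OF h_int sm sn] by (simp only: eq)
  have "(\<lambda>n. \<integral>v. h n v \<partial>lborel) sums (\<integral>v. (\<Sum>n. h n v) \<partial>lborel)"
    by (rule sums_integral[OF h_int sm sn])
  moreover have "(\<lambda>n. \<integral>v. h n v \<partial>lborel) sums (moebius_series s / s)"
    unfolding h_eq using has_sum_imp_sums[OF moebius_series_has_sum[OF s]] by (rule sums_divide)
  ultimately show "(\<integral>v. of_real (mertens (exp v)) * exp (- s * of_real v) \<partial>lborel) = moebius_series s / s"
    unfolding eq by (rule sums_unique2)
qed

section \<open>The Gaussian kernel and its inversion formula\<close>

lemma gaussian_fourier: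
  fixes a \<kappa> :: real
  assumes "\<kappa> > 0"
  shows "integrable lborel (\<lambda>t. exp (- (\<kappa>\<^sup>2 * t\<^sup>2) / 2))"
    and "(\<integral>t. of_real (exp (- (\<kappa>\<^sup>2 * t\<^sup>2) / 2)) * exp (\<i> * of_real (a * t)) \<partial>lborel) =
          complex_of_real (sqrt (2 * pi) / \<kappa> * exp (- a\<^sup>2 / (2 * \<kappa>\<^sup>2)))"
proof -
  have d: "std_normal_density (\<kappa> * t) * sqrt (2 * pi) = exp (- (\<kappa>\<^sup>2 * t\<^sup>2) / 2)" for t
    by (simp add: std_normal_density_def power_mult_distrib)
  have "integrable lborel (\<lambda>t. std_normal_density (0 + \<kappa> * t))"
    using assms by (intro lborel_integrable_real_affine integrable_normal_density) auto
  then have "integrable lborel (\<lambda>t. std_normal_density (\<kappa> * t) * sqrt (2 * pi))"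
    by (intro integrable_mult_left) simp
  then show "integrable lborel (\<lambda>t. exp (- (\<kappa>\<^sup>2 * t\<^sup>2) / 2))" unfolding d .
  \<comment> \<open>The characteristic function of the standard normal law at a / \<kappa>, rescaled
    by x = \<kappa> t.\<close>
  have "complex_of_real (exp (- ((a / \<kappa>)\<^sup>2) / 2)) = char std_normal_distribution (a / \<kappa>)"
    by (simp add: char_std_normal_distribution)
  also have "\<dots> = (\<integral>x. std_normal_density x *\<^sub>R iexp ((a / \<kappa>) * x) \<partial>lborel)"
    unfolding char_def by (subst integral_density) auto
  also have "\<dots> = \<bar>\<kappa>\<bar> *\<^sub>R (\<integral>t. std_normal_density (0 + \<kappa> * t) *\<^sub>R iexp ((a / \<kappa>) * (0 + \<kappa> * t)) \<partial>lborel)"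
    using assms by (intro lborel_integral_real_affine) auto
  also have "(\<lambda>t. std_normal_density (0 + \<kappa> * t) *\<^sub>R iexp ((a / \<kappa>) * (0 + \<kappa> * t))) =
      (\<lambda>t. (1 / sqrt (2 * pi)) *\<^sub>R (of_real (exp (- (\<kappa>\<^sup>2 * t\<^sup>2) / 2)) * exp (\<i> * of_real (a * t))))"
    using assms by (simp add: fun_eq_iff scaleR_conv_of_real std_normal_density_def power_mult_distrib)
  finally have "complex_of_real (exp (- ((a / \<kappa>)\<^sup>2) / 2)) =
     (\<kappa> / sqrt (2 * pi)) *\<^sub>R (\<integral>t. of_real (exp (- (\<kappa>\<^sup>2 * t\<^sup>2) / 2)) * exp (\<i> * of_real (a * t)) \<partial>lborel)"
    using assms by simp
  then have "(sqrt (2 * pi) / \<kappa>) *\<^sub>R complex_of_real (exp (- ((a / \<kappa>)\<^sup>2) / 2)) =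
     (\<integral>t. of_real (exp (- (\<kappa>\<^sup>2 * t\<^sup>2) / 2)) * exp (\<i> * of_real (a * t)) \<partial>lborel)"
    using assms by simp
  then show "(\<integral>t. of_real (exp (- (\<kappa>\<^sup>2 * t\<^sup>2) / 2)) * exp (\<i> * of_real (a * t)) \<partial>lborel) =
          complex_of_real (sqrt (2 * pi) / \<kappa> * exp (- a\<^sup>2 / (2 * \<kappa>\<^sup>2)))"
    by (simp add: scaleR_conv_of_real power_divide mult.commute[of "\<kappa>\<^sup>2" 2])
qed

text \<open>The moment generating function, at the complex argument s, of the normal law with mean u
  and standard deviation \<kappa>. It is entire and decays like a Gaussian along vertical
  lines.\<close>

definition gauss_kernel :: "real \<Rightarrow> real \<Rightarrow> complex \<Rightarrow> complex" where
  "gauss_kernel \<kappa> u s = exp (s * of_real u + of_real (\<kappa>\<^sup>2) * s\<^sup>2 / 2)"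

lemma norm_gauss_kernel: "norm (gauss_kernel \<kappa> u (Complex c t)) = exp (c * u + \<kappa>\<^sup>2 * c\<^sup>2 / 2) * exp (- (\<kappa>\<^sup>2 * t\<^sup>2) / 2)"
proof -
  have "Re (Complex c t * of_real u + of_real (\<kappa>\<^sup>2) * (Complex c t)\<^sup>2 / 2) =
      c * u + \<kappa>\<^sup>2 * c\<^sup>2 / 2 + - (\<kappa>\<^sup>2 * t\<^sup>2) / 2"
    by (simp add: Re_power2 right_diff_distrib diff_divide_distrib del: of_real_power)
  then show ?thesis unfolding gauss_kernel_def norm_exp_eq_Re mult_exp_exp by (rule arg_cong)
qed

text \<open>Laplace inversion for the normal density; completing the square removes the dependence
  on the abscissa c.\<close>

lemma gauss_kernel_integral:
  assumes "\<kappa> > 0"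
  shows "(\<integral>t. gauss_kernel \<kappa> w (Complex c t) \<partial>lborel) = of_real (2 * pi * normal_density 0 \<kappa> w)"
proof -
  \<comment> \<open>The imaginary part of the exponent is t times this a.\<close>
  define a where "a = w + \<kappa>\<^sup>2 * c"
  have "gauss_kernel \<kappa> w (Complex c t) = of_real (exp (c * w + \<kappa>\<^sup>2 * c\<^sup>2 / 2)) *
      (of_real (exp (- (\<kappa>\<^sup>2 * t\<^sup>2) / 2)) * exp (\<i> * of_real (a * t)))" for t
    unfolding gauss_kernel_def exp_of_real [symmetric] exp_add [symmetric]
    by (rule arg_cong[of _ _ exp]) (simp add: complex_eq_iff a_def Re_power2 Im_power2 power2_eq_square field_simps)
  then have "(\<integral>t. gauss_kernel \<kappa> w (Complex c t) \<partial>lborel) =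
     of_real (exp (c * w + \<kappa>\<^sup>2 * c\<^sup>2 / 2)) * complex_of_real (sqrt (2 * pi) / \<kappa> * exp (- a\<^sup>2 / (2 * \<kappa>\<^sup>2)))"
    using gaussian_fourier(2)[OF assms, of a] by simp
  also have "\<dots> = of_real (sqrt (2 * pi) / \<kappa> * exp (c * w + \<kappa>\<^sup>2 * c\<^sup>2 / 2 + - a\<^sup>2 / (2 * \<kappa>\<^sup>2)))"
    by (simp only: exp_add of_real_mult mult_ac)
  also have "c * w + \<kappa>\<^sup>2 * c\<^sup>2 / 2 + - a\<^sup>2 / (2 * \<kappa>\<^sup>2) = - w\<^sup>2 / (2 * \<kappa>\<^sup>2)"
    using assms by (simp add: a_def field_simps power2_eq_square)
  also have "sqrt (2 * pi) / \<kappa> * exp (- w\<^sup>2 / (2 * \<kappa>\<^sup>2)) = 2 * pi * normal_density 0 \<kappa> w"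
    using assms by (simp add: normal_density_def real_sqrt_mult field_simps)
  finally show ?thesis .
qed

lemma gauss_kernel_measurable [measurable]: "(\<lambda>t. gauss_kernel \<kappa> u (Complex c t)) \<in> borel_measurable borel"
  unfolding gauss_kernel_def Complex_eq by measurable

lemma gauss_kernel_integrable:
  assumes "\<kappa> > 0"
  shows "integrable lborel (\<lambda>t. gauss_kernel \<kappa> u (Complex c t))"
  by (rule Bochner_Integration.integrable_bound[OF integrable_mult_right[OF gaussian_fourier(1)[OF assms], of "exp (c * u + \<kappa>\<^sup>2 * c\<^sup>2 / 2)"]])
     (auto simp: norm_gauss_kernel)

text \<open>Insert the Laplace transform of \<open>mertens (exp v)\<close> for the first factor,
  exchange the integrals and evaluate the inner one by the inversion formula at u - v. The exchange
  is legitimate because the modulus of the integrand is an integrable function of t times an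
  integrable function of v.\<close>

lemma mertens_smoothed:
  assumes c: "c > 1" and \<kappa>: "\<kappa> > 0"
  shows "(\<integral>v. of_real (mertens (exp v) * normal_density u \<kappa> v) \<partial>lborel) =
     (\<integral>t. moebius_series (Complex c t) / Complex c t * gauss_kernel \<kappa> u (Complex c t) \<partial>lborel) / (2 * of_real pi)"
proof -
  define f :: "real \<Rightarrow> real \<Rightarrow> complex" where
    "f = (\<lambda>t v. of_real (mertens (exp v)) * exp (- Complex c t * of_real v) * gauss_kernel \<kappa> u (Complex c t))"
  have fm: "(\<lambda>(t, v). f t v) \<in> borel_measurable (lborel \<Otimes>\<^sub>M lborel)"
    unfolding f_def gauss_kernel_def Complex_eq by measurable
  have i1: "integrable lborel (\<lambda>v. mertens (exp v) * exp (- c * v))"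
  proof -
    have "integrable lborel (\<lambda>v. of_real (mertens (exp v)) * exp (- complex_of_real c * of_real v))"
      using c by (intro mertens_laplace) auto
    then have "integrable lborel (\<lambda>v. complex_of_real (mertens (exp v) * exp (- c * v)))"
      by (simp add: exp_of_real [symmetric])
    then show ?thesis by (simp only: complex_of_real_integrable_eq)
  qed
  have nf: "norm (f t v) = norm (gauss_kernel \<kappa> u (Complex c t)) * \<bar>mertens (exp v) * exp (- c * v)\<bar>" for t v
    by (simp add: f_def norm_mult abs_mult)
  have int: "integrable (lborel \<Otimes>\<^sub>M lborel) (\<lambda>(t, v). f t v)"
  proof (rule lborel_pair.Fubini_integrable[OF fm])
    show "integrable lborel (\<lambda>t. \<integral>v. norm (case (t, v) of (t, v) \<Rightarrow> f t v) \<partial>lborel)"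
      unfolding prod.case nf using gauss_kernel_integrable[OF \<kappa>, of u c] by simp
    have "integrable lborel (\<lambda>v. f t v)" for t
      unfolding f_def using mertens_laplace(1)[of "Complex c t"] c by simp
    then show "AE t in lborel. integrable lborel (\<lambda>v. case (t, v) of (t, v) \<Rightarrow> f t v)" by simp
  qed
  have "(\<integral>t. moebius_series (Complex c t) / Complex c t * gauss_kernel \<kappa> u (Complex c t) \<partial>lborel) = (\<integral>t. (\<integral>v. f t v \<partial>lborel) \<partial>lborel)"
    unfolding f_def using mertens_laplace(2) c by simp
  also have "\<dots> = (\<integral>v. (\<integral>t. f t v \<partial>lborel) \<partial>lborel)"
    by (rule lborel_pair.Fubini_integral[OF int, symmetric])
  also have "(\<lambda>v. \<integral>t. f t v \<partial>lborel) = (\<lambda>v. of_real (mertens (exp v) * normal_density u \<kappa> v) * (2 * of_real pi))"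
  proof
    fix v
    have "f t v = of_real (mertens (exp v)) * gauss_kernel \<kappa> (u - v) (Complex c t)" for t
      unfolding f_def gauss_kernel_def mult.assoc exp_add [symmetric] by (simp add: algebra_simps)
    then have "(\<integral>t. f t v \<partial>lborel) = of_real (mertens (exp v)) * (\<integral>t. gauss_kernel \<kappa> (u - v) (Complex c t) \<partial>lborel)"
      by simp
    also have "\<dots> = of_real (mertens (exp v)) * of_real (2 * pi * normal_density 0 \<kappa> (u - v))"
      using \<kappa> by (simp add: gauss_kernel_integral)
    also have "normal_density 0 \<kappa> (u - v) = normal_density u \<kappa> v"
      by (simp add: normal_density_def power2_commute)
    finally show "(\<integral>t. f t v \<partial>lborel) = of_real (mertens (exp v) * normal_density u \<kappa> v) * (2 * of_real pi)"
      by simp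
  qed
  finally show ?thesis by simp
qed

section \<open>Comparison of the Mertens function with its Gaussian mean\<close>

lemma mertens_lipschitz:
  assumes "x \<ge> 0" "y \<ge> 0"
  shows "\<bar>mertens x - mertens y\<bar> \<le> 1 + \<bar>x - y\<bar>"
proof -
  have main: "\<bar>mertens y - mertens x\<bar> \<le> 1 + (y - x)" if "0 \<le> x" "x \<le> y" for x y
  proof -
    have "nats_upto x \<subseteq> nats_upto y" using that by (auto simp: nats_upto_def)
    then have "mertens y - mertens x = (\<Sum>n\<in>nats_upto y - nats_upto x. real_of_int (moebius_mu n))"
      by (simp add: mertens_def sum_diff)
    also have "\<bar>\<dots>\<bar> \<le> (\<Sum>n\<in>nats_upto y - nats_upto x. 1)"
    proof (intro order_trans[OF sum_abs] sum_mono)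
      show "\<bar>real_of_int (moebius_mu n)\<bar> \<le> 1" for n using abs_moebius_mu_le_1[of n] by linarith
    qed
    also have "\<dots> = real (card (nats_upto y) - card (nats_upto x))"
      using \<open>nats_upto x \<subseteq> nats_upto y\<close> by (simp add: card_Diff_subset)
    also have "\<dots> \<le> 1 + (y - x)"
      using that by (simp add: nats_upto_eq) linarith
    finally show ?thesis .
  qed
  show ?thesis using main[of x y] main[of y x] assms by (cases "x \<le> y") auto
qed

text \<open>Completing the square: the exponential weight only moves the mean to u + a \<kappa>^2
  and pulls out a constant.\<close>

lemma normal_density_exp:
  assumes "\<kappa> > 0"
  shows "integrable lborel (\<lambda>v. exp (a * (v - u)) * normal_density u \<kappa> v)"
    and "(\<integral>v. exp (a * (v - u)) * normal_density u \<kappa> v \<partial>lborel) = exp (a\<^sup>2 * \<kappa>\<^sup>2 / 2)"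
proof -
  have "exp (a * (v - u)) * normal_density u \<kappa> v = exp (a\<^sup>2 * \<kappa>\<^sup>2 / 2) * normal_density (u + a * \<kappa>\<^sup>2) \<kappa> v" for v
  proof -
    have "a * (v - u) + - (v - u)\<^sup>2 / (2 * \<kappa>\<^sup>2) = a\<^sup>2 * \<kappa>\<^sup>2 / 2 + - (v - (u + a * \<kappa>\<^sup>2))\<^sup>2 / (2 * \<kappa>\<^sup>2)"
      using assms by (simp add: field_simps power2_eq_square)
    then have "exp (a * (v - u)) * exp (- (v - u)\<^sup>2 / (2 * \<kappa>\<^sup>2)) =
        exp (a\<^sup>2 * \<kappa>\<^sup>2 / 2) * exp (- (v - (u + a * \<kappa>\<^sup>2))\<^sup>2 / (2 * \<kappa>\<^sup>2))"
      unfolding mult_exp_exp by (rule arg_cong)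
    then show ?thesis
      unfolding normal_density_def mult.left_commute[of "exp (a * (v - u))"]
        mult.left_commute[of "exp (a\<^sup>2 * \<kappa>\<^sup>2 / 2)"] by (rule arg_cong)
  qed
  then show "integrable lborel (\<lambda>v. exp (a * (v - u)) * normal_density u \<kappa> v)"
    and "(\<integral>v. exp (a * (v - u)) * normal_density u \<kappa> v \<partial>lborel) = exp (a\<^sup>2 * \<kappa>\<^sup>2 / 2)"
    using assms by simp_all
qed

text \<open>The Lipschitz bound leaves 1 plus exp u times the mean of |1 - exp (v - u)|. AM-GM with
  weight \<kappa> replaces the absolute value by its square, so that only exponential moments of the
  normal law occur; the mean of that square is O(\<kappa>^2).\<close>

lemma mertens_smoothing_error:
  assumes \<kappa>: "0 < \<kappa>" "\<kappa> \<le> 1"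
  shows "norm (of_real (mertens (exp u)) - (\<integral>v. of_real (mertens (exp v) * normal_density u \<kappa> v) \<partial>lborel) :: complex)
           \<le> 1 + 9 * \<kappa> * exp u"
proof -
  define nd where "nd = normal_density u \<kappa>"
  define D where "D = (\<lambda>v. mertens (exp u) - mertens (exp v))"
  \<comment> \<open>The majorant after AM-GM, already expanded into exponential weights with
    exponents 0, 1 and 2 times v - u.\<close>
  define B where "B = (\<lambda>v. (1 + exp u * \<kappa> / 2 + exp u / (2 * \<kappa>)) * nd v
       - exp u / \<kappa> * (exp (1 * (v - u)) * nd v) + exp u / (2 * \<kappa>) * (exp (2 * (v - u)) * nd v))"
  have nd: "nd v \<ge> 0" for v by (simp add: nd_def)
  have ndi: "integrable lborel nd" "(\<integral>v. nd v \<partial>lborel) = 1"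
    using \<kappa> by (simp_all add: nd_def)
  note ei = normal_density_exp[OF \<kappa>(1), of 1 u, folded nd_def] normal_density_exp[OF \<kappa>(1), of 2 u, folded nd_def]
  have "has_bochner_integral lborel B ((1 + exp u * \<kappa> / 2 + exp u / (2 * \<kappa>)) * 1
       - exp u / \<kappa> * exp (1\<^sup>2 * \<kappa>\<^sup>2 / 2) + exp u / (2 * \<kappa>) * exp (2\<^sup>2 * \<kappa>\<^sup>2 / 2))"
    unfolding B_def
    by (intro has_bochner_integral_add has_bochner_integral_diff has_bochner_integral_mult_right)
       (use ndi ei in \<open>simp_all add: has_bochner_integral_iff\<close>)
  then have Bi: "integrable lborel B" and
    Bv: "(\<integral>v. B v \<partial>lborel) = (1 + exp u * \<kappa> / 2 + exp u / (2 * \<kappa>)) - exp u / \<kappa> * exp (\<kappa>\<^sup>2 / 2) + exp u / (2 * \<kappa>) * exp (2 * \<kappa>\<^sup>2)"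
    by (auto simp: has_bochner_integral_iff)
  have DB: "\<bar>D v * nd v\<bar> \<le> B v" for v
  proof -
    define e where "e = exp (v - u)"
    have "exp v = exp u * e" by (simp add: e_def flip: exp_add)
    have "\<bar>D v\<bar> \<le> 1 + \<bar>exp u - exp v\<bar>" unfolding D_def by (rule mertens_lipschitz) auto
    also have "\<bar>exp u - exp v\<bar> = exp u * \<bar>1 - e\<bar>"
    proof -
      have "exp u - exp v = exp u * (1 - e)" by (simp add: \<open>exp v = exp u * e\<close> algebra_simps)
      then show ?thesis by (simp add: abs_mult)
    qed
    also have "\<bar>1 - e\<bar> \<le> (\<kappa> + (1 - e)\<^sup>2 / \<kappa>) / 2"
    proof -
      have "0 \<le> (\<kappa> - \<bar>1 - e\<bar>)\<^sup>2 / \<kappa>" using \<kappa> by simp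
      also have "\<dots> = \<kappa> - 2 * \<bar>1 - e\<bar> + (1 - e)\<^sup>2 / \<kappa>"
        using \<kappa> by (simp add: power2_diff field_simps) (simp add: power2_eq_square)
      finally show ?thesis by simp
    qed
    finally have "\<bar>D v\<bar> \<le> 1 + exp u * ((\<kappa> + (1 - e)\<^sup>2 / \<kappa>) / 2)" by simp
    then have "\<bar>D v * nd v\<bar> \<le> (1 + exp u * ((\<kappa> + (1 - e)\<^sup>2 / \<kappa>) / 2)) * nd v"
      using nd by (simp add: abs_mult mult_right_mono)
    also have "\<dots> = B v"
    proof -
      have "exp (2 * (v - u)) = e\<^sup>2" unfolding e_def by (rule exp_double)
      then show ?thesis using \<kappa> unfolding B_def by (simp add: e_def[symmetric] power2_eq_square field_simps)
    qed
    finally show ?thesis .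
  qed
  have Di: "integrable lborel (\<lambda>v. D v * nd v)"
    by (rule Bochner_Integration.integrable_bound[OF Bi])
       (use DB order_trans[OF abs_ge_zero DB] in \<open>auto simp: D_def nd_def\<close>)
  have Mi: "integrable lborel (\<lambda>v. mertens (exp v) * nd v)"
  proof -
    have "integrable lborel (\<lambda>v. mertens (exp u) * nd v - D v * nd v)"
      by (intro Bochner_Integration.integrable_diff integrable_mult_right ndi Di)
    then show ?thesis by (simp add: D_def algebra_simps)
  qed
  have "(\<integral>v. D v * nd v \<partial>lborel) = (\<integral>v. mertens (exp u) * nd v - mertens (exp v) * nd v \<partial>lborel)"
    by (simp add: D_def algebra_simps)
  also have "\<dots> = mertens (exp u) - (\<integral>v. mertens (exp v) * nd v \<partial>lborel)"
    using ndi Mi by (subst Bochner_Integration.integral_diff) auto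
  finally have eq: "(\<integral>v. D v * nd v \<partial>lborel) = mertens (exp u) - (\<integral>v. mertens (exp v) * nd v \<partial>lborel)" .
  have "\<bar>\<integral>v. D v * nd v \<partial>lborel\<bar> \<le> (\<integral>v. B v \<partial>lborel)"
    using Bochner_Integration.integral_norm_bound_integral[OF Di Bi] DB by simp
  also have "\<dots> \<le> 1 + 9 * \<kappa> * exp u"
  proof -
    define x where "x = \<kappa>\<^sup>2"
    have x: "0 \<le> x" "x \<le> 1" using \<kappa> by (auto simp: x_def power_le_one)
    have "exp (2 * x) = (exp x)\<^sup>2" by (simp add: exp_double)
    also have "\<dots> \<le> (1 + x + x\<^sup>2)\<^sup>2" using exp_bound[OF x] by (intro power_mono) auto
    also have "\<dots> \<le> 1 + 10 * x"
    proof -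
      have "x\<^sup>2 \<le> x" using x by (simp add: power2_eq_square mult_left_le_one_le)
      then have "(1 + x + x\<^sup>2)\<^sup>2 \<le> (1 + 2 * x)\<^sup>2" using x by (intro power_mono) auto
      also have "\<dots> = 1 + 4 * x + 4 * x\<^sup>2" by (simp add: power2_eq_square algebra_simps)
      finally show ?thesis using \<open>x\<^sup>2 \<le> x\<close> x by linarith
    qed
    finally have e2: "exp (2 * x) \<le> 1 + 10 * x" .
    have e1: "1 + x / 2 \<le> exp (x / 2)" by (rule exp_ge_add_one_self)
    \<comment> \<open>The bracket is the mean of (1 - exp (v - u))^2; its constant terms cancel,
      leaving O(x) with x = \<kappa>^2.\<close>
    have "(\<integral>v. B v \<partial>lborel) = 1 + exp u * \<kappa> / 2 + exp u / (2 * \<kappa>) * (1 - 2 * exp (x / 2) + exp (2 * x))"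
      unfolding Bv x_def using \<kappa> by (simp add: field_simps)
    also have "\<dots> \<le> 1 + exp u * \<kappa> / 2 + exp u / (2 * \<kappa>) * (9 * x)"
    proof -
      have "1 - 2 * exp (x / 2) + exp (2 * x) \<le> 9 * x" using e1 e2 by linarith
      then show ?thesis using \<kappa> by (intro add_left_mono mult_left_mono) auto
    qed
    also have "\<dots> = 1 + 5 * \<kappa> * exp u"
      using \<kappa> by (simp add: x_def power2_eq_square field_simps)
    also have "\<dots> \<le> 1 + 9 * \<kappa> * exp u" using \<kappa> by simp
    finally show ?thesis .
  qed
  finally show ?thesis
    unfolding eq nd_def [symmetric] integral_complex_of_real
    by (simp only: norm_of_real flip: of_real_diff)
qed

section \<open>The unconditional bound\<close>

lemma integrable_inverse_one_plus_square: "integrable lborel (\<lambda>x::real. 1 / (1 + x\<^sup>2))"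
  using integrable_inverse_1_plus_square by (simp add: set_integrable_def inverse_eq_divide)

text \<open>Shifting t by the half-period pi / u changes the sign of the oscillating factor. So
  twice the integral involves only differences of \<phi> at points pi / u apart, which vanish in the
  limit by continuity and dominated convergence.\<close>

lemma riemann_lebesgue:
  fixes \<phi> :: "real \<Rightarrow> complex"
  assumes cont: "continuous_on UNIV \<phi>" and bound: "\<And>t. norm (\<phi> t) \<le> D / (1 + t\<^sup>2)"
  shows "((\<lambda>u. \<integral>t. \<phi> t * exp (\<i> * of_real (u * t)) \<partial>lborel) \<longlongrightarrow> 0) at_top"
proof -
  have D: "D \<ge> 0" using order_trans[OF norm_ge_zero bound[of 0]] by simp
  have m [measurable]: "\<phi> \<in> borel_measurable borel" using cont by (rule borel_measurable_continuous_onI)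
  have int_w: "integrable lborel (\<lambda>t. D / (1 + t\<^sup>2))"
    using integrable_mult_right[OF integrable_inverse_one_plus_square, of D] by simp
  define f where "f = (\<lambda>u t. \<phi> t * exp (\<i> * of_real (u * t)))"
  have fm [measurable]: "f u \<in> borel_measurable borel" for u
    unfolding f_def by measurable
  have nf: "norm (f u t) = norm (\<phi> t)" for u t by (simp add: f_def norm_mult)
  have fi: "integrable lborel (f u)" for u
    by (rule Bochner_Integration.integrable_bound[OF int_w])
       (use D bound in \<open>auto simp: nf\<close>)
  have \<phi>i: "integrable lborel \<phi>" using fi[of 0] by (simp add: f_def)
  have shift_i: "integrable lborel (\<lambda>t. \<phi> (h + t))" for h
    using lborel_integrable_real_affine[OF \<phi>i, of 1 h] by simp
  define E where "E = (\<lambda>u. \<integral>t. norm (\<phi> t - \<phi> (pi / u + t)) \<partial>lborel)"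
  have le: "norm (\<integral>t. f u t \<partial>lborel) \<le> E u" if u: "u > 0" for u
  proof -
    have sh: "f u (pi / u + 1 * t) = - (\<phi> (pi / u + t) * exp (\<i> * of_real (u * t)))" for t
    proof -
      have "\<i> * of_real (u * (pi / u + t)) = \<i> * of_real (u * t) + \<i> * of_real pi"
        using u by (simp add: field_simps)
      then have "exp (\<i> * of_real (u * (pi / u + t))) = - exp (\<i> * of_real (u * t))"
        by (simp only: exp_add) (simp add: mult.commute[of \<i> "of_real pi"])
      then show ?thesis by (simp add: f_def)
    qed
    have "(\<integral>t. f u t \<partial>lborel) = \<bar>1\<bar> *\<^sub>R (\<integral>t. f u (pi / u + 1 * t) \<partial>lborel)"
      by (rule lborel_integral_real_affine) simp
    also have "\<dots> = - (\<integral>t. \<phi> (pi / u + t) * exp (\<i> * of_real (u * t)) \<partial>lborel)"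
      unfolding sh by simp
    finally have "2 * (\<integral>t. f u t \<partial>lborel) =
        (\<integral>t. f u t \<partial>lborel) - (\<integral>t. \<phi> (pi / u + t) * exp (\<i> * of_real (u * t)) \<partial>lborel)" by simp
    also have "\<dots> = (\<integral>t. f u t - \<phi> (pi / u + t) * exp (\<i> * of_real (u * t)) \<partial>lborel)"
    proof (rule Bochner_Integration.integral_diff [symmetric, OF fi])
      show "integrable lborel (\<lambda>t. \<phi> (pi / u + t) * exp (\<i> * of_real (u * t)))"
        by (rule Bochner_Integration.integrable_bound[OF shift_i]) (auto simp: norm_mult)
    qed
    also have "(\<lambda>t. f u t - \<phi> (pi / u + t) * exp (\<i> * of_real (u * t))) =
        (\<lambda>t. (\<phi> t - \<phi> (pi / u + t)) * exp (\<i> * of_real (u * t)))"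
      by (simp add: f_def left_diff_distrib fun_eq_iff)
    finally have "norm (2 * (\<integral>t. f u t \<partial>lborel)) \<le>
       (\<integral>t. norm ((\<phi> t - \<phi> (pi / u + t)) * exp (\<i> * of_real (u * t))) \<partial>lborel)"
      using integral_norm_bound by metis
    also have "\<dots> = E u" by (simp add: norm_mult E_def)
    finally have "2 * norm (\<integral>t. f u t \<partial>lborel) \<le> E u" by (simp add: norm_mult)
    then show ?thesis using norm_ge_zero[of "\<integral>t. f u t \<partial>lborel"] by linarith
  qed
  have "(E \<longlongrightarrow> (\<integral>t. 0 \<partial>(lborel :: real measure))) at_top"
    unfolding E_def
  proof (rule integral_dominated_convergence_at_top)
    show "integrable lborel (\<lambda>t. 4 * (D / (1 + t\<^sup>2)))" by (rule integrable_mult_right[OF int_w])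
    show "\<forall>\<^sub>F u in at_top. AE t in lborel. norm (norm (\<phi> t - \<phi> (pi / u + t))) \<le> 4 * (D / (1 + t\<^sup>2))"
      using eventually_ge_at_top[of pi]
    proof eventually_elim
      case (elim u)
      have u: "u > 0" using elim pi_gt_zero by linarith
      \<comment> \<open>As u \<ge> pi, the shift is at most 1 and changes the majorant by a factor
        of at most 3; with the unshifted term this makes the constant 4.\<close>
      define h where "h = pi / u"
      have h: "0 \<le> h" "h \<le> 1" using u elim by (auto simp: h_def)
      have "norm (\<phi> t - \<phi> (h + t)) \<le> 4 * (D / (1 + t\<^sup>2))" for t
      proof -
        have "3 * (1 + (h + t)\<^sup>2) - (1 + t\<^sup>2) = 2 + 2 * (t + 3/2 * h)\<^sup>2 - 3/2 * h\<^sup>2"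
          by (simp add: power2_eq_square field_simps)
        moreover have "h\<^sup>2 \<le> 1" using h by (simp add: power_le_one)
        ultimately have "1 + t\<^sup>2 \<le> 3 * (1 + (h + t)\<^sup>2)"
          using zero_le_power2[of "t + 3/2 * h"] by linarith
        then have "D / (3 * (1 + (h + t)\<^sup>2)) \<le> D / (1 + t\<^sup>2)"
          using D by (intro divide_left_mono mult_pos_pos add_pos_nonneg) auto
        then have "3 * (D / (3 * (1 + (h + t)\<^sup>2))) \<le> 3 * (D / (1 + t\<^sup>2))"
          by (rule mult_left_mono) simp
        moreover have "3 * (D / (3 * z)) = D / z" for z by simp
        ultimately have "D / (1 + (h + t)\<^sup>2) \<le> 3 * (D / (1 + t\<^sup>2))" by (simp only:)
        then show ?thesis
          using bound[of t] bound[of "h + t"] norm_triangle_ineq4[of "\<phi> t" "\<phi> (h + t)"] by linarith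
      qed
      then show ?case by (simp add: h_def)
    qed
    show "AE t in lborel. ((\<lambda>u. norm (\<phi> t - \<phi> (pi / u + t))) \<longlongrightarrow> 0) at_top"
    proof (intro AE_I2)
      fix t :: real
      have "((\<lambda>u. pi / u + t) \<longlongrightarrow> 0 + t) at_top"
        by (intro tendsto_add tendsto_const tendsto_divide_0[OF tendsto_const] filterlim_at_top_imp_at_infinity filterlim_ident)
      moreover have "isCont \<phi> t" using cont by (simp add: continuous_on_eq_continuous_at)
      ultimately have "((\<lambda>u. \<phi> (pi / u + t)) \<longlongrightarrow> \<phi> t) at_top"
        by (intro isCont_tendsto_compose[of t \<phi>]) auto
      then have "((\<lambda>u. norm (\<phi> t - \<phi> (pi / u + t))) \<longlongrightarrow> norm (\<phi> t - \<phi> t)) at_top"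
        by (intro tendsto_intros)
      then show "((\<lambda>u. norm (\<phi> t - \<phi> (pi / u + t))) \<longlongrightarrow> 0) at_top" by simp
    qed
  qed auto
  then have E0: "(E \<longlongrightarrow> 0) at_top" by simp
  have "((\<lambda>u. \<integral>t. f u t \<partial>lborel) \<longlongrightarrow> 0) at_top"
  proof (rule Lim_null_comparison[OF _ E0])
    show "eventually (\<lambda>u. norm (\<integral>t. f u t \<partial>lborel) \<le> E u) at_top"
      using eventually_gt_at_top[of 0] by eventually_elim (rule le)
  qed
  then show ?thesis by (simp only: f_def)
qed

text \<open>This is \<open>1 / (s * \<zeta>(s))\<close>, with the correct value \<open>0\<close> at \<open>s = 1\<close>.\<close>
definition inv_zeta :: "complex \<Rightarrow> complex" where
  "inv_zeta s = (s - 1) / (s * zeta_reg s)"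

lemma moebius_series_eq_inv_zeta:
  assumes "Re s > 1"
  shows "moebius_series s / s = inv_zeta s"
proof -
  have "s \<noteq> 1" using assms by auto
  then show ?thesis using assms by (simp add: inv_zeta_def moebius_series_eq zeta_reg_eq_zD)
qed

section \<open>The smoothed Mertens function on the line Re s = 1\<close>

lemma norm_minus_1_le: "Re s \<ge> 1/2 \<Longrightarrow> norm (s - 1) \<le> norm s"
  by (rule power2_le_imp_le, unfold cmod_power2) (simp_all add: power2_eq_square algebra_simps)

lemma inv_zeta_bound_ge_1:
  obtains C where "C > 0" "\<And>s. 1 \<le> Re s \<Longrightarrow> Re s \<le> 2 \<Longrightarrow> norm (inv_zeta s) \<le> C * (1 + \<bar>Im s\<bar>) ^ 3"
proof -
  obtain c where c: "c > 0" "\<And>s. 1 \<le> Re s \<Longrightarrow> Re s \<le> 2 \<Longrightarrow> norm (zeta_reg s) * (1 + \<bar>Im s\<bar>) ^ 3 \<ge> c"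
    using zeta_reg_lower_bound by blast
  show ?thesis
  proof (rule that[of "1 / c"])
    fix s assume s: "1 \<le> Re s" "Re s \<le> 2"
    have nz: "norm (zeta_reg s) > 0" "norm s > 0" using zeta_reg_nonzero_ge_1[OF s(1)] s by auto
    have "norm (inv_zeta s) = (norm (s - 1) / norm s) * (1 / norm (zeta_reg s))"
      by (simp add: inv_zeta_def norm_mult norm_divide)
    also have "\<dots> \<le> 1 * (1 / norm (zeta_reg s))"
      using nz s by (intro mult_right_mono) (auto simp: divide_le_eq_1 intro: norm_minus_1_le)
    also have "\<dots> \<le> 1 / c * (1 + \<bar>Im s\<bar>) ^ 3"
      using nz c(1) c(2)[OF s] by (simp add: field_simps)
    finally show "norm (inv_zeta s) \<le> 1 / c * (1 + \<bar>Im s\<bar>) ^ 3" .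
  qed (use c in simp)
qed

lemma inv_zeta_holomorphic:
  assumes "\<And>s. s \<in> A \<Longrightarrow> zeta_reg s \<noteq> 0" "\<And>s. s \<in> A \<Longrightarrow> Re s > 0"
  shows "inv_zeta holomorphic_on A"
proof -
  have "zeta_reg holomorphic_on A" using assms(2) by (intro holomorphic_on_subset[OF holomorphic_zeta_reg]) auto
  moreover have "s \<noteq> 0" if "s \<in> A" for s using assms(2)[OF that] by auto
  ultimately show ?thesis unfolding inv_zeta_def using assms by (intro holomorphic_intros) auto
qed

lemma gauss_kernel_holomorphic [holomorphic_intros]: "gauss_kernel \<kappa> u holomorphic_on A"
  unfolding gauss_kernel_def by (intro holomorphic_intros) auto

text \<open>The cubic weight matches the growth of the reciprocal of zeta for 1 \<le> Re s \<le> 2;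
  the Gaussian pays for it and still leaves the integrable 1 / (1 + t^2).\<close>

lemma cubic_gaussian_bound:
  fixes \<kappa> t :: real
  assumes "\<kappa> > 0"
  shows "(1 + \<bar>t\<bar>) ^ 3 * exp (- (\<kappa>\<^sup>2 * t\<^sup>2) / 2) \<le> 32 * (1 + 216 / \<kappa> ^ 6) / (1 + t\<^sup>2)"
proof -
  define x where "x = \<kappa>\<^sup>2 * t\<^sup>2 / 2"
  have x: "x \<ge> 0" by (simp add: x_def)
  \<comment> \<open>The inequality exp x \<ge> (x / 3)^3 controls t^6; with x = \<kappa>^2 t^2 / 2
    it produces 216 = 27 * 8.\<close>
  have "(x / 3) ^ 3 \<le> (1 + x / real 3) ^ 3" using x by (intro power_mono) auto
  also have "\<dots> \<le> exp x" using x by (intro exp_ge_one_plus_x_over_n_power_n) auto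
  finally have "x ^ 3 / 27 \<le> exp x" by (simp add: power_divide)
  moreover have "x ^ 3 = \<kappa> ^ 6 * t ^ 6 / 8"
    by (simp add: x_def power_mult_distrib power_divide flip: power_mult)
  ultimately have "t ^ 6 \<le> 216 / \<kappa> ^ 6 * exp x" using assms by (simp add: field_simps)
  then have t6: "t ^ 6 * exp (- x) \<le> 216 / \<kappa> ^ 6" by (simp add: exp_minus field_simps)
  have "(1 + \<bar>t\<bar>) ^ 3 * (1 + t\<^sup>2) \<le> (1 + \<bar>t\<bar>) ^ 3 * (1 + \<bar>t\<bar>)\<^sup>2"
    by (intro mult_left_mono) (auto simp: power2_eq_square algebra_simps)
  also have "\<dots> = (1 + \<bar>t\<bar>) ^ 5" by (simp flip: power_add)
  also have "\<dots> \<le> (2 * max 1 \<bar>t\<bar>) ^ 5" by (intro power_mono) auto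
  also have "\<dots> = 32 * max 1 \<bar>t\<bar> ^ 5" by (simp add: power_mult_distrib)
  also have "max 1 \<bar>t\<bar> ^ 5 \<le> 1 + t ^ 6"
  proof (cases "\<bar>t\<bar> \<le> 1")
    case False
    then have "\<bar>t\<bar> ^ 5 \<le> \<bar>t\<bar> ^ 6" by (intro power_increasing) auto
    then show ?thesis using False by (simp add: max_def power_even_abs)
  qed (simp add: max_def)
  finally have "(1 + \<bar>t\<bar>) ^ 3 * (1 + t\<^sup>2) \<le> 32 * (1 + t ^ 6)" by simp
  then have "(1 + \<bar>t\<bar>) ^ 3 * (1 + t\<^sup>2) * exp (- x) \<le> 32 * (1 + t ^ 6) * exp (- x)"
    by (intro mult_right_mono) auto
  also have "\<dots> = 32 * (exp (- x) + t ^ 6 * exp (- x))" by (simp add: algebra_simps)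
  also have "\<dots> \<le> 32 * (1 + 216 / \<kappa> ^ 6)" using t6 x by (intro mult_left_mono add_mono) auto
  finally have "(1 + \<bar>t\<bar>) ^ 3 * exp (- x) * (1 + t\<^sup>2) \<le> 32 * (1 + 216 / \<kappa> ^ 6)" by (simp add: mult_ac)
  moreover have "1 + t\<^sup>2 > 0" by (intro add_pos_nonneg) auto
  ultimately show ?thesis by (simp add: pos_le_divide_eq x_def)
qed

lemma continuous_on_inv_zeta_line:
  assumes "\<And>t. zeta_reg (Complex c t) \<noteq> 0" "c > 0"
  shows "continuous_on UNIV (\<lambda>t. inv_zeta (Complex c t) * gauss_kernel \<kappa> u (Complex c t))"
proof -
  have nz: "zeta_reg s \<noteq> 0" if "Re s = c" for s
    using assms(1)[of "Im s"] that by (cases s) simp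
  have A: "continuous_on {s. Re s = c} (\<lambda>s. inv_zeta s * gauss_kernel \<kappa> u s)"
    by (intro holomorphic_on_imp_continuous_on holomorphic_intros inv_zeta_holomorphic)
       (use nz assms(2) in auto)
  have B: "continuous_on UNIV (\<lambda>t. Complex c t)"
    unfolding Complex_eq by (intro continuous_intros)
  show ?thesis by (rule continuous_on_compose2[OF A B]) auto
qed

text \<open>The line Re s = 1 is reached as a limit of lines Re s = c with c > 1: the smoothed
  Mertens function does not depend on c, and the integrands are dominated uniformly for 1 < c \<le>
  2.\<close>

lemma mertens_smoothed_line_1:
  assumes \<kappa>: "\<kappa> > 0"
  shows "(\<integral>v. of_real (mertens (exp v) * normal_density u \<kappa> v) \<partial>lborel) =
     (\<integral>t. inv_zeta (Complex 1 t) * gauss_kernel \<kappa> u (Complex 1 t) \<partial>lborel) / (2 * of_real pi)"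
proof -
  obtain C where C: "C > 0" "\<And>s. 1 \<le> Re s \<Longrightarrow> Re s \<le> 2 \<Longrightarrow> norm (inv_zeta s) \<le> C * (1 + \<bar>Im s\<bar>) ^ 3"
    using inv_zeta_bound_ge_1 by blast
  define c where "c = (\<lambda>n::nat. 1 + 1 / real (Suc n))"
  define I where "I = (\<lambda>c. \<integral>t. inv_zeta (Complex c t) * gauss_kernel \<kappa> u (Complex c t) \<partial>lborel)"
  define W where "W = C * exp (2 * \<bar>u\<bar> + 2 * \<kappa>\<^sup>2) * (32 * (1 + 216 / \<kappa> ^ 6))"
  have c: "1 < c n" "c n \<le> 2" for n by (auto simp: c_def)
  have meas: "(\<lambda>t. inv_zeta (Complex a t) * gauss_kernel \<kappa> u (Complex a t)) \<in> borel_measurable lborel" if "a \<ge> 1" for a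
    using continuous_on_inv_zeta_line[of a \<kappa> u] zeta_reg_nonzero_ge_1 that
    by (auto intro!: borel_measurable_continuous_onI)
  have lim: "(\<lambda>n. I (c n)) \<longlonglongrightarrow> I 1"
    unfolding I_def
  proof (rule integral_dominated_convergence)
    show "integrable lborel (\<lambda>t. W * (1 / (1 + t\<^sup>2)))"
      by (rule integrable_mult_right[OF integrable_inverse_one_plus_square])
    show "AE t in lborel. (\<lambda>n. inv_zeta (Complex (c n) t) * gauss_kernel \<kappa> u (Complex (c n) t)) \<longlonglongrightarrow>
              inv_zeta (Complex 1 t) * gauss_kernel \<kappa> u (Complex 1 t)"
    proof (intro AE_I2)
      fix t
      have "continuous_on {s. Re s \<ge> 1} (\<lambda>s. inv_zeta s * gauss_kernel \<kappa> u s)"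
        by (intro holomorphic_on_imp_continuous_on holomorphic_intros inv_zeta_holomorphic)
           (auto simp: zeta_reg_nonzero_ge_1)
      moreover have "c \<longlonglongrightarrow> 1"
        unfolding c_def using tendsto_add[OF tendsto_const LIMSEQ_inverse_real_of_nat, of 1] by (simp add: inverse_eq_divide)
      then have "(\<lambda>n. Complex (c n) t) \<longlonglongrightarrow> Complex 1 t"
        unfolding Complex_eq by (intro tendsto_intros)
      ultimately show "(\<lambda>n. inv_zeta (Complex (c n) t) * gauss_kernel \<kappa> u (Complex (c n) t)) \<longlonglongrightarrow>
              inv_zeta (Complex 1 t) * gauss_kernel \<kappa> u (Complex 1 t)"
        by (rule continuous_on_tendsto_compose) (auto intro!: always_eventually less_imp_le[OF c(1)])
    qed
    show "AE t in lborel. norm (inv_zeta (Complex (c n) t) * gauss_kernel \<kappa> u (Complex (c n) t)) \<le> W * (1 / (1 + t\<^sup>2))" for n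
    proof (intro AE_I2)
      fix t
      have "c n * u \<le> c n * \<bar>u\<bar>" using c(1)[of n] by (intro mult_left_mono) auto
      also have "\<dots> \<le> 2 * \<bar>u\<bar>" using c(2)[of n] by (intro mult_right_mono) auto
      finally have "c n * u \<le> 2 * \<bar>u\<bar>" .
      moreover have "(c n)\<^sup>2 \<le> 2\<^sup>2" using c[of n] by (intro power_mono) auto
      then have "\<kappa>\<^sup>2 * (c n)\<^sup>2 / 2 \<le> 2 * \<kappa>\<^sup>2"
        using mult_left_mono[of "(c n)\<^sup>2" 4 "\<kappa>\<^sup>2"] by simp
      ultimately have e: "exp (c n * u + \<kappa>\<^sup>2 * (c n)\<^sup>2 / 2) \<le> exp (2 * \<bar>u\<bar> + 2 * \<kappa>\<^sup>2)" by simp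
      have "norm (inv_zeta (Complex (c n) t)) \<le> C * (1 + \<bar>t\<bar>) ^ 3"
        using C(2)[of "Complex (c n) t"] c[of n] by simp
      then have "norm (inv_zeta (Complex (c n) t) * gauss_kernel \<kappa> u (Complex (c n) t)) \<le>
          C * (1 + \<bar>t\<bar>) ^ 3 * (exp (2 * \<bar>u\<bar> + 2 * \<kappa>\<^sup>2) * exp (- (\<kappa>\<^sup>2 * t\<^sup>2) / 2))"
        unfolding norm_mult norm_gauss_kernel using e C by (intro mult_mono) auto
      also have "\<dots> = C * exp (2 * \<bar>u\<bar> + 2 * \<kappa>\<^sup>2) * ((1 + \<bar>t\<bar>) ^ 3 * exp (- (\<kappa>\<^sup>2 * t\<^sup>2) / 2))"
        by (simp add: mult_ac)
      also have "\<dots> \<le> C * exp (2 * \<bar>u\<bar> + 2 * \<kappa>\<^sup>2) * (32 * (1 + 216 / \<kappa> ^ 6) / (1 + t\<^sup>2))"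
        using C by (intro mult_left_mono cubic_gaussian_bound \<kappa>) auto
      finally show "norm (inv_zeta (Complex (c n) t) * gauss_kernel \<kappa> u (Complex (c n) t)) \<le> W * (1 / (1 + t\<^sup>2))"
        by (simp add: W_def)
    qed
  qed (use meas c in \<open>auto intro: less_imp_le\<close>)
  have "I (c n) = 2 * of_real pi * (\<integral>v. of_real (mertens (exp v) * normal_density u \<kappa> v) \<partial>lborel)" for n
  proof -
    have "I (c n) = (\<integral>t. moebius_series (Complex (c n) t) / Complex (c n) t * gauss_kernel \<kappa> u (Complex (c n) t) \<partial>lborel)"
      unfolding I_def using c[of n] by (subst moebius_series_eq_inv_zeta) auto
    then show ?thesis using mertens_smoothed[OF c(1)[of n] \<kappa>, of u] by simp
  qed
  with lim have "2 * of_real pi * (\<integral>v. of_real (mertens (exp v) * normal_density u \<kappa> v) \<partial>lborel) = I 1"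
    by (simp only: LIMSEQ_const_iff)
  then have "(\<integral>v. of_real (mertens (exp v) * normal_density u \<kappa> v) \<partial>lborel) = I 1 / (2 * of_real pi)"
    by (simp add: field_simps)
  then show ?thesis unfolding I_def .
qed

lemma mertens_exp_smallo:
  assumes e: "e > 0"
  shows "eventually (\<lambda>u. \<bar>mertens (exp u)\<bar> \<le> e * exp u) at_top"
proof -
  \<comment> \<open>The target e exp u is split into thirds, for the smoothing term 9 \<kappa> exp
    u, the constant 1 and the integral on Re s = 1.\<close>
  define \<kappa> where "\<kappa> = min 1 (e / 27)"
  have \<kappa>: "0 < \<kappa>" "\<kappa> \<le> 1" "9 * \<kappa> \<le> e / 3" using e by (auto simp: \<kappa>_def)
  obtain C where C: "C > 0" "\<And>s. 1 \<le> Re s \<Longrightarrow> Re s \<le> 2 \<Longrightarrow> norm (inv_zeta s) \<le> C * (1 + \<bar>Im s\<bar>) ^ 3"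
    using inv_zeta_bound_ge_1 by blast
  define \<phi> where "\<phi> = (\<lambda>t. inv_zeta (Complex 1 t) * gauss_kernel \<kappa> 0 (Complex 1 t))"
  have "((\<lambda>u. \<integral>t. \<phi> t * exp (\<i> * of_real (u * t)) \<partial>lborel) \<longlongrightarrow> 0) at_top"
  proof (rule riemann_lebesgue)
    show "continuous_on UNIV \<phi>"
      unfolding \<phi>_def by (intro continuous_on_inv_zeta_line zeta_reg_nonzero_ge_1) auto
    fix t
    have "norm (\<phi> t) \<le> (C * (1 + \<bar>t\<bar>) ^ 3) * (exp (\<kappa>\<^sup>2 / 2) * exp (- (\<kappa>\<^sup>2 * t\<^sup>2) / 2))"
      unfolding \<phi>_def norm_mult norm_gauss_kernel using C(2)[of "Complex 1 t"] C(1) by (intro mult_mono) auto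
    also have "\<dots> = C * exp (\<kappa>\<^sup>2 / 2) * ((1 + \<bar>t\<bar>) ^ 3 * exp (- (\<kappa>\<^sup>2 * t\<^sup>2) / 2))" by (simp add: mult_ac)
    also have "\<dots> \<le> C * exp (\<kappa>\<^sup>2 / 2) * (32 * (1 + 216 / \<kappa> ^ 6) / (1 + t\<^sup>2))"
      using C by (intro mult_left_mono cubic_gaussian_bound \<kappa>) auto
    finally show "norm (\<phi> t) \<le> C * exp (\<kappa>\<^sup>2 / 2) * (32 * (1 + 216 / \<kappa> ^ 6)) / (1 + t\<^sup>2)" by simp
  qed
  then have "eventually (\<lambda>u. dist (\<integral>t. \<phi> t * exp (\<i> * of_real (u * t)) \<partial>lborel) 0 < e / 3) at_top"
    using e by (intro tendstoD) auto
  moreover have "eventually (\<lambda>u. u \<ge> ln (3 / e)) at_top" by (rule eventually_ge_at_top)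
  ultimately show ?thesis
  proof eventually_elim
    case (elim u)
    define R where "R = (\<integral>t. \<phi> t * exp (\<i> * of_real (u * t)) \<partial>lborel)"
    have R: "norm R < e / 3" using elim(1) by (simp add: R_def)
    have "exp (ln (3 / e)) \<le> exp u" using elim(2) by simp
    then have "3 / e \<le> exp u" using e by simp
    then have 1: "1 \<le> e / 3 * exp u" using e by (simp add: field_simps)
    \<comment> \<open>On Re s = 1 the parameter u enters the kernel only through exp u, which is the
      trivial size, and through the oscillation exp (i u t), to which Riemann-Lebesgue
      applies.\<close>
    have "inv_zeta (Complex 1 t) * gauss_kernel \<kappa> u (Complex 1 t) = of_real (exp u) * (\<phi> t * exp (\<i> * of_real (u * t)))" for t
    proof -
      have "gauss_kernel \<kappa> u (Complex 1 t) = exp (of_real u) * (gauss_kernel \<kappa> 0 (Complex 1 t) * exp (\<i> * of_real (u * t)))"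
        unfolding gauss_kernel_def mult_exp_exp by (rule arg_cong[of _ _ exp]) (simp add: Complex_eq algebra_simps)
      then show ?thesis by (simp add: \<phi>_def exp_of_real mult_ac)
    qed
    then have "(\<integral>v. of_real (mertens (exp v) * normal_density u \<kappa> v) \<partial>lborel) = of_real (exp u) * R / (2 * of_real pi)"
      unfolding mertens_smoothed_line_1[OF \<kappa>(1)] R_def by simp
    then have "norm (\<integral>v. complex_of_real (mertens (exp v) * normal_density u \<kappa> v) \<partial>lborel) = exp u * norm R / (2 * pi)"
      by (simp add: norm_mult norm_divide)
    also have "\<dots> \<le> exp u * norm R / 1" using pi_gt3 by (intro divide_left_mono) auto
    also have "\<dots> \<le> exp u * (e / 3)" using R by simp
    finally have S: "norm (\<integral>v. complex_of_real (mertens (exp v) * normal_density u \<kappa> v) \<partial>lborel) \<le> exp u * (e / 3)" .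
    have "norm (complex_of_real (mertens (exp u))) \<le> 1 + 9 * \<kappa> * exp u + exp u * (e / 3)"
      using mertens_smoothing_error[OF \<kappa>(1,2), of u] S
        norm_triangle_ineq2[of "complex_of_real (mertens (exp u))" "\<integral>v. complex_of_real (mertens (exp v) * normal_density u \<kappa> v) \<partial>lborel"]
      by linarith
    moreover have "9 * \<kappa> * exp u \<le> e / 3 * exp u" using \<kappa> by (intro mult_right_mono) auto
    moreover have "e * exp u = e / 3 * exp u + e / 3 * exp u + exp u * (e / 3)" by simp
    ultimately show ?case using 1 unfolding norm_of_real by linarith
  qed
qed

lemma mertens_smallo: "mertens \<in> o[at_top](\<lambda>x. x)"
proof (rule landau_o.smallI)
  fix c :: real assume "c > 0"
  from eventually_compose_filterlim[OF mertens_exp_smallo[OF this] ln_at_top]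
  have "eventually (\<lambda>x. \<bar>mertens (exp (ln x))\<bar> \<le> c * exp (ln x)) at_top" .
  then show "eventually (\<lambda>x. norm (mertens x) \<le> c * norm x) at_top"
    using eventually_gt_at_top[of 0] by eventually_elim simp
qed

section \<open>The bound under the Riemann hypothesis\<close>

text \<open>Connects the integrals over finite intervals, as produced by contour integration, with
  the Lebesgue integral over the line.\<close>

lemma tendsto_integral_symmetric:
  fixes f :: "real \<Rightarrow> complex"
  assumes f: "integrable lborel f" and cont: "continuous_on UNIV f"
  shows "(\<lambda>n. integral {- real (Suc n)..real (Suc n)} f) \<longlonglongrightarrow> (\<integral>t. f t \<partial>lborel)"
proof -
  have "integral {- real (Suc n)..real (Suc n)} f = (\<integral>t. indicator {- real (Suc n)..real (Suc n)} t *\<^sub>R f t \<partial>lborel)" for n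
  proof -
    have "set_integrable lborel {- real (Suc n)..real (Suc n)} f"
      using f by (intro integrable_mult_indicator[of _ lborel f, folded set_integrable_def]) auto
    from set_borel_integral_eq_integral(2)[OF this] show ?thesis by (simp add: set_lebesgue_integral_def)
  qed
  moreover have "(\<lambda>n. \<integral>t. indicator {- real (Suc n)..real (Suc n)} t *\<^sub>R f t \<partial>lborel) \<longlonglongrightarrow> (\<integral>t. f t \<partial>lborel)"
  proof (rule integral_dominated_convergence[where w = "\<lambda>t. norm (f t)"])
    show "AE t in lborel. (\<lambda>n. indicator {- real (Suc n)..real (Suc n)} t *\<^sub>R f t) \<longlonglongrightarrow> f t"
    proof (intro AE_I2 tendsto_eventually)
      fix t :: real
      obtain N where N: "\<bar>t\<bar> \<le> real N" using real_arch_simple by blast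
      show "eventually (\<lambda>n. indicator {- real (Suc n)..real (Suc n)} t *\<^sub>R f t = f t) sequentially"
        using eventually_ge_at_top[of N]
      proof eventually_elim
        case (elim n)
        then have "\<bar>t\<bar> \<le> real (Suc n)" using N by linarith
        then show ?case by (auto simp: indicator_def abs_le_iff)
      qed
    qed
  qed (use f borel_measurable_continuous_onI[OF cont] in \<open>auto simp: indicator_def\<close>)
  ultimately show ?thesis by simp
qed

text \<open>Cauchy's theorem on the rectangle between the two lines and the heights -T and T; the
  horizontal sides contribute at most 2 (b - a) B(T), which tends to 0.\<close>

lemma vertical_integral_shift:
  fixes f :: "complex \<Rightarrow> complex" and a b :: real
  assumes "a < b"
    and f: "f holomorphic_on A" "{s. a \<le> Re s \<and> Re s \<le> b} \<subseteq> A"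
    and int: "integrable lborel (\<lambda>t. f (Complex a t))" "integrable lborel (\<lambda>t. f (Complex b t))"
    and bound: "\<And>s. a \<le> Re s \<Longrightarrow> Re s \<le> b \<Longrightarrow> norm (f s) \<le> B \<bar>Im s\<bar>" and B: "(B \<longlongrightarrow> 0) at_top"
  shows "(\<integral>t. f (Complex a t) \<partial>lborel) = (\<integral>t. f (Complex b t) \<partial>lborel)"
proof -
  define S where "S = {s. a \<le> Re s \<and> Re s \<le> b}"
  have S: "convex S"
  proof -
    have "S = {s. a \<le> Re s} \<inter> {s. Re s \<le> b}" by (auto simp: S_def)
    then show ?thesis by (simp add: convex_Int convex_halfspace_Re_le convex_halfspace_Re_ge)
  qed
  have fS: "f holomorphic_on S" using f by (auto simp: S_def intro: holomorphic_on_subset)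
  have cont: "continuous_on S f" by (rule holomorphic_on_imp_continuous_on[OF fS])
  have line: "continuous_on UNIV (\<lambda>t. f (Complex c t))" if "a \<le> c" "c \<le> b" for c
  proof -
    have "continuous_on UNIV (\<lambda>t. Complex c t)" unfolding Complex_eq by (intro continuous_intros)
    then show ?thesis by (rule continuous_on_compose2[OF cont]) (use that in \<open>auto simp: S_def\<close>)
  qed
  define V where "V = (\<lambda>c n. integral {- real (Suc n)..real (Suc n)} (\<lambda>t. f (Complex c t)))"
  have diff: "norm (V b n - V a n) \<le> 2 * (b - a) * B (real (Suc n))" for n
  proof -
    define T where "T = real (Suc n)"
    have T: "T > 0" by (simp add: T_def)
    define p1 p2 p3 p4 where "p1 = Complex a (- T)" and "p2 = Complex b (- T)" and "p3 = Complex b T" and "p4 = Complex a T"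
    note p = p1_def p2_def p3_def p4_def
    have pS: "p1 \<in> S" "p2 \<in> S" "p3 \<in> S" "p4 \<in> S" using \<open>a < b\<close> by (auto simp: S_def p)
    have seg: "closed_segment x y \<subseteq> S" if "x \<in> S" "y \<in> S" for x y
      using S that by (simp add: closed_segment_subset)
    have ci: "f contour_integrable_on linepath x y" if "x \<in> S" "y \<in> S" for x y
      using continuous_on_subset[OF cont seg[OF that]] by (rule contour_integrable_continuous_linepath)
    have "(f has_contour_integral 0) (linepath p1 p2 +++ linepath p2 p3 +++ linepath p3 p4 +++ linepath p4 p1)"
      by (rule Cauchy_theorem_convex_simple[OF fS S]) (use seg pS in \<open>auto simp: path_image_join\<close>)
    moreover have "(f has_contour_integral (contour_integral (linepath p1 p2) f + (contour_integral (linepath p2 p3) f +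
         (contour_integral (linepath p3 p4) f + contour_integral (linepath p4 p1) f))))
         (linepath p1 p2 +++ linepath p2 p3 +++ linepath p3 p4 +++ linepath p4 p1)"
      by (intro has_contour_integral_join has_contour_integral_integral ci pS) auto
    ultimately have "contour_integral (linepath p1 p2) f + (contour_integral (linepath p2 p3) f +
         (contour_integral (linepath p3 p4) f + contour_integral (linepath p4 p1) f)) = 0"
      by (rule has_contour_integral_unique[rotated])
    moreover have "contour_integral (linepath p2 p3) f = \<i> * V b n"
      unfolding V_def T_def [symmetric] using T by (intro contour_integral_linepath_same_Re) (auto simp: p)
    moreover have "contour_integral (linepath p4 p1) f = - (\<i> * V a n)"
    proof -
      have "contour_integral (linepath p1 p4) f = \<i> * V a n"
        unfolding V_def T_def [symmetric] using T by (intro contour_integral_linepath_same_Re) (auto simp: p)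
      then show ?thesis
        using contour_integral_reverse_linepath[of p4 p1 f] continuous_on_subset[OF cont seg[OF pS(4,1)]] by simp
    qed
    ultimately have "\<i> * (V b n - V a n) = - (contour_integral (linepath p1 p2) f + contour_integral (linepath p3 p4) f)"
      by (simp add: algebra_simps add_eq_0_iff)
    then have "norm (V b n - V a n) = norm (contour_integral (linepath p1 p2) f + contour_integral (linepath p3 p4) f)"
      by (metis norm_minus_cancel norm_mult norm_ii mult_1)
    also have "\<dots> \<le> norm (contour_integral (linepath p1 p2) f) + norm (contour_integral (linepath p3 p4) f)"
      by (rule norm_triangle_ineq)
    also have "\<dots> \<le> B T * norm (p2 - p1) + B T * norm (p4 - p3)"
    proof (intro add_mono contour_integral_bound_linepath ci pS)
      show "0 \<le> B T" using order_trans[OF norm_ge_zero bound[of p1]] \<open>a < b\<close> T by (simp add: p)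
      then show "0 \<le> B T" .
      fix x assume "x \<in> closed_segment p1 p2"
      moreover from this have "Im x = - T" by (auto simp: p closed_segment_same_Im)
      ultimately show "norm (f x) \<le> B T" using bound[of x] seg[OF pS(1,2)] T by (auto simp: S_def)
    next
      fix x assume "x \<in> closed_segment p3 p4"
      moreover from this have "Im x = T" by (auto simp: p closed_segment_same_Im)
      ultimately show "norm (f x) \<le> B T" using bound[of x] seg[OF pS(3,4)] T by (auto simp: S_def)
    qed
    also have "norm (p2 - p1) = b - a" using \<open>a < b\<close> by (simp add: p cmod_def)
    also have "norm (p4 - p3) = b - a" using \<open>a < b\<close> by (simp add: p cmod_def)
    finally show ?thesis by (simp add: T_def algebra_simps)
  qed
  have "(\<lambda>n. V b n - V a n) \<longlonglongrightarrow> 0"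
  proof (rule Lim_null_comparison)
    show "eventually (\<lambda>n. norm (V b n - V a n) \<le> 2 * (b - a) * B (real (Suc n))) sequentially"
      using diff by simp
    have "(\<lambda>n. B (real (Suc n))) \<longlonglongrightarrow> 0"
      by (intro filterlim_compose[OF B] filterlim_compose[OF filterlim_real_sequentially] filterlim_Suc)
    then show "(\<lambda>n. 2 * (b - a) * B (real (Suc n))) \<longlonglongrightarrow> 0"
      by (rule tendsto_mult_right_zero)
  qed
  moreover have "(\<lambda>n. V b n - V a n) \<longlonglongrightarrow> (\<integral>t. f (Complex b t) \<partial>lborel) - (\<integral>t. f (Complex a t) \<partial>lborel)"
    unfolding V_def using \<open>a < b\<close> by (intro tendsto_diff tendsto_integral_symmetric int line) auto
  ultimately show ?thesis using LIMSEQ_unique by fastforce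
qed

text \<open>The integral over the half-line is explicit, and w is built by reflecting that half. The
  reflection counts t = 0 twice, hence a majorant rather than an equality.\<close>

lemma powr_majorant:
  fixes \<epsilon> :: real
  assumes "\<epsilon> > 0"
  obtains w :: "real \<Rightarrow> real" where "integrable lborel w" "\<And>t. (1 + \<bar>t\<bar>) powr (- 1 - \<epsilon>) \<le> w t" "\<And>t. w t \<ge> 0"
proof -
  define q where "q = (\<lambda>t::real. indicator {0..} t * (1 + \<bar>t\<bar>) powr (- 1 - \<epsilon>))"
  have q0: "q t \<ge> 0" for t by (simp add: q_def)
  have lim: "((\<lambda>t. - ((1 + t) powr (- \<epsilon>)) / \<epsilon>) \<longlongrightarrow> 0) at_top"
    using assms by real_asymp
  have "(\<integral>\<^sup>+t. ennreal ((1 + \<bar>t\<bar>) powr (- 1 - \<epsilon>)) * indicator {0..} t \<partial>lborel) = 0 - (- ((1 + 0) powr (- \<epsilon>)) / \<epsilon>)"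
  proof (rule nn_integral_FTC_atLeast[OF _ _ _ lim])
    fix x :: real assume "0 \<le> x"
    have "((\<lambda>t. 1 + t) has_real_derivative 1) (at x)"
      by (auto intro!: derivative_eq_intros)
    from DERIV_fun_powr[OF this, of "- \<epsilon>"] \<open>0 \<le> x\<close>
    have "((\<lambda>t. (1 + t) powr (- \<epsilon>)) has_real_derivative (- \<epsilon>) * (1 + x) powr (- \<epsilon> - 1) * 1) (at x)"
      by simp
    from DERIV_cdivide[OF DERIV_minus[OF this], of \<epsilon>]
    show "((\<lambda>t. - ((1 + t) powr (- \<epsilon>)) / \<epsilon>) has_real_derivative (1 + \<bar>x\<bar>) powr (- 1 - \<epsilon>)) (at x)"
    proof (rule DERIV_cong)
      have e: "(1 + x) powr (- \<epsilon> - 1) = (1 + \<bar>x\<bar>) powr (- 1 - \<epsilon>)"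
        using \<open>0 \<le> x\<close> by (intro arg_cong2[of _ _ _ _ "(powr)"]) auto
      show "- (- \<epsilon> * (1 + x) powr (- \<epsilon> - 1) * 1) / \<epsilon> = (1 + \<bar>x\<bar>) powr (- 1 - \<epsilon>)"
        unfolding e using assms by simp
    qed
  qed auto
  then have *: "(\<integral>\<^sup>+t. ennreal (q t) \<partial>lborel) = ennreal (1 / \<epsilon>)"
    by (simp add: q_def ennreal_mult' mult.commute ennreal_indicator)
  have qi: "integrable lborel q"
    by (rule integrableI_nn_integral_finite[OF _ _ *]) (use q0 assms in \<open>auto simp: q_def[abs_def]\<close>)
  show ?thesis
  proof (rule that[of "\<lambda>t. q t + q (- t)"])
    show "integrable lborel (\<lambda>t. q t + q (- t))"
      using lborel_integrable_real_affine[OF qi, of "- 1" 0] qi by simp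
    show "(1 + \<bar>t\<bar>) powr (- 1 - \<epsilon>) \<le> q t + q (- t)" for t
      using q0[of t] q0[of "- t"] by (cases "t \<ge> 0") (auto simp: q_def indicator_def)
  qed (use q0 in auto)
qed

text \<open>The Gaussian cuts off at |t| of order 1 / \<kappa>, where the power has order
  \<kappa>^(-2 \<epsilon>). With z = 1 + \<kappa> |t|, which is at least \<kappa> (1 + |t|) because
  \<kappa> \<le> 1, the claim reduces to z^2 \<le> 4 exp (\<kappa>^2 t^2 / 2).\<close>

lemma powr_gaussian_le:
  fixes \<kappa> \<epsilon> t :: real
  assumes "0 < \<kappa>" "\<kappa> \<le> 1" "0 < \<epsilon>" "\<epsilon> \<le> 1"
  shows "(1 + \<bar>t\<bar>) powr (2 * \<epsilon>) * exp (- (\<kappa>\<^sup>2 * t\<^sup>2) / 2) \<le> 4 * \<kappa> powr (- (2 * \<epsilon>))"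
proof -
  define z where "z = 1 + \<kappa> * \<bar>t\<bar>"
  have z: "z \<ge> 1" using assms by (simp add: z_def)
  have "(\<kappa> * (1 + \<bar>t\<bar>)) powr (2 * \<epsilon>) \<le> z powr (2 * \<epsilon>)"
    using assms by (intro powr_mono2) (auto simp: z_def algebra_simps)
  also have "\<dots> \<le> z powr 2" using z assms by (intro powr_mono) auto
  also have "\<dots> = z\<^sup>2" using z by simp
  also have "\<dots> \<le> 4 * (1 + \<kappa>\<^sup>2 * t\<^sup>2 / 2)"
  proof -
    have "0 \<le> (1 - \<kappa> * \<bar>t\<bar>)\<^sup>2" by simp
    then show ?thesis by (simp add: z_def power2_eq_square algebra_simps)
  qed
  also have "\<dots> \<le> 4 * exp (\<kappa>\<^sup>2 * t\<^sup>2 / 2)"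
    by (intro mult_left_mono exp_ge_add_one_self) auto
  finally have "\<kappa> powr (2 * \<epsilon>) * (1 + \<bar>t\<bar>) powr (2 * \<epsilon>) \<le> 4 * exp (\<kappa>\<^sup>2 * t\<^sup>2 / 2)"
    using assms by (simp add: powr_mult)
  then show ?thesis using assms by (simp add: powr_minus exp_minus field_simps)
qed

lemma mertens_bound_RH:
  fixes \<delta> :: real
  assumes RH: riemann_hypothesis and \<delta>: "\<delta> > 0"
  shows "\<exists>K>0. \<forall>y\<ge>1. \<bar>mertens y\<bar> \<le> K * y powr (1/2 + \<delta>)"
proof -
  \<comment> \<open>The excess d in the exponent is spent in halves: d / 2 on keeping the line b to
    the right of 1/2, and 2 \<epsilon> = d / 2 on the Gaussian cutoff. The cap keeps b below
    1.\<close>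
  define d where "d = min \<delta> (1/2)"
  define b where "b = 1/2 + d / 2"
  define \<epsilon> where "\<epsilon> = d / 4"
  have d: "0 < d" "d \<le> 1/2" "d \<le> \<delta>" using \<delta> by (auto simp: d_def)
  have b: "1/2 < b" "b \<le> 1" "b < 2" and \<epsilon>: "0 < \<epsilon>" "\<epsilon> \<le> 1" and b\<epsilon>: "b + 2 * \<epsilon> = 1/2 + d"
    using d by (auto simp: b_def \<epsilon>_def)
  obtain C where C: "C > 0" "\<And>s. b \<le> Re s \<Longrightarrow> Re s \<le> 2 \<Longrightarrow> norm (inv_zeta s) \<le> C * (1 + \<bar>Im s\<bar>) powr (\<epsilon> - 1)"
    using inverse_zeta_growth_RH[OF RH b(1,2) \<epsilon>(1)] unfolding inv_zeta_def by blast
  obtain w where w: "integrable lborel w" "\<And>t. (1 + \<bar>t\<bar>) powr (- 1 - \<epsilon>) \<le> w t" "\<And>t. w t \<ge> 0"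
    using powr_majorant[OF \<epsilon>(1)] by blast
  define W where "W = (\<integral>t. w t \<partial>lborel)"
  have W: "W \<ge> 0" unfolding W_def using w(3) by (intro integral_nonneg_AE) auto
  \<comment> \<open>For moving the line a bound without decay is enough, since the Gaussian supplies
    the decay; the power of 1 + |Im s| is exploited only on Re s = b.\<close>
  have C': "norm (inv_zeta s) \<le> C" if "b \<le> Re s" "Re s \<le> 2" for s
  proof -
    have "(1 + \<bar>Im s\<bar>) powr (\<epsilon> - 1) \<le> 1" using \<epsilon> powr_mono[of "\<epsilon> - 1" 0 "1 + \<bar>Im s\<bar>"] by (auto split: if_splits)
    then have "C * (1 + \<bar>Im s\<bar>) powr (\<epsilon> - 1) \<le> C * 1" using C by (intro mult_left_mono) auto
    then show ?thesis using C(2)[OF that] by simp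
  qed
  have nz: "zeta_reg s \<noteq> 0" if "b \<le> Re s" for s using zeta_reg_nonzero_RH[OF RH, of s] that b by auto
  \<comment> \<open>The 10 is the smoothing error 1 + 9 \<kappa> exp u at \<kappa> = exp (-
    u).\<close>
  define K where "K = 10 + exp 1 * 4 * C * W"
  have K: "K > 0" using C W by (auto simp: K_def intro!: add_pos_nonneg)
  have main: "\<bar>mertens (exp u)\<bar> \<le> K * exp u powr (1/2 + d)" if u: "u \<ge> 0" for u
  proof -
    define \<kappa> where "\<kappa> = exp (- u)"
    have \<kappa>: "0 < \<kappa>" "\<kappa> \<le> 1" using u by (auto simp: \<kappa>_def)
    define f where "f = (\<lambda>s. inv_zeta s * gauss_kernel \<kappa> u s)"
    define E where "E = exp (2 * u + 2 * \<kappa>\<^sup>2)"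
    have fb: "norm (f s) \<le> C * E * exp (- (\<kappa>\<^sup>2 * (Im s)\<^sup>2) / 2)" if s: "b \<le> Re s" "Re s \<le> 2" for s
    proof -
      have "norm (gauss_kernel \<kappa> u s) = exp (Re s * u + \<kappa>\<^sup>2 * (Re s)\<^sup>2 / 2) * exp (- (\<kappa>\<^sup>2 * (Im s)\<^sup>2) / 2)"
        using norm_gauss_kernel[of \<kappa> u "Re s" "Im s"] by simp
      moreover have "Re s * u \<le> 2 * u" using s u by (intro mult_right_mono) auto
      moreover have "(Re s)\<^sup>2 \<le> 2\<^sup>2" using s b by (intro power_mono) auto
      then have "\<kappa>\<^sup>2 * (Re s)\<^sup>2 / 2 \<le> 2 * \<kappa>\<^sup>2" using mult_left_mono[of "(Re s)\<^sup>2" 4 "\<kappa>\<^sup>2"] by simp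
      ultimately have "norm (gauss_kernel \<kappa> u s) \<le> E * exp (- (\<kappa>\<^sup>2 * (Im s)\<^sup>2) / 2)"
        unfolding E_def by (auto intro!: mult_right_mono)
      then have "norm (f s) \<le> C * (E * exp (- (\<kappa>\<^sup>2 * (Im s)\<^sup>2) / 2))"
        unfolding f_def norm_mult using C'[OF s] C by (intro mult_mono) auto
      then show ?thesis by simp
    qed
    have int: "integrable lborel (\<lambda>t. f (Complex c t))" if c: "b \<le> c" "c \<le> 2" for c
    proof (rule Bochner_Integration.integrable_bound)
      show "integrable lborel (\<lambda>t. C * E * exp (- (\<kappa>\<^sup>2 * t\<^sup>2) / 2))"
        by (intro integrable_mult_right gaussian_fourier(1) \<kappa>)
      show "(\<lambda>t. f (Complex c t)) \<in> borel_measurable lborel"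
        using continuous_on_inv_zeta_line[of c \<kappa> u] nz c b by (auto simp: f_def intro!: borel_measurable_continuous_onI)
      show "AE t in lborel. norm (f (Complex c t)) \<le> norm (C * E * exp (- (\<kappa>\<^sup>2 * t\<^sup>2) / 2))"
        using fb[of "Complex c _"] c C by (auto simp: E_def)
    qed
    have "(\<integral>t. f (Complex b t) \<partial>lborel) = (\<integral>t. f (Complex 2 t) \<partial>lborel)"
    proof (rule vertical_integral_shift)
      show "f holomorphic_on {s. b \<le> Re s}"
        unfolding f_def by (intro holomorphic_intros inv_zeta_holomorphic) (use nz b in auto)
      show "norm (f s) \<le> C * E * exp (- (\<kappa>\<^sup>2 * \<bar>Im s\<bar>\<^sup>2) / 2)" if "b \<le> Re s" "Re s \<le> 2" for s
        using fb[OF that] by simp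
      have "((\<lambda>x. exp (- (k * x\<^sup>2) / 2)) \<longlongrightarrow> 0) at_top" if "k > 0" for k :: real
        using that by real_asymp
      then show "((\<lambda>x. C * E * exp (- (\<kappa>\<^sup>2 * x\<^sup>2) / 2)) \<longlongrightarrow> 0) at_top"
        using \<kappa> by (intro tendsto_mult_right_zero) auto
    qed (use b int in auto)
    moreover have "(\<integral>v. of_real (mertens (exp v) * normal_density u \<kappa> v) \<partial>lborel) =
        (\<integral>t. f (Complex 2 t) \<partial>lborel) / (2 * of_real pi)"
      using mertens_smoothed[of 2 \<kappa> u] \<kappa> moebius_series_eq_inv_zeta[of "Complex 2 _"] by (simp add: f_def)
    ultimately have "norm (\<integral>v. complex_of_real (mertens (exp v) * normal_density u \<kappa> v) \<partial>lborel) =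
        norm (\<integral>t. f (Complex b t) \<partial>lborel) / (2 * pi)"
      by (simp add: norm_divide norm_mult)
    also have "\<dots> \<le> norm (\<integral>t. f (Complex b t) \<partial>lborel) / 1"
      using pi_gt3 by (intro divide_left_mono) auto
    also have "\<dots> \<le> (\<integral>t. (exp (b * u + 1) * 4 * C * \<kappa> powr (- (2 * \<epsilon>))) * w t \<partial>lborel)"
      unfolding div_by_1
    proof (rule Bochner_Integration.integral_norm_bound_integral)
      show "integrable lborel (\<lambda>t. f (Complex b t))" using b by (intro int) auto
      show "integrable lborel (\<lambda>t. (exp (b * u + 1) * 4 * C * \<kappa> powr (- (2 * \<epsilon>))) * w t)"
        by (intro integrable_mult_right w)
      fix t :: real
      define y where "y = 1 + \<bar>t\<bar>"
      have y: "y > 0" by (simp add: y_def)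
      have "\<kappa>\<^sup>2 * b\<^sup>2 \<le> 1 * 1" using \<kappa> b by (intro mult_mono power_le_one) auto
      then have e: "exp (b * u + \<kappa>\<^sup>2 * b\<^sup>2 / 2) \<le> exp (b * u + 1)" by simp
      have "norm (f (Complex b t)) \<le> (C * y powr (\<epsilon> - 1)) * (exp (b * u + 1) * exp (- (\<kappa>\<^sup>2 * t\<^sup>2) / 2))"
        unfolding f_def norm_mult norm_gauss_kernel using C(2)[of "Complex b t"] C(1) b e
        by (intro mult_mono) (auto simp: y_def)
      \<comment> \<open>The exponent \<epsilon> - 1 is not integrable. Splitting off y^(2
        \<epsilon>) leaves the integrable -1 - \<epsilon>, and the Gaussian holds the split-off
        power below 4 \<kappa>^(-2 \<epsilon>) = 4 exp (2 \<epsilon> u).\<close>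
      also have "y powr (\<epsilon> - 1) = y powr (- 1 - \<epsilon>) * y powr (2 * \<epsilon>)"
        by (simp flip: powr_add)
      also have "C * (y powr (- 1 - \<epsilon>) * y powr (2 * \<epsilon>)) * (exp (b * u + 1) * exp (- (\<kappa>\<^sup>2 * t\<^sup>2) / 2)) =
          C * exp (b * u + 1) * (y powr (- 1 - \<epsilon>) * (y powr (2 * \<epsilon>) * exp (- (\<kappa>\<^sup>2 * t\<^sup>2) / 2)))"
        by (simp add: mult_ac)
      also have "\<dots> \<le> C * exp (b * u + 1) * (w t * (4 * \<kappa> powr (- (2 * \<epsilon>))))"
      proof (rule mult_left_mono)
        show "y powr (- 1 - \<epsilon>) * (y powr (2 * \<epsilon>) * exp (- (\<kappa>\<^sup>2 * t\<^sup>2) / 2)) \<le>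
            w t * (4 * \<kappa> powr (- (2 * \<epsilon>)))"
          by (rule mult_mono) (use w powr_gaussian_le[OF \<kappa> \<epsilon>, of t] in \<open>auto simp: y_def\<close>)
      qed (use C in auto)
      finally show "norm (f (Complex b t)) \<le> (exp (b * u + 1) * 4 * C * \<kappa> powr (- (2 * \<epsilon>))) * w t"
        by (simp add: mult_ac)
    qed
    also have "\<dots> = exp (b * u + 1) * 4 * C * \<kappa> powr (- (2 * \<epsilon>)) * W" by (simp add: W_def)
    also have "\<dots> = exp 1 * 4 * C * W * (exp (b * u) * \<kappa> powr (- (2 * \<epsilon>)))"
      by (simp add: exp_add mult_ac)
    also have "exp (b * u) * \<kappa> powr (- (2 * \<epsilon>)) = exp u powr (1/2 + d)"
      unfolding b\<epsilon> [symmetric] by (simp add: \<kappa>_def powr_def algebra_simps flip: exp_add)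
    finally have S: "norm (\<integral>v. complex_of_real (mertens (exp v) * normal_density u \<kappa> v) \<partial>lborel)
        \<le> exp 1 * 4 * C * W * exp u powr (1/2 + d)" .
    have "norm (complex_of_real (mertens (exp u))) \<le> 1 + 9 * \<kappa> * exp u + exp 1 * 4 * C * W * exp u powr (1/2 + d)"
      using mertens_smoothing_error[OF \<kappa>, of u] S
        norm_triangle_ineq2[of "complex_of_real (mertens (exp u))" "\<integral>v. complex_of_real (mertens (exp v) * normal_density u \<kappa> v) \<partial>lborel"]
      by linarith
    also have "9 * \<kappa> * exp u = 9" by (simp add: \<kappa>_def flip: exp_add)
    also have "1 + 9 + exp 1 * 4 * C * W * exp u powr (1/2 + d) \<le> K * exp u powr (1/2 + d)"
    proof -
      have "1 \<le> exp u powr (1/2 + d)" using u d by (intro ge_one_powr_ge_zero) auto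
      then show ?thesis by (simp add: K_def algebra_simps)
    qed
    finally show ?thesis by simp
  qed
  show ?thesis
  proof (intro exI[of _ K] conjI allI impI K)
    fix y :: real assume y: "y \<ge> 1"
    have "\<bar>mertens y\<bar> \<le> K * y powr (1/2 + d)" using main[of "ln y"] y by simp
    also have "\<dots> \<le> K * y powr (1/2 + \<delta>)" using K d y by (intro mult_left_mono powr_mono) auto
    finally show "\<bar>mertens y\<bar> \<le> K * y powr (1/2 + \<delta>)" .
  qed
qed

theorem theorem1p1:
  shows "(\<exists>f :: nat \<Rightarrow> complex.
            resembles_moebius f \<and> (\<forall>n\<ge>1. f n \<in> {-1, 0, 1}) \<and>
            partial_sums f \<in> o[at_top](\<lambda>x. complex_of_real (sqrt x))) \<and>
         (riemann_hypothesis \<longrightarrow>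
            (\<exists>f :: nat \<Rightarrow> complex.
               resembles_moebius f \<and>
               (\<forall>\<epsilon>>0. partial_sums f \<in> o[at_top](\<lambda>x. complex_of_real (x powr (2/5 + \<epsilon>))))))"
proof (intro conjI impI)
  have "complex_of_int (sqfree_chi n) \<in> {- 1, 0, 1}" for n using sqfree_chi_in[of n] by auto
  then show "\<exists>f :: nat \<Rightarrow> complex. resembles_moebius f \<and> (\<forall>n\<ge>1. f n \<in> {-1, 0, 1}) \<and>
      partial_sums f \<in> o[at_top](\<lambda>x. complex_of_real (sqrt x))"
    using resembles_moebius_sqfree_chi sqfree_chi_unconditional[OF mertens_smallo] by blast
  assume RH: riemann_hypothesis
  show "\<exists>f :: nat \<Rightarrow> complex. resembles_moebius f \<and>
      (\<forall>\<epsilon>>0. partial_sums f \<in> o[at_top](\<lambda>x. complex_of_real (x powr (2/5 + \<epsilon>))))"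
    using resembles_moebius_sqfree_chi sqfree_chi_conditional[OF mertens_bound_RH[OF RH]] by blast
qed

end
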